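(* Let $T>0$, $\alpha,\lambda,\sigma>0$, let $\mathscr{E}:H\to\mathbb{R}$ be an admissible objective, suppose the active-subspace condition holds for $(V,Q,\mathscr{E},\xi)$, and let $M_0:=\mathbb{E}[\|\xi\|_H^2]<\infty$ and $R>0$ with $R^2>M_0$. Suppose $\lambda>2\sigma^2L_{\mathsf{D}}^2$. Let $T_1\in(0,T]$ be such that $\Phi$ maps $\mathscr{C}_{T_0,R}$ into itself for all $T_0\in(0,T_1]$. Then there exists a time horizon $T_0\in(0,T_1]$ such that the map $\Phi$ is a strict contraction on $\mathscr{C}_{T_0,R}$ with respect to the metric $\mathsf{d}_{\mathscr{C}_{T_0}}$.
   Context: $H$ is an infinite-dimensional real separable Hilbert space with inner product $\langle\cdot,\cdot\rangle_H$ and norm $\|\cdot\|_H$. $Q:H\to H$ is a symmetric, positive semi-definite, trace-class operator; $W^Q$ is an $H$-valued $Q$-Wiener process on a filtered probability space satisfying the usual conditions; $\xi$ is an $\mathcal{F}_0$-measurable $H$-valued random variable. Admissible objective: $\mathscr{E}:H\to\mathbb{R}$ is an admissible objective if there exist an exponent $p\ge1$ and constants $C_{\mathscr{E}},c,R_0,L>0$ such that (1) $\inf_{x\in H}\mathscr{E}(x)\ge0$; (2) $\mathscr{E}(x)\le C_{\mathscr{E}}(1+\|x\|_H^p)$ for all $x\in H$; (3) $\mathscr{E}(x)\ge c\|x\|_H^p$ whenever $\|x\|_H>R_0$; (4) $|\mathscr{E}(x)-\mathscr{E}(y)|\le L(1+\|x\|_H^{p-1}+\|y\|_H^{p-1})\|x-y\|_H$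 for all $x,y\in H$. Active-subspace condition for $(V,Q,\mathscr{E},\xi)$: $V\subset H$ is a linear subspace of finite dimension $d<\infty$, $H=V\oplus V^\perp$; the global minimizer $x^*$ of $\mathscr{E}$ lies in $V$; $\mathrm{Law}(\xi)$ is supported on $V$; and there is $\lambda_{\min}>0$ with $\langle v,Qv\rangle_H\ge\lambda_{\min}\|v\|_H^2$ for all $v\in V$. $\mathsf{D}(x)=\|x\|_H\,\mathsf{P}_V$, with $\mathsf{P}_V$ the orthogonal projection onto $V$; $L_{\mathsf{D}}:=\mathrm{Tr}(\mathsf{P}_VQ\mathsf{P}_V)^{1/2}$. $\mathscr{P}_2(V)$ is the space of probability measures supported on $V$ with finite second moment, with the 2-Wasserstein distance $\mathcal{W}_2$. $\mathfrak{m}_\alpha(\mu)=\dfrac{\int x\,e^{-\alpha\mathscr{E}(x)}\,\mu(dx)}{\int e^{-\alpha\mathscr{E}(x)}\,\mu(dx)}$. For $T_0\in(0,T]$, $$\mathscr{C}_{T_0,R}=\Big\{\boldsymbol{\mu}=(\mu_t)_{t\in[0,T_0]}\in C([0,T_0];\mathscr{P}_2(V)):\ \sup_{0\le t\le T_0}\int_V\|x\|_H^2\,\mu_t(dx)\le R^2\Big\},$$ with metric $\mathsf{d}_{\mathscr{C}_{T_0}}(\boldsymbol{\mu},\boldsymbol{\nu})=\sup_{0\le t\le T_0}\mathcal{W}_2(\mu_t,\nu_t)$. For a flow $\boldsymbol{\mu}\in C([0,T_0];\mathscr{P}_2(V))$, $X^{\boldsymbol{\mu}}$ is the unique strong solution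 on $[0,T_0]$ of the decoupled SDE $$dX^{\boldsymbol{\mu}}_t=-\lambda\big(X^{\boldsymbol{\mu}}_t-\mathfrak{m}_\alpha(\mu_t)\big)\,dt+\sigma\,\mathsf{D}\big(X^{\boldsymbol{\mu}}_t-\mathfrak{m}_\alpha(\mu_t)\big)\,dW_t^Q,\qquad X^{\boldsymbol{\mu}}_0=\xi,$$ and $\Phi(\boldsymbol{\mu})_t=\mathrm{Law}(X^{\boldsymbol{\mu}}_t)$. Strict contraction means: there is $\kappa\in[0,1)$ with $\mathsf{d}_{\mathscr{C}_{T_0}}(\Phi(\boldsymbol{\mu}),\Phi(\boldsymbol{\nu}))\le\kappa\,\mathsf{d}_{\mathscr{C}_{T_0}}(\boldsymbol{\mu},\boldsymbol{\nu})$ for all $\boldsymbol{\mu},\boldsymbol{\nu}\in\mathscr{C}_{T_0,R}$. *)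

theory Defs
  imports "HOL-Probability.Probability"
begin

text \<open>Throughout, the sort \<open>{real_inner, banach, second_countable_topology}\<close> is the class of
  real separable Hilbert spaces; infinite dimension is a separate predicate.\<close>

definition infinite_dimensional :: "'h::real_vector itself \<Rightarrow> bool" where
  "infinite_dimensional _ \<longleftrightarrow> (\<forall>B::'h set. finite B \<longrightarrow> span B \<noteq> UNIV)"


section \<open>Operators\<close>

definition orthonormal_basis :: "'h::real_inner set \<Rightarrow> bool" where
  "orthonormal_basis B \<longleftrightarrow>
     pairwise orthogonal B \<and> (\<forall>e\<in>B. norm e = 1) \<and> closure (span B) = UNIV"

text \<open>Trace along a chosen orthonormal basis; the choice is immaterial for trace-class operators.\<close>

definition trace_op :: "('h::real_inner \<Rightarrow> 'h) \<Rightarrow> real" where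
  "trace_op A = (\<Sum>\<^sub>\<infinity>e\<in>(SOME B. orthonormal_basis B). e \<bullet> A e)"

text \<open>For a positive operator \<open>Q\<close> one has \<open>|Q| = Q\<close>, so trace class means that the series of
  nonnegative terms defining the trace converges.\<close>

definition covariance_operator :: "('h::real_inner \<Rightarrow>\<^sub>L 'h) \<Rightarrow> bool" where
  "covariance_operator Q \<longleftrightarrow>
     (\<forall>x y. blinfun_apply Q x \<bullet> y = x \<bullet> blinfun_apply Q y) \<and>
     (\<forall>x. 0 \<le> x \<bullet> blinfun_apply Q x) \<and>
     (\<forall>B. orthonormal_basis B \<longrightarrow> (\<lambda>e. e \<bullet> blinfun_apply Q e) summable_on B)"

definition orth_proj :: "'h::real_inner set \<Rightarrow> 'h \<Rightarrow> 'h" where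
  "orth_proj V x = (THE v. v \<in> V \<and> x - v \<in> V\<^sup>\<bottom>)"

definition diffusion :: "'h::real_inner set \<Rightarrow> 'h \<Rightarrow> 'h \<Rightarrow>\<^sub>L 'h" where
  "diffusion V x = norm x *\<^sub>R Blinfun (orth_proj V)"

definition L_D :: "'h::real_inner set \<Rightarrow> ('h \<Rightarrow>\<^sub>L 'h) \<Rightarrow> real" where
  "L_D V Q = sqrt (trace_op (\<lambda>x. orth_proj V (blinfun_apply Q (orth_proj V x))))"


section \<open>The objective and the active subspace\<close>

text \<open>In the growth conditions \<open>powr\<close> gives \<open>0 powr 0 = 0\<close>. This only matters in the last
  condition for \<open>p = 1\<close>, where the convention \<open>0 powr 0 = 1\<close> yields the same class of functions
  (at the cost of a factor 3 in the existentially quantified \<open>L\<close>).\<close>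

definition admissible_objective :: "('h::real_normed_vector \<Rightarrow> real) \<Rightarrow> bool" where
  "admissible_objective E \<longleftrightarrow>
     (\<exists>p C c R0 L. p \<ge> 1 \<and> C > 0 \<and> c > 0 \<and> R0 > 0 \<and> L > 0 \<and>
        (\<forall>x. 0 \<le> E x) \<and>
        (\<forall>x. E x \<le> C * (1 + norm x powr p)) \<and>
        (\<forall>x. norm x > R0 \<longrightarrow> E x \<ge> c * norm x powr p) \<and>
        (\<forall>x y. \<bar>E x - E y\<bar> \<le> L * (1 + norm x powr (p - 1) + norm y powr (p - 1)) * norm (x - y)))"

definition active_subspace ::
  "'w measure \<Rightarrow> 'h::real_inner set \<Rightarrow> ('h \<Rightarrow>\<^sub>L 'h) \<Rightarrow> ('h \<Rightarrow> real) \<Rightarrow> ('w \<Rightarrow> 'h) \<Rightarrow> bool" where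
  "active_subspace M V Q E \<xi> \<longleftrightarrow>
     subspace V \<and> (\<exists>B. finite B \<and> V = span B) \<and>
     (\<forall>x. \<exists>v\<in>V. \<exists>w\<in>V\<^sup>\<bottom>. x = v + w) \<and>
     (\<exists>x\<^sub>0\<in>V. is_arg_min E (\<lambda>_. True) x\<^sub>0) \<and>
     (AE x in distr M borel \<xi>. x \<in> V) \<and>
     (\<exists>l>0. \<forall>v\<in>V. v \<bullet> blinfun_apply Q v \<ge> l * (norm v)\<^sup>2)"


section \<open>Filtered probability spaces and Wiener processes\<close>

text \<open>Filtrations are indexed by the reals, but only nonnegative times are ever used.\<close>

definition usual_conditions :: "'w measure \<Rightarrow> (real \<Rightarrow> 'w measure) \<Rightarrow> bool" where
  "usual_conditions M F \<longleftrightarrow>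
     prob_space M \<and> complete_measure M \<and> filtration (space M) F \<and>
     (\<forall>t\<ge>0. sets (F t) \<subseteq> sets M) \<and>
     null_sets M \<subseteq> sets (F 0) \<and>
     (\<forall>t\<ge>0. sets (F t) = (\<Inter>s\<in>{t<..}. sets (F s)))"

definition centered_gaussian :: "real \<Rightarrow> real measure" where
  "centered_gaussian v =
     (if v = 0 then return borel 0 else density lborel (\<lambda>x. ennreal (normal_density 0 (sqrt v) x)))"

text \<open>An \<open>'h\<close>-valued increment has law \<open>N(0, (t - s) Q)\<close> iff each of its one-dimensional
  projections along \<open>h\<close> is centered Gaussian with variance \<open>(t - s) \<langle>h, Q h\<rangle>\<close>.\<close>

definition Q_wiener_process ::
  "'w measure \<Rightarrow> (real \<Rightarrow> 'w measure) \<Rightarrow>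
   ('h::{real_inner, banach, second_countable_topology} \<Rightarrow>\<^sub>L 'h) \<Rightarrow> (real \<Rightarrow> 'w \<Rightarrow> 'h) \<Rightarrow> bool" where
  "Q_wiener_process M F Q W \<longleftrightarrow>
     (\<forall>t\<ge>0. W t \<in> borel_measurable (F t)) \<and>
     (AE \<omega> in M. W 0 \<omega> = 0) \<and>
     (AE \<omega> in M. continuous_on {0..} (\<lambda>t. W t \<omega>)) \<and>
     (\<forall>s t. 0 \<le> s \<and> s < t \<longrightarrow>
        prob_space.indep_set M (sets (F s))
          {(\<lambda>\<omega>. W t \<omega> - W s \<omega>) -` A \<inter> space M | A. A \<in> sets borel} \<and>
        (\<forall>h. distr M borel (\<lambda>\<omega>. h \<bullet> (W t \<omega> - W s \<omega>)) =
             centered_gaussian ((t - s) * (h \<bullet> blinfun_apply Q h))))"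


section \<open>The Ito integral\<close>

text \<open>Squared norm \<open>\<parallel>A Q\<^sup>1\<^sup>/\<^sup>2\<parallel>\<^sup>2 = Tr (A Q A\<^sup>*)\<close> (Hilbert--Schmidt norm) of the integrands.\<close>

definition L20_norm_sq :: "('h::real_inner \<Rightarrow>\<^sub>L 'h) \<Rightarrow> ('h \<Rightarrow>\<^sub>L 'h) \<Rightarrow> real" where
  "L20_norm_sq Q A = trace_op (\<lambda>x. blinfun_apply A (blinfun_apply Q (adjoint (blinfun_apply A) x)))"

text \<open>Elementary processes: on \<open>(\<tau> i, \<tau> (i+1)]\<close>, \<open>i < n\<close>, equal to the operator-valued random
  variable \<open>\<Psi> i\<close>, which is \<open>F (\<tau> i)\<close>-measurable and takes finitely many values.\<close>

definition elementary ::
  "(real \<Rightarrow> 'w measure) \<Rightarrow> real \<Rightarrow> nat \<Rightarrow> (nat \<Rightarrow> real) \<Rightarrow> (nat \<Rightarrow> 'w \<Rightarrow> ('h::real_inner \<Rightarrow>\<^sub>L 'h)) \<Rightarrow> bool" where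
  "elementary F T n \<tau> \<Psi> \<longleftrightarrow>
     mono_on {..n} \<tau> \<and> \<tau> ` {..n} \<subseteq> {0..T} \<and> (\<forall>i<n. simple_function (F (\<tau> i)) (\<Psi> i))"

definition elementary_process ::
  "nat \<Rightarrow> (nat \<Rightarrow> real) \<Rightarrow> (nat \<Rightarrow> 'w \<Rightarrow> ('h::real_inner \<Rightarrow>\<^sub>L 'h)) \<Rightarrow> real \<Rightarrow> 'w \<Rightarrow> ('h \<Rightarrow>\<^sub>L 'h)" where
  "elementary_process n \<tau> \<Psi> t \<omega> = (\<Sum>i<n. indicator {\<tau> i<..\<tau> (Suc i)} t *\<^sub>R \<Psi> i \<omega>)"

definition elementary_integral ::
  "(real \<Rightarrow> 'w \<Rightarrow> 'h) \<Rightarrow> nat \<Rightarrow> (nat \<Rightarrow> real) \<Rightarrow> (nat \<Rightarrow> 'w \<Rightarrow> ('h::real_inner \<Rightarrow>\<^sub>L 'h)) \<Rightarrow> real \<Rightarrow> 'w \<Rightarrow> 'h" where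
  "elementary_integral W n \<tau> \<Psi> t \<omega> =
     (\<Sum>i<n. blinfun_apply (\<Psi> i \<omega>) (W (min (\<tau> (Suc i)) t) \<omega> - W (min (\<tau> i) t) \<omega>))"

definition progressively_measurable ::
  "(real \<Rightarrow> 'w measure) \<Rightarrow> real \<Rightarrow> (real \<Rightarrow> 'w \<Rightarrow> ('h::real_inner \<Rightarrow>\<^sub>L 'h)) \<Rightarrow> bool" where
  "progressively_measurable F T A \<longleftrightarrow>
     (\<forall>t\<in>{0..T}. \<forall>h. (\<lambda>(s, \<omega>). blinfun_apply (A s \<omega>) h)
        \<in> borel_measurable (restrict_space borel {0..t} \<Otimes>\<^sub>M F t))"

text \<open>\<open>I\<close> is a version of the process \<open>\<integral>\<^sub>0\<^sup>t A\<^sub>s dW\<^sub>s\<close>, \<open>t \<in> [0,T]\<close>: the \<open>L\<^sup>2\<close>-limit of the integrals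
  of elementary processes approximating \<open>A\<close>. The latter forces \<open>A\<close> to be square integrable.\<close>

definition has_ito_integral ::
  "'w measure \<Rightarrow> (real \<Rightarrow> 'w measure) \<Rightarrow> ('h \<Rightarrow>\<^sub>L 'h) \<Rightarrow> (real \<Rightarrow> 'w \<Rightarrow> 'h) \<Rightarrow> real \<Rightarrow>
   (real \<Rightarrow> 'w \<Rightarrow> ('h::{real_inner, banach, second_countable_topology} \<Rightarrow>\<^sub>L 'h)) \<Rightarrow> (real \<Rightarrow> 'w \<Rightarrow> 'h) \<Rightarrow> bool" where
  "has_ito_integral M F Q W T A I \<longleftrightarrow>
     progressively_measurable F T A \<and>
     (\<forall>t\<in>{0..T}. I t \<in> borel_measurable (F t)) \<and>
     (\<exists>n \<tau> \<Psi>.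
        (\<forall>k. elementary F T (n k) (\<tau> k) (\<Psi> k)) \<and>
        (\<lambda>k. \<integral>\<^sup>+\<omega>. (\<integral>\<^sup>+t\<in>{0..T}.
           ennreal (L20_norm_sq Q (elementary_process (n k) (\<tau> k) (\<Psi> k) t \<omega> - A t \<omega>)) \<partial>lborel) \<partial>M)
          \<longlonglongrightarrow> 0 \<and>
        (\<forall>t\<in>{0..T}.
          (\<lambda>k. \<integral>\<^sup>+\<omega>. ennreal ((norm (elementary_integral W (n k) (\<tau> k) (\<Psi> k) t \<omega> - I t \<omega>))\<^sup>2) \<partial>M)
            \<longlonglongrightarrow> 0))"


section \<open>Wasserstein space and flows of measures\<close>

definition P2 :: "'h::{real_inner, banach, second_countable_topology} set \<Rightarrow> 'h measure set" where
  "P2 V = {\<mu>. prob_space \<mu> \<and> sets \<mu> = sets borel \<and> (AE x in \<mu>. x \<in> V) \<and>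
              integrable \<mu> (\<lambda>x. (norm x)\<^sup>2)}"

definition couplings ::
  "'h::{real_inner, banach, second_countable_topology} measure \<Rightarrow> 'h measure \<Rightarrow> ('h \<times> 'h) measure set" where
  "couplings \<mu> \<nu> = {\<pi>. prob_space \<pi> \<and> sets \<pi> = sets (borel \<Otimes>\<^sub>M borel) \<and>
                       distr \<pi> borel fst = \<mu> \<and> distr \<pi> borel snd = \<nu>}"

definition W2 ::
  "'h::{real_inner, banach, second_countable_topology} measure \<Rightarrow> 'h measure \<Rightarrow> real" where
  "W2 \<mu> \<nu> = sqrt (enn2real
     (INF \<pi>\<in>couplings \<mu> \<nu>. \<integral>\<^sup>+z. ennreal ((norm (fst z - snd z))\<^sup>2) \<partial>\<pi>))"

text \<open>\<open>C([0,T]; P2 V)\<close>; flows are extensional functions on \<open>{0..T}\<close>.\<close>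

definition flows ::
  "'h::{real_inner, banach, second_countable_topology} set \<Rightarrow> real \<Rightarrow> (real \<Rightarrow> 'h measure) set" where
  "flows V T = {\<mu> \<in> {0..T} \<rightarrow>\<^sub>E P2 V.
     \<forall>t\<in>{0..T}. ((\<lambda>s. W2 (\<mu> s) (\<mu> t)) \<longlongrightarrow> 0) (at t within {0..T})}"

definition flow_ball ::
  "'h::{real_inner, banach, second_countable_topology} set \<Rightarrow> real \<Rightarrow> real \<Rightarrow> (real \<Rightarrow> 'h measure) set" where
  "flow_ball V T R = {\<mu> \<in> flows V T. \<forall>t\<in>{0..T}. (\<integral>x. (norm x)\<^sup>2 \<partial>\<mu> t) \<le> R\<^sup>2}"

definition flow_dist ::
  "real \<Rightarrow> (real \<Rightarrow> 'h::{real_inner, banach, second_countable_topology} measure) \<Rightarrow> (real \<Rightarrow> 'h measure) \<Rightarrow> real" where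
  "flow_dist T \<mu> \<nu> = (SUP t\<in>{0..T}. W2 (\<mu> t) (\<nu> t))"

definition consensus_point ::
  "real \<Rightarrow> ('h::{real_inner, banach, second_countable_topology} \<Rightarrow> real) \<Rightarrow> 'h measure \<Rightarrow> 'h" where
  "consensus_point \<alpha> E \<mu> =
     (\<integral>x. exp (- \<alpha> * E x) *\<^sub>R x \<partial>\<mu>) /\<^sub>R (\<integral>x. exp (- \<alpha> * E x) \<partial>\<mu>)"


section \<open>The decoupled equation and the map \<open>\<Phi>\<close>\<close>

definition strong_solution ::
  "'w measure \<Rightarrow> (real \<Rightarrow> 'w measure) \<Rightarrow> ('h \<Rightarrow>\<^sub>L 'h) \<Rightarrow> (real \<Rightarrow> 'w \<Rightarrow> 'h) \<Rightarrow>
   'h::{real_inner, banach, second_countable_topology} set \<Rightarrow> ('h \<Rightarrow> real) \<Rightarrow>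
   real \<Rightarrow> real \<Rightarrow> real \<Rightarrow> ('w \<Rightarrow> 'h) \<Rightarrow> real \<Rightarrow> (real \<Rightarrow> 'h measure) \<Rightarrow> (real \<Rightarrow> 'w \<Rightarrow> 'h) \<Rightarrow> bool" where
  "strong_solution M F Q W V E \<alpha> lam \<sigma> \<xi> T \<mu> X \<longleftrightarrow>
     (\<forall>t\<in>{0..T}. X t \<in> borel_measurable (F t)) \<and>
     (\<forall>\<omega>\<in>space M. continuous_on {0..T} (\<lambda>t. X t \<omega>)) \<and>
     (\<exists>I. has_ito_integral M F Q W T
            (\<lambda>t \<omega>. \<sigma> *\<^sub>R diffusion V (X t \<omega> - consensus_point \<alpha> E (\<mu> t))) I \<and>
          (AE \<omega> in M. \<forall>t\<in>{0..T}.
             X t \<omega> = \<xi> \<omega>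
               + (LINT s:{0..t}|lborel. - lam *\<^sub>R (X s \<omega> - consensus_point \<alpha> E (\<mu> s)))
               + I t \<omega>))"

text \<open>\<open>\<Phi>\<close> is a partial map: it is defined at \<open>\<mu>\<close> only if the equation driven by \<open>\<mu>\<close> has a strong
  solution (pathwise uniqueness makes the law independent of the choice). Where it is undefined
  it takes the value \<open>null_measure borel\<close>, which is not a probability measure; hence ``\<open>\<Phi>\<close> maps
  \<open>C\<close> into itself'' includes that \<open>\<Phi>\<close> is defined on \<open>C\<close>.\<close>

definition Phi ::
  "'w measure \<Rightarrow> (real \<Rightarrow> 'w measure) \<Rightarrow> ('h \<Rightarrow>\<^sub>L 'h) \<Rightarrow> (real \<Rightarrow> 'w \<Rightarrow> 'h) \<Rightarrow>
   'h::{real_inner, banach, second_countable_topology} set \<Rightarrow> ('h \<Rightarrow> real) \<Rightarrow>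
   real \<Rightarrow> real \<Rightarrow> real \<Rightarrow> ('w \<Rightarrow> 'h) \<Rightarrow> real \<Rightarrow> (real \<Rightarrow> 'h measure) \<Rightarrow> (real \<Rightarrow> 'h measure)" where
  "Phi M F Q W V E \<alpha> lam \<sigma> \<xi> T \<mu> =
     (\<lambda>t\<in>{0..T}.
        if \<exists>X. strong_solution M F Q W V E \<alpha> lam \<sigma> \<xi> T \<mu> X
        then distr M borel ((SOME X. strong_solution M F Q W V E \<alpha> lam \<sigma> \<xi> T \<mu> X) t)
        else null_measure borel)"

definition strict_contraction_on :: "('a \<Rightarrow> 'a \<Rightarrow> real) \<Rightarrow> 'a set \<Rightarrow> ('a \<Rightarrow> 'a) \<Rightarrow> bool" where
  "strict_contraction_on d C f \<longleftrightarrow>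
     (\<exists>\<kappa>. 0 \<le> \<kappa> \<and> \<kappa> < 1 \<and> (\<forall>x\<in>C. \<forall>y\<in>C. d (f x) (f y) \<le> \<kappa> * d x y))"

end

theory Submission
  imports Defs
begin

text \<open>Write \<open>X\<close> and \<open>Y\<close> for the solutions driven by two flows \<open>\<mu>\<close> and \<open>\<nu>\<close>, and \<open>d\<close> for the distance of the
two flows. Both solutions start in \<open>\<xi>\<close>, so \<open>X\<^sub>t - Y\<^sub>t\<close> consists of a drift integral and a difference of
two Ito integrals, and both are controlled by the time integral of the second moment of
\<open>(X\<^sub>s - Y\<^sub>s) - (m(\<mu>\<^sub>s) - m(\<nu>\<^sub>s))\<close>, where \<open>m\<close> is the consensus point. On measures with second moment at
most \<open>R\<^sup>2\<close> the consensus point is Lipschitz for the Wasserstein distance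
(\<open>consensus_point_lipschitz\<close>), so the second bracket is at most \<open>C * d\<close>. If
\<open>r\<close> is the supremum over \<open>t\<close> of the second moment of \<open>X\<^sub>t - Y\<^sub>t\<close>, this gives
\<open>r \<le> K * T0 * (2 * r + 2 * C\<^sup>2 * d\<^sup>2)\<close>, where \<open>K\<close> and \<open>C\<close> do not depend on \<open>T0\<close>. The number \<open>r\<close> is
finite, because \<open>\<Phi>\<close> maps the ball of flows into itself and hence both laws have second moment at
most \<open>R\<^sup>2\<close>; for small \<open>T0\<close> the term with \<open>r\<close> can therefore be absorbed into the left-hand side,
which leaves \<open>r \<le> d\<^sup>2 / 4\<close>. The joint law of \<open>X\<^sub>t\<close> and \<open>Y\<^sub>t\<close> is a coupling, so \<open>\<Phi>\<close> contracts by the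
factor \<open>1 / 2\<close>.

The consensus point is a quotient of the integrals of \<open>exp (- \<alpha> * E x) *\<^sub>R x\<close> and \<open>exp (- \<alpha> * E x)\<close>. Both
integrands are globally Lipschitz, since the coercivity of \<open>E\<close> makes the Gibbs weight beat every
power that the growth of \<open>E\<close> produces (\<open>gibbs_weight_lipschitz\<close>), and the bound on the second
moment keeps the denominator away from \<open>0\<close> (\<open>gibbs_normalisation_lower_bound\<close>).

For the stochastic part (\<open>strong_solution_gap\<close>) both solutions live in the finite-dimensional space
\<open>V\<close>, so it suffices to bound \<open>v \<bullet> (I\<^sub>t - J\<^sub>t)\<close> for the finitely many vectors \<open>v\<close> of an orthonormal basis of
\<open>V\<close>. For fixed \<open>v\<close> an elementary integral is a sum of scalar terms \<open>1\<^sub>A * (a \<bullet> (W\<^sub>t - W\<^sub>s))\<close>, whose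
covariances are explicit; this yields the Ito isometry for such sums with the quadratic form
\<open>a \<bullet> Q a\<close> (\<open>elem_int_isometry\<close>). The passage to the limit uses that this form, evaluated at the
adjoint of an operator, is dominated by the Hilbert--Schmidt norm in the definition of the integral
(\<open>qform_adjoint_le\<close>). That norm is a trace along an orthonormal basis of the whole space, which is
why the existence of bases, Parseval's identity and the existence of adjoints come first. Only
\<open>(a + b + c)\<^sup>2 \<le> 3 * (a\<^sup>2 + b\<^sup>2 + c\<^sup>2)\<close> is needed to pass to the limit: a constant factor is harmless when
\<open>T0\<close> may be small.\<close>

section \<open>Separable Hilbert spaces: bases, adjoints, projections\<close>

definition orthonormal :: "'h::real_inner set \<Rightarrow> bool" where
  "orthonormal B \<longleftrightarrow> pairwise orthogonal B \<and> (\<forall>e\<in>B. norm e = 1)"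

lemma orthonormal_inner:
  assumes "orthonormal B" "e \<in> B" "f \<in> B"
  shows "e \<bullet> f = (if e = f then 1 else 0)"
  using assms unfolding orthonormal_def pairwise_def orthogonal_def
  by (auto simp: dot_square_norm)

lemma orthonormal_sum_inner:
  assumes "orthonormal B" "finite F" "F \<subseteq> B" "e \<in> F"
  shows "e \<bullet> (\<Sum>f\<in>F. c f *\<^sub>R f) = c e"
proof -
  have "e \<bullet> (\<Sum>f\<in>F. c f *\<^sub>R f) = (\<Sum>f\<in>F. if e = f then c f else 0)"
    unfolding inner_sum_right inner_scaleR_right
    using assms by (intro sum.cong) (auto simp: orthonormal_inner[OF assms(1)] subset_iff)
  then show ?thesis using assms by simp
qed

text \<open>One step of the Gram--Schmidt process. The old vectors are kept unchanged, so that
  infinitely many steps produce an increasing chain of orthonormal sets.\<close>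

lemma orthonormal_extend:
  fixes x :: "'h::real_inner"
  assumes "finite B" "orthonormal B"
  shows "\<exists>C. finite C \<and> orthonormal C \<and> B \<subseteq> C \<and> span C = span (insert x B)"
proof -
  define p where "p = (\<Sum>e\<in>B. (e \<bullet> x) *\<^sub>R e)"
  define u where "u = x - p"
  have p: "p \<in> span B"
    unfolding p_def by (intro span_sum span_scale span_base)
  have ou: "e \<bullet> u = 0" if "e \<in> B" for e
    unfolding u_def p_def using orthonormal_sum_inner[OF assms(2,1) order_refl that]
    by (simp add: inner_diff_right)
  show ?thesis
  proof (cases "u = 0")
    case True
    then have "x \<in> span B" using p unfolding u_def by simp
    then show ?thesis using assms by (intro exI[of _ B]) (simp add: span_redundant)
  next
    case False
    let ?C = "insert (u /\<^sub>R norm u) B"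
    have "orthonormal ?C"
      using assms(2) ou False unfolding orthonormal_def
      by (auto simp: pairwise_insert orthogonal_def inner_commute[of u])
    moreover have "span ?C = span (insert x B)"
    proof (rule subset_antisym; rule span_minimal[OF _ subspace_span])
      have "u \<in> span (insert x B)"
        unfolding u_def using p span_mono[of B "insert x B"]
        by (auto intro!: span_diff intro: span_base)
      then show "?C \<subseteq> span (insert x B)"
        by (auto intro: span_scale span_base)
      have "norm u *\<^sub>R (u /\<^sub>R norm u) \<in> span ?C"
        by (intro span_scale span_base) auto
      then have "u \<in> span ?C" using False by simp
      moreover have "p \<in> span ?C" using p span_mono[of B ?C] by auto
      ultimately have "u + p \<in> span ?C" by (rule span_add)
      then show "insert x B \<subseteq> span ?C"
        by (auto intro: span_base simp: u_def)
    qed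
    ultimately show ?thesis using assms by (intro exI[of _ ?C]) auto
  qed
qed

lemma finite_orthonormal_span:
  fixes B :: "'h::real_inner set"
  assumes "finite B"
  shows "\<exists>C. finite C \<and> orthonormal C \<and> span C = span B"
  using assms
proof (induction B)
  case empty
  show ?case by (intro exI[of _ "{}"]) (auto simp: orthonormal_def)
next
  case (insert x B)
  then obtain C where C: "finite C" "orthonormal C" "span C = span B" by auto
  obtain D where "finite D" "orthonormal D" "span D = span (insert x C)"
    using orthonormal_extend[OF C(1,2)] by metis
  moreover have "span (insert x C) = span (insert x B)"
    using C(3) by (metis span_insert)
  ultimately show ?case by auto
qed

text \<open>Gram--Schmidt applied to a countable dense sequence: the union of the resulting
  chain has a span that contains the dense sequence.\<close>

lemma orthonormal_basis_exists:
  "\<exists>B::'h::{real_inner, second_countable_topology} set. orthonormal_basis B"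
proof -
  obtain D :: "'h set" where D: "countable D" "\<And>X. open X \<Longrightarrow> X \<noteq> {} \<Longrightarrow> \<exists>d\<in>D. d \<in> X"
    using countable_dense_setE by metis
  have "D \<noteq> {}" using D(2)[of UNIV] by auto
  have "\<exists>f. \<forall>n::nat. (finite (f n) \<and> orthonormal (f n)) \<and>
      (f n \<subseteq> f (Suc n) \<and> from_nat_into D n \<in> span (f (Suc n)))"
  proof (rule dependent_nat_choice)
    show "\<exists>x::'h set. finite x \<and> orthonormal x"
      by (intro exI[of _ "{}"]) (auto simp: orthonormal_def)
  next
    fix x :: "'h set" and n :: nat
    assume "finite x \<and> orthonormal x"
    then obtain C where "finite C \<and> orthonormal C \<and> x \<subseteq> C \<and> span C = span (insert (from_nat_into D n) x)"
      using orthonormal_extend by metis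
    moreover from this have "from_nat_into D n \<in> span C" by (auto intro: span_base)
    ultimately show "\<exists>y. (finite y \<and> orthonormal y) \<and> (x \<subseteq> y \<and> from_nat_into D n \<in> span y)"
      by blast
  qed
  then obtain f :: "nat \<Rightarrow> 'h set" where f: "\<And>n. orthonormal (f n)" "\<And>n. f n \<subseteq> f (Suc n)"
      "\<And>n. from_nat_into D n \<in> span (f (Suc n))" by auto
  define B where "B = (\<Union>n. f n)"
  have "pairwise orthogonal B"
    unfolding B_def using f(1) lift_Suc_mono_le[of f, OF f(2)] unfolding orthonormal_def
    by (intro pairwise_chain_Union) (auto simp: chain_subset_def, metis nat_le_linear subsetD)
  moreover have "\<forall>e\<in>B. norm e = 1"
    using f(1) unfolding B_def orthonormal_def by auto
  moreover have "D \<subseteq> span B"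
  proof
    fix d assume "d \<in> D"
    then obtain n where "d = from_nat_into D n" using from_nat_into_surj[OF D(1)] by metis
    then have "d \<in> span (f (Suc n))" using f(3) by simp
    moreover have "f (Suc n) \<subseteq> B" unfolding B_def by auto
    ultimately show "d \<in> span B" using span_mono by blast
  qed
  moreover have "closure D = UNIV"
    using D(2) by (fastforce simp: closure_iff_nhds_not_empty)
  ultimately show ?thesis unfolding orthonormal_basis_def
    by (metis closure_mono top.extremum_uniqueI)
qed

lemma orthonormal_basis_orthonormal: "orthonormal_basis B \<Longrightarrow> orthonormal B"
  by (simp add: orthonormal_basis_def orthonormal_def)

text \<open>Distinct orthonormal vectors have distance \<open>sqrt 2\<close>, so the balls of
  radius \<open>1/2\<close> around them are disjoint, and a separable space has only countably
  many disjoint open sets. Countability is what permits exchanging the sum over a basis with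
  an expectation.\<close>

lemma orthonormal_countable:
  fixes B :: "'h::{real_inner, second_countable_topology} set"
  assumes "orthonormal B"
  shows "countable B"
proof -
  have d: "dist e f > 1" if "e \<in> B" "f \<in> B" "e \<noteq> f" for e f
  proof -
    have "(dist e f)\<^sup>2 = 2"
      using orthonormal_inner[OF assms that(1,2)] orthonormal_inner[OF assms that(1,1)]
        orthonormal_inner[OF assms that(2,2)] that(3)
      by (simp add: dist_norm power2_norm_eq_inner inner_diff inner_commute)
    then show ?thesis by (metis one_less_numeral_iff one_power2 power2_less_imp_less zero_le_dist semiring_norm(76))
  qed
  have dj: "ball e (1/2) \<inter> ball f (1/2) = {}" if "e \<in> B" "f \<in> B" "e \<noteq> f" for e f
    using d[OF that] by (intro disjoint_ballI) auto
  have "inj_on (\<lambda>e. ball e (1/2)) B"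
    by (rule inj_onI) (metis dj Int_absorb centre_in_ball empty_iff half_gt_zero zero_less_one)
  moreover have "countable ((\<lambda>e. ball e (1/2)) ` B)"
    by (rule countable_disjoint_open_subsets) (auto simp: disjoint_def simp del: mem_ball dest: dj)
  ultimately show ?thesis using countable_image_inj_on by blast
qed

text \<open>Pythagoras for an arbitrary linear combination. The last sum vanishes exactly for
  the Fourier coefficients, which gives Bessel's inequality and the optimality of the Fourier
  partial sum.\<close>

lemma bessel_defect:
  fixes x :: "'h::real_inner"
  assumes "orthonormal F" "finite F"
  shows "(norm (x - (\<Sum>e\<in>F. c e *\<^sub>R e)))\<^sup>2 = (norm x)\<^sup>2 - (\<Sum>e\<in>F. (e \<bullet> x)\<^sup>2) + (\<Sum>e\<in>F. (e \<bullet> x - c e)\<^sup>2)"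
proof -
  let ?s = "\<Sum>e\<in>F. c e *\<^sub>R e"
  have 1: "?s \<bullet> ?s = (\<Sum>e\<in>F. c e * c e)"
    unfolding inner_sum_left[of _ _ "?s"] using orthonormal_sum_inner[OF assms order_refl]
    by (intro sum.cong) auto
  have 2: "?s \<bullet> x = (\<Sum>e\<in>F. c e * (e \<bullet> x))" "x \<bullet> ?s = (\<Sum>e\<in>F. c e * (e \<bullet> x))"
    by (simp_all add: inner_sum_left inner_sum_right inner_commute)
  show ?thesis
    unfolding power2_norm_eq_inner inner_diff 1 2 power2_diff sum.distrib sum_subtractf
    by (simp add: power2_eq_square inner_diff 1 2 sum.distrib sum_subtractf algebra_simps sum_distrib_left)
qed

lemma bessel:
  fixes x :: "'h::real_inner"
  assumes "orthonormal F" "finite F"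
  shows "(\<Sum>e\<in>F. (e \<bullet> x)\<^sup>2) \<le> (norm x)\<^sup>2"
  using bessel_defect[OF assms, of x "\<lambda>e. e \<bullet> x"] zero_le_power2[of "norm (x - (\<Sum>e\<in>F. (e \<bullet> x) *\<^sub>R e))"]
  by (simp only: diff_self) simp

lemma span_orthonormal_expansion:
  assumes "orthonormal F" "finite F" "x \<in> span F"
  shows "(norm x)\<^sup>2 = (\<Sum>e\<in>F. (e \<bullet> x)\<^sup>2)"
proof -
  obtain c where x: "x = (\<Sum>e\<in>F. c e *\<^sub>R e)"
    using assms span_finite[OF assms(2)] by auto
  have "(\<Sum>e\<in>F. (e \<bullet> x - c e)\<^sup>2) = 0"
    using orthonormal_sum_inner[OF assms(1,2) order_refl] by (simp add: x)
  then show ?thesis using bessel_defect[OF assms(1,2), of x c] x by simp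
qed

lemma nn_integral_count_space_infsum:
  fixes f :: "'i \<Rightarrow> real"
  assumes "f summable_on B" "\<And>x. x \<in> B \<Longrightarrow> 0 \<le> f x"
  shows "(\<integral>\<^sup>+x. ennreal (f x) \<partial>count_space B) = ennreal (infsum f B)"
proof -
  have "(\<lambda>x. norm (f x)) summable_on B"
    using assms by (simp cong: summable_on_cong)
  then have "Infinite_Set_Sum.abs_summable_on f B"
    by (rule abs_summable_equivalent[THEN iffD1])
  then show ?thesis
    using assms(2) by (simp add: nn_integral_conv_infsetsum infsetsum_infsum)
qed

lemma summable_on_if_nn_integral_finite:
  fixes f :: "'i \<Rightarrow> real"
  assumes "(\<integral>\<^sup>+x. ennreal (f x) \<partial>count_space B) < \<infinity>" "\<And>x. x \<in> B \<Longrightarrow> 0 \<le> f x"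
  shows "f summable_on B"
proof -
  have "integrable (count_space B) f"
    using assms by (intro integrableI_nonneg) (auto simp: AE_count_space)
  then have "(\<lambda>x. norm (f x)) summable_on B"
    unfolding abs_summable_on_def[symmetric] by (rule abs_summable_equivalent[THEN iffD2])
  then show ?thesis using assms(2) by (simp cong: summable_on_cong)
qed

text \<open>Bessel's inequality bounds the sum by \<open>(norm x)\<^sup>2\<close>; conversely
  the span of the basis contains vectors close to \<open>x\<close>, and the Fourier partial
  sum on their finite support is at least as close.\<close>

lemma parseval:
  fixes x :: "'h::real_inner"
  assumes "orthonormal_basis B"
  shows "(\<lambda>e. (e \<bullet> x)\<^sup>2) summable_on B" "(norm x)\<^sup>2 = (\<Sum>\<^sub>\<infinity>e\<in>B. (e \<bullet> x)\<^sup>2)"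
proof -
  have on: "orthonormal B" using assms by (rule orthonormal_basis_orthonormal)
  have mono: "orthonormal F" if "F \<subseteq> B" for F
    using on that unfolding orthonormal_def by (auto intro: pairwise_mono)
  have bes: "(\<Sum>e\<in>F. (e \<bullet> x)\<^sup>2) \<le> (norm x)\<^sup>2" if "finite F" "F \<subseteq> B" for F
    using bessel[OF mono] that by blast
  show summable: "(\<lambda>e. (e \<bullet> x)\<^sup>2) summable_on B"
    using bes by (intro nonneg_bdd_above_summable_on bdd_aboveI[of _ "(norm x)\<^sup>2"]) auto
  show "(norm x)\<^sup>2 = (\<Sum>\<^sub>\<infinity>e\<in>B. (e \<bullet> x)\<^sup>2)"
  proof (rule antisym)
    show "(\<Sum>\<^sub>\<infinity>e\<in>B. (e \<bullet> x)\<^sup>2) \<le> (norm x)\<^sup>2"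
      using bes by (intro infsum_le_finite_sums summable)
    show "(norm x)\<^sup>2 \<le> (\<Sum>\<^sub>\<infinity>e\<in>B. (e \<bullet> x)\<^sup>2)"
    proof (rule field_le_epsilon)
      fix \<epsilon> :: real assume \<epsilon>: "0 < \<epsilon>"
      have "x \<in> closure (span B)" using assms unfolding orthonormal_basis_def by simp
      then obtain y where y: "y \<in> span B" "dist y x < sqrt \<epsilon>"
        using \<epsilon> unfolding closure_approachable by (meson real_sqrt_gt_zero)
      then obtain F c where F: "finite F" "F \<subseteq> B" and c: "y = (\<Sum>e\<in>F. c e *\<^sub>R e)"
        unfolding span_explicit by auto
      have "(norm x)\<^sup>2 - (\<Sum>e\<in>F. (e \<bullet> x)\<^sup>2) \<le> (norm (x - y))\<^sup>2"
        using bessel_defect[OF mono[OF F(2)] F(1), of x c] c by (simp add: sum_nonneg)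
      also have "\<dots> \<le> (sqrt \<epsilon>)\<^sup>2"
        using y(2) by (intro power_mono) (auto simp: dist_norm norm_minus_commute)
      also have "\<dots> = \<epsilon>" using \<epsilon> by simp
      finally have "(norm x)\<^sup>2 \<le> (\<Sum>e\<in>F. (e \<bullet> x)\<^sup>2) + \<epsilon>" by simp
      moreover have "(\<Sum>e\<in>F. (e \<bullet> x)\<^sup>2) \<le> (\<Sum>\<^sub>\<infinity>e\<in>B. (e \<bullet> x)\<^sup>2)"
        using F by (intro finite_sum_le_infsum summable) auto
      ultimately show "(norm x)\<^sup>2 \<le> (\<Sum>\<^sub>\<infinity>e\<in>B. (e \<bullet> x)\<^sup>2) + \<epsilon>" by simp
    qed
  qed
qed

lemma parseval_nn:
  fixes x :: "'h::real_inner"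
  assumes "orthonormal_basis B"
  shows "ennreal ((norm x)\<^sup>2) = (\<integral>\<^sup>+e. ennreal ((e \<bullet> x)\<^sup>2) \<partial>count_space B)"
  using parseval[OF assms, of x] by (simp add: nn_integral_count_space_infsum)

text \<open>The representing vector is the minimiser of \<open>(norm x)\<^sup>2 - 2 * f
  x\<close>: by the parallelogram law every minimising sequence is Cauchy, and the first-order
  condition at the limit reads \<open>f h = h \<bullet> z\<close>.\<close>

lemma riesz_representation:
  fixes f :: "'h::{real_inner, banach} \<Rightarrow> real"
  assumes "bounded_linear f"
  shows "\<exists>z. \<forall>x. f x = x \<bullet> z"
proof -
  interpret f: bounded_linear f by fact
  define J where "J x = (norm x)\<^sup>2 - 2 * f x" for x
  obtain K where K: "\<And>x. norm (f x) \<le> norm x * K" using f.bounded by auto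
  have lb: "- K\<^sup>2 \<le> J x" for x
  proof -
    have "f x \<le> norm x * K" using K[of x] by simp
    moreover have "0 \<le> (norm x - K)\<^sup>2" by simp
    ultimately show ?thesis unfolding J_def power2_diff by linarith
  qed
  have bdd: "bdd_below (range J)" using lb by (intro bdd_belowI[of _ "-K\<^sup>2"]) auto
  define m where "m = Inf (range J)"
  have m: "m \<le> J x" for x unfolding m_def using bdd by (intro cInf_lower) auto
  have "\<exists>x. J x < m + 1 / Suc n" for n
    using cInf_lessD[of "range J" "m + 1 / Suc n"] unfolding m_def by auto
  then obtain u where u: "\<And>n. J (u n) < m + 1 / Suc n" by metis
  have par: "(norm (x - y))\<^sup>2 \<le> 2 * (J x - m) + 2 * (J y - m)" for x y
  proof -
    have "(norm (x - y))\<^sup>2 = 2 * J x + 2 * J y - 4 * J ((x + y) /\<^sub>R 2)"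
      unfolding J_def power2_norm_eq_inner f.scaleR f.add
      by (simp add: inner_diff inner_add inner_commute algebra_simps)
    then show ?thesis using m[of "(x + y) /\<^sub>R 2"] by simp
  qed
  have "Cauchy u"
  proof (rule metric_CauchyI)
    fix e :: real assume "0 < e"
    then obtain N where N: "inverse (real (Suc N)) < e\<^sup>2 / 4"
      using reals_Archimedean[of "e\<^sup>2 / 4"] by auto
    have "dist (u i) (u j) < e" if "N \<le> i" "N \<le> j" for i j
    proof -
      have b: "J (u k) - m < e\<^sup>2 / 4" if "N \<le> k" for k
      proof -
        have "1 / real (Suc k) \<le> inverse (real (Suc N))" using that by (simp add: field_simps)
        then show ?thesis using u[of k] N by linarith
      qed
      have "(norm (u i - u j))\<^sup>2 < e\<^sup>2" using par[of "u i" "u j"] b[OF that(1)] b[OF that(2)] by simp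
      then show ?thesis using \<open>0 < e\<close> by (simp add: dist_norm power2_less_imp_less)
    qed
    then show "\<exists>N. \<forall>i\<ge>N. \<forall>j\<ge>N. dist (u i) (u j) < e" by blast
  qed
  then obtain z where z: "u \<longlonglongrightarrow> z" using Cauchy_convergent_iff convergent_def by blast
  have "(\<lambda>n. J (u n)) \<longlonglongrightarrow> J z"
    unfolding J_def by (intro tendsto_intros z f.tendsto)
  moreover have "(\<lambda>n. m + 1 / real (Suc n)) \<longlonglongrightarrow> m + 0"
    by (intro tendsto_intros LIMSEQ_Suc[OF lim_1_over_n])
  ultimately have "J z \<le> m"
    using LIMSEQ_le[of "\<lambda>n. J (u n)" "J z" "\<lambda>n. m + 1 / real (Suc n)" m] u by (auto intro: less_imp_le)
  \<comment> \<open>first-order condition at the minimiser \<open>z\<close>\<close>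
  have "f h = h \<bullet> z" for h
  proof -
    define b where "b = 2 * (h \<bullet> z - f h)"
    have q: "0 \<le> t * b + t\<^sup>2 * (norm h)\<^sup>2" for t
    proof -
      have "J (z + t *\<^sub>R h) = J z + (t * b + t\<^sup>2 * (norm h)\<^sup>2)"
        unfolding J_def b_def f.add f.scaleR power2_norm_eq_inner
        by (simp add: inner_add inner_commute algebra_simps power2_eq_square)
      then show ?thesis using m[of "z + t *\<^sub>R h"] \<open>J z \<le> m\<close> by simp
    qed
    \<comment> \<open>at \<open>t = - b / N\<close> the quadratic equals \<open>- b\<^sup>2 / N\<^sup>2\<close>; the \<open>+ 1\<close> keeps \<open>N\<close> positive for \<open>h = 0\<close>\<close>
    define N where "N = (norm h)\<^sup>2 + 1"
    have "N > 0" unfolding N_def by (simp add: add_nonneg_pos)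
    have "0 \<le> (- b / N) * b + (- b / N)\<^sup>2 * (norm h)\<^sup>2" by (rule q)
    also have "\<dots> = - (b\<^sup>2) / N\<^sup>2"
    proof -
    have n: "(norm h)\<^sup>2 = N - 1" by (simp add: N_def)
    show ?thesis unfolding n using \<open>N > 0\<close> by (simp add: field_simps power2_eq_square)
  qed
    finally have "b\<^sup>2 \<le> 0" using \<open>N > 0\<close> by (simp add: divide_le_0_iff)
    then show ?thesis unfolding b_def by simp
  qed
  then show ?thesis by blast
qed

text \<open>The constant \<open>adjoint\<close> is a choice among functions with this
  property; that one exists is the Riesz representation theorem.\<close>

lemma adjoint_blinfun_works:
  fixes A :: "'h::{real_inner, banach} \<Rightarrow>\<^sub>L 'g::real_inner"
  shows "blinfun_apply A x \<bullet> y = x \<bullet> adjoint (blinfun_apply A) y"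
proof -
  have "\<exists>w. \<forall>x. blinfun_apply A x \<bullet> y = x \<bullet> w" for y
    by (rule riesz_representation) (intro bounded_linear_inner_left_comp blinfun.bounded_linear_right)
  then obtain g where "\<forall>x y. blinfun_apply A x \<bullet> y = x \<bullet> g y" by metis
  from someI[of "\<lambda>g. \<forall>x y. blinfun_apply A x \<bullet> y = x \<bullet> g y", OF this]
  show ?thesis unfolding adjoint_def by blast
qed

lemma inner_blinfun_adjoint:
  fixes A :: "'h::{real_inner, banach} \<Rightarrow>\<^sub>L 'g::real_inner"
  shows "y \<bullet> blinfun_apply A x = adjoint (blinfun_apply A) y \<bullet> x"
  using adjoint_blinfun_works[of A x y] by (simp add: inner_commute)

lemma adjoint_blinfun_eqI:
  fixes A :: "'h::{real_inner, banach} \<Rightarrow>\<^sub>L 'g::real_inner"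
  assumes "\<And>x. blinfun_apply A x \<bullet> y = x \<bullet> w"
  shows "adjoint (blinfun_apply A) y = w"
  using assms adjoint_blinfun_works[of A _ y] by (metis inner_eq_zero_iff inner_diff_right eq_iff_diff_eq_0)

lemma orth_proj_props:
  assumes "subspace V" "\<forall>x. \<exists>v\<in>V. \<exists>w\<in>V\<^sup>\<bottom>. x = v + w"
  shows "orth_proj V x \<in> V" "x - orth_proj V x \<in> V\<^sup>\<bottom>"
proof -
  have "\<exists>!v. v \<in> V \<and> x - v \<in> V\<^sup>\<bottom>"
  proof (rule ex_ex1I)
    show "\<exists>v. v \<in> V \<and> x - v \<in> V\<^sup>\<bottom>" using assms(2)[rule_format, of x] by (metis add_diff_cancel_left')
    fix v w assume a: "v \<in> V \<and> x - v \<in> V\<^sup>\<bottom>" "w \<in> V \<and> x - w \<in> V\<^sup>\<bottom>"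
    then have "(v - w) \<bullet> (x - w - (x - v)) = 0"
      using assms(1) by (simp add: orthogonal_comp_def orthogonal_def subspace_diff inner_diff_right)
    then show "v = w" by simp
  qed
  from theI'[OF this] show "orth_proj V x \<in> V" "x - orth_proj V x \<in> V\<^sup>\<bottom>"
    unfolding orth_proj_def by auto
qed

lemma orth_proj_inner:
  assumes "subspace V" "\<forall>x. \<exists>v\<in>V. \<exists>w\<in>V\<^sup>\<bottom>. x = v + w" "v \<in> V"
  shows "orth_proj V x \<bullet> v = x \<bullet> v"
  using orth_proj_props(2)[OF assms(1,2), of x] assms(3)
  by (simp add: orthogonal_comp_def orthogonal_def inner_diff_right inner_commute)

lemma bounded_linear_orth_proj:
  assumes "subspace V" "\<forall>x. \<exists>v\<in>V. \<exists>w\<in>V\<^sup>\<bottom>. x = v + w"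
  shows "bounded_linear (orth_proj V)"
proof -
  note P = orth_proj_props[OF assms] and I = orth_proj_inner[OF assms]
  have eqI: "a = b" if "a \<in> V" "b \<in> V" "\<And>v. v \<in> V \<Longrightarrow> a \<bullet> v = b \<bullet> v" for a b
    using that(3)[of "a - b"] that(1,2) assms(1)
    by (metis inner_diff_left inner_eq_zero_iff eq_iff_diff_eq_0 subspace_diff)
  show ?thesis
  proof (rule bounded_linear_intro[of _ 1])
    show "orth_proj V (x + y) = orth_proj V x + orth_proj V y" for x y
      using assms(1) P(1) by (intro eqI) (auto simp: subspace_add inner_add_left I)
    show "orth_proj V (r *\<^sub>R x) = r *\<^sub>R orth_proj V x" for r x
      using assms(1) P(1) by (intro eqI) (auto simp: subspace_scale I)
    show "norm (orth_proj V x) \<le> norm x * 1" for x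
    proof -
      have "(norm (orth_proj V x))\<^sup>2 = x \<bullet> orth_proj V x"
        by (simp add: power2_norm_eq_inner I P(1))
      also have "\<dots> \<le> norm x * norm (orth_proj V x)" by (rule norm_cauchy_schwarz)
      finally show ?thesis
        by (metis mult.commute mult_le_cancel_left_pos mult_1_right norm_ge_zero order_le_less power2_eq_square)
    qed
  qed
qed

section \<open>Gibbs weights of an admissible objective\<close>

text \<open>The bound is the logarithmic inequality \<open>ln y \<le> y - 1\<close> at
  \<open>y = b / q * s\<close>, exponentiated; the right-hand side is the maximum of the
  left-hand side over \<open>s\<close>.\<close>

lemma powr_mult_exp_bounded:
  fixes s q b :: real
  assumes "s > 0" "q > 0" "b > 0"
  shows "s powr q * exp (- b * s) \<le> exp (- q - q * ln (b / q))"
proof -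
  have "ln (b / q * s) \<le> b / q * s - 1"
    using assms by (intro ln_le_minus_one) auto
  then have "ln (b / q) + ln s \<le> b / q * s - 1"
    using assms by (subst (asm) ln_mult_pos) auto
  then have "q * (ln (b / q) + ln s) \<le> q * (b / q * s - 1)"
    using assms by (intro mult_left_mono) auto
  then have "q * ln s - b * s \<le> - q - q * ln (b / q)"
    using assms by (simp add: algebra_simps)
  moreover have "s powr q * exp (- b * s) = exp (q * ln s - b * s)"
    using assms by (simp add: powr_def exp_diff exp_minus field_simps)
  ultimately show ?thesis by simp
qed

text \<open>On a ball the power is bounded and the exponential is at most \<open>1\<close>.
  Outside of it coercivity and \<open>p \<ge> 1\<close> give \<open>E x \<ge> c * norm
  x\<close>, and an exponential beats a power.\<close>

lemma gibbs_weight_moment_bounded: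
  fixes E :: "'h::real_normed_vector \<Rightarrow> real"
  assumes "\<alpha> > 0" "p \<ge> 1" "c > 0" and nn: "\<And>x. 0 \<le> E x"
    and coercive: "\<And>x. norm x > R0 \<Longrightarrow> E x \<ge> c * norm x powr p"
  shows "\<exists>B>0. \<forall>x. (1 + norm x) powr p * exp (- \<alpha> * E x) \<le> B"
proof -
  define r where "r = max R0 1"
  define B where "B = (1 + r) powr p + exp (\<alpha> * c) * exp (- p - p * ln (\<alpha> * c / p))"
  have "(1 + norm x) powr p * exp (- \<alpha> * E x) \<le> B" for x
  proof (cases "norm x \<le> r")
    case True
    have "(1 + norm x) powr p * exp (- \<alpha> * E x) \<le> (1 + r) powr p * 1"
      using True assms nn[of x] by (intro mult_mono powr_mono2) auto
    then show ?thesis unfolding B_def by (simp add: add_increasing2)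
  next
    case False
    then have x: "norm x > R0" "norm x > 1" by (auto simp: r_def)
    have "norm x powr 1 \<le> norm x powr p" using assms x by (intro powr_mono) auto
    then have "c * norm x \<le> E x"
      using coercive[OF x(1)] assms x
      by (smt (verit, ccfv_threshold) mult_left_mono powr_one)
    then have "exp (- \<alpha> * E x) \<le> exp (\<alpha> * c + - (\<alpha> * c) * (1 + norm x))"
      using assms by (simp add: algebra_simps)
    then have "(1 + norm x) powr p * exp (- \<alpha> * E x)
        \<le> (1 + norm x) powr p * (exp (\<alpha> * c) * exp (- (\<alpha> * c) * (1 + norm x)))"
      by (intro mult_left_mono) (auto simp flip: exp_add)
    also have "\<dots> = exp (\<alpha> * c) * ((1 + norm x) powr p * exp (- (\<alpha> * c) * (1 + norm x)))"
      by simp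
    also have "\<dots> \<le> exp (\<alpha> * c) * exp (- p - p * ln (\<alpha> * c / p))"
      using assms by (intro mult_left_mono powr_mult_exp_bounded) (auto simp: add_pos_nonneg)
    finally show ?thesis unfolding B_def by (simp add: add_increasing)
  qed
  moreover have "B > 0" unfolding B_def by (intro add_nonneg_pos mult_pos_pos) auto
  ultimately show ?thesis by blast
qed

lemma exp_neg_diff_le:
  fixes a b :: real
  shows "\<bar>exp (- a) - exp (- b)\<bar> \<le> \<bar>a - b\<bar> * max (exp (- a)) (exp (- b))"
proof -
  have *: "\<bar>exp (- a) - exp (- b)\<bar> \<le> \<bar>a - b\<bar> * exp (- a)" if "a \<le> b" for a b :: real
  proof -
    have "exp (- b) = exp (- a) * exp (a - b)" by (simp flip: exp_add)
    moreover have "1 - exp (a - b) \<le> b - a" using exp_ge_add_one_self[of "a - b"] by linarith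
    then have "exp (- a) * (1 - exp (a - b)) \<le> exp (- a) * (b - a)"
      by (intro mult_left_mono) auto
    ultimately show ?thesis using that by (simp add: algebra_simps)
  qed
  show ?thesis
  proof (cases "a \<le> b")
    case True
    then have "max (exp (- a)) (exp (- b)) = exp (- a)" by simp
    then show ?thesis using *[OF True] by simp
  next
    case False
    then have "max (exp (- a)) (exp (- b)) = exp (- b)" by simp
    then show ?thesis using *[of b a] False by (simp add: abs_minus_commute)
  qed
qed

text \<open>Points at distance more than \<open>1\<close> are handled by boundedness. For
  points \<open>x\<close>, \<open>y\<close> at distance at most \<open>1\<close> the numbers
  \<open>1 + norm x\<close> and \<open>1 + norm y\<close> differ at most by a factor
  \<open>2\<close>, so the polynomial factor in the local Lipschitz bound of \<open>E\<close>
  can be evaluated at whichever point has the larger weight, where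
  \<open>gibbs_weight_moment_bounded\<close> absorbs it. The spare factor \<open>1 + norm
  y\<close> in the estimate \<open>near\<close> covers the weighted identity map.\<close>

lemma gibbs_weight_lipschitz:
  fixes E :: "'h::real_normed_vector \<Rightarrow> real"
  assumes "admissible_objective E" and \<alpha>: "\<alpha> > 0"
  shows "\<exists>K>0. \<forall>x y. norm (exp (- \<alpha> * E x) *\<^sub>R x) \<le> K \<and>
           \<bar>exp (- \<alpha> * E x) - exp (- \<alpha> * E y)\<bar> \<le> K * norm (x - y) \<and>
           norm (exp (- \<alpha> * E x) *\<^sub>R x - exp (- \<alpha> * E y) *\<^sub>R y) \<le> K * norm (x - y)"
proof -
  from assms(1) obtain p c R0 L where E: "p \<ge> 1" "c > 0" "L > 0" "\<And>x. 0 \<le> E x"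
      "\<And>x. norm x > R0 \<Longrightarrow> E x \<ge> c * norm x powr p"
      "\<And>x y. \<bar>E x - E y\<bar> \<le> L * (1 + norm x powr (p - 1) + norm y powr (p - 1)) * norm (x - y)"
    unfolding admissible_objective_def by auto
  obtain B where B: "B > 0" "\<And>x. (1 + norm x) powr p * exp (- \<alpha> * E x) \<le> B"
    using gibbs_weight_moment_bounded[OF \<alpha> E(1,2,4,5)] by blast
  define g where "g x = exp (- \<alpha> * E x)" for x
  define w where "w x = 1 + norm x" for x :: 'h
  have w1: "1 \<le> w x" for x unfolding w_def by simp
  have g: "0 < g x" "g x \<le> 1" for x using \<alpha> E(4)[of x] unfolding g_def by auto
  have wp: "w x * w x powr (p - 1) = w x powr p" for x
    using w1[of x] powr_add[of "w x" 1 "p - 1"] by simp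
  have wg: "w x powr p * g x \<le> B" for x using B unfolding g_def w_def by blast
  have xg: "norm x * g x \<le> B" for x
  proof -
    have "w x powr 1 \<le> w x powr p" using w1[of x] E(1) by (intro powr_mono) auto
    then have "norm x \<le> w x powr p" using w1[of x] by (simp add: w_def)
    then have "norm x * g x \<le> w x powr p * g x" using g[of x] by (intro mult_right_mono) auto
    then show ?thesis using wg[of x] by linarith
  qed
  define K1 where "K1 = L * (2 + 2 powr (p - 1))"
  have K1: "K1 > 0" unfolding K1_def using E by (intro mult_pos_pos add_pos_nonneg) auto
  have dE: "\<bar>E x - E y\<bar> \<le> K1 * w x powr (p - 1) * norm (x - y)" if "norm (x - y) \<le> 1" for x y
  proof -
    have "norm y \<le> norm x + norm (x - y)" by (metis norm_minus_commute norm_triangle_sub)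
    then have "norm y \<le> 2 * w x" using that norm_ge_zero[of x] unfolding w_def distrib_left by argo
    then have "norm y powr (p - 1) \<le> (2 * w x) powr (p - 1)"
      using E(1) by (intro powr_mono2) auto
    also have "\<dots> = 2 powr (p - 1) * w x powr (p - 1)" using w1[of x] by (simp add: powr_mult)
    finally have 1: "norm y powr (p - 1) \<le> 2 powr (p - 1) * w x powr (p - 1)" .
    have 2: "norm x powr (p - 1) \<le> w x powr (p - 1)"
      using E(1) by (intro powr_mono2) (auto simp: w_def)
    have 3: "1 \<le> w x powr (p - 1)" using w1[of x] E(1) by (intro ge_one_powr_ge_zero) auto
    have "L * (1 + norm x powr (p - 1) + norm y powr (p - 1)) \<le> K1 * w x powr (p - 1)"
      unfolding K1_def mult.assoc using 1 2 3 E(3)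
      by (intro mult_left_mono) (simp_all add: algebra_simps)
    then show ?thesis using E(6)[of x y] mult_right_mono[OF _ norm_ge_zero[of "x - y"]]
      by (meson order_trans)
  qed
  define K where "K = 1 + 2 * B + 2 * \<alpha> * K1 * B"
  have K: "1 \<le> K" "2 * B \<le> K" "1 + 2 * \<alpha> * K1 * B \<le> K" using B(1) K1 \<alpha> unfolding K_def by auto
  \<comment> \<open>the two values are compared at the point \<open>z\<close> where the weight is larger\<close>
  have near: "w y * \<bar>g x - g y\<bar> \<le> 2 * \<alpha> * K1 * B * norm (x - y)"
    if n: "norm (x - y) \<le> 1" for x y
  proof -
    obtain z where z: "z = x \<or> z = y" "max (g x) (g y) = g z" by (metis max_def)
    have dz: "\<bar>E x - E y\<bar> \<le> K1 * w z powr (p - 1) * norm (x - y)"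
      using z(1) dE[OF n] dE[of y x] n by (auto simp: norm_minus_commute abs_minus_commute)
    have wy: "w y \<le> 2 * w z"
    proof -
      have "norm y \<le> norm x + norm (x - y)" by (metis norm_minus_commute norm_triangle_sub)
      then show ?thesis
        using z(1) n norm_ge_zero[of x] norm_ge_zero[of y] unfolding w_def
        by (elim disjE; simp only: distrib_left; argo)
    qed
    have "\<bar>g x - g y\<bar> \<le> \<bar>\<alpha> * E x - \<alpha> * E y\<bar> * g z"
      using exp_neg_diff_le[of "\<alpha> * E x" "\<alpha> * E y"] z(2) unfolding g_def by simp
    also have "\<bar>\<alpha> * E x - \<alpha> * E y\<bar> = \<alpha> * \<bar>E x - E y\<bar>"
      using \<alpha> by (simp add: abs_mult flip: right_diff_distrib)
    finally have "w y * \<bar>g x - g y\<bar> \<le> (2 * w z) * (\<alpha> * (K1 * w z powr (p - 1) * norm (x - y)) * g z)"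
      using wy w1[of y] w1[of z] g[of z] \<alpha> dz
      by (intro mult_mono order_trans[OF _ mult_right_mono[OF mult_left_mono[OF dz]]]) auto
    also have "\<dots> = (2 * \<alpha> * K1 * norm (x - y)) * ((w z * w z powr (p - 1)) * g z)" by simp
    also have "\<dots> \<le> (2 * \<alpha> * K1 * norm (x - y)) * B"
      unfolding wp using wg[of z] \<alpha> K1 by (intro mult_left_mono) auto
    finally show ?thesis by (simp add: mult_ac)
  qed
  have l1: "\<bar>g x - g y\<bar> \<le> K * norm (x - y)" for x y
  proof (cases "norm (x - y) \<le> 1")
    case True
    have "\<bar>g x - g y\<bar> \<le> w y * \<bar>g x - g y\<bar>" using mult_right_mono[OF w1[of y], of "\<bar>g x - g y\<bar>"] by simp
    also have "\<dots> \<le> (2 * \<alpha> * K1 * B) * norm (x - y)" by (rule near[OF True])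
    also have "\<dots> \<le> K * norm (x - y)" using K by (intro mult_right_mono) auto
    finally show ?thesis .
  next
    case False
    have "\<bar>g x - g y\<bar> \<le> 1 * 1" using g[of x] g[of y] by auto
    also have "\<dots> \<le> K * norm (x - y)" using False K by (intro mult_mono) auto
    finally show ?thesis .
  qed
  have l2: "norm (g x *\<^sub>R x - g y *\<^sub>R y) \<le> K * norm (x - y)" for x y
  proof (cases "norm (x - y) \<le> 1")
    case True
    have "g x *\<^sub>R x - g y *\<^sub>R y = g x *\<^sub>R (x - y) + (g x - g y) *\<^sub>R y"
      by (simp add: algebra_simps)
    then have "norm (g x *\<^sub>R x - g y *\<^sub>R y) \<le> g x * norm (x - y) + norm y * \<bar>g x - g y\<bar>"
      using norm_triangle_ineq[of "g x *\<^sub>R (x - y)" "(g x - g y) *\<^sub>R y"] g[of x]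
      by (simp add: mult.commute)
    also have "\<dots> \<le> 1 * norm (x - y) + w y * \<bar>g x - g y\<bar>"
      using g by (intro add_mono mult_right_mono) (auto simp: w_def)
    also have "\<dots> \<le> 1 * norm (x - y) + (2 * \<alpha> * K1 * B) * norm (x - y)"
      using near[OF True] by simp
    also have "\<dots> = (1 + 2 * \<alpha> * K1 * B) * norm (x - y)" by (simp only: distrib_right)
    also have "\<dots> \<le> K * norm (x - y)" using K by (intro mult_right_mono) auto
    finally show ?thesis .
  next
    case False
    have "norm (g x *\<^sub>R x - g y *\<^sub>R y) \<le> norm (g x *\<^sub>R x) + norm (g y *\<^sub>R y)"
      by (rule norm_triangle_ineq4)
    also have "\<dots> \<le> (2 * B) * 1" using xg[of x] xg[of y] g[of x] g[of y] by (simp add: mult.commute)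
    also have "\<dots> \<le> K * norm (x - y)" using False K B(1) by (intro mult_mono) auto
    finally show ?thesis .
  qed
  have "norm (g x *\<^sub>R x) \<le> K" for x
    using xg[of x] g[of x] K B(1) by (simp add: mult.commute)
  then show ?thesis using l1 l2 K unfolding g_def by (intro exI[of _ K]) auto
qed

text \<open>By Markov's inequality at least three quarters of the mass lie in the ball of
  radius \<open>2 * R\<close>, where the upper growth bound of \<open>E\<close> keeps the
  weight above a positive constant.\<close>

lemma gibbs_normalisation_lower_bound:
  fixes E :: "'h::{real_inner, banach, second_countable_topology} \<Rightarrow> real"
  assumes "admissible_objective E" "\<alpha> > 0" "R > 0"
  shows "\<exists>a>0. \<forall>\<mu>. prob_space \<mu> \<longrightarrow> sets \<mu> = sets borel \<longrightarrow> integrable \<mu> (\<lambda>x. (norm x)\<^sup>2) \<longrightarrow>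
           (\<integral>x. (norm x)\<^sup>2 \<partial>\<mu>) \<le> R\<^sup>2 \<longrightarrow> a \<le> (\<integral>x. exp (- \<alpha> * E x) \<partial>\<mu>)"
proof -
  from assms(1) obtain p C where E: "p \<ge> 1" "C > 0" "\<And>x. 0 \<le> E x" "\<And>x. E x \<le> C * (1 + norm x powr p)"
    unfolding admissible_objective_def by auto
  obtain K where K: "\<And>x y. \<bar>exp (- \<alpha> * E x) - exp (- \<alpha> * E y)\<bar> \<le> K * norm (x - y)" "K > 0"
    using gibbs_weight_lipschitz[OF assms(1,2)] by blast
  define b where "b = exp (- \<alpha> * (C * (1 + (2 * R) powr p)))"
  have b: "b > 0" unfolding b_def by simp
  have cont: "continuous_on UNIV (\<lambda>x. exp (- \<alpha> * E x))"
    using K by (intro lipschitz_on_continuous_on[of K] lipschitz_onI) (auto simp: dist_norm dist_real_def)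
  \<comment> \<open>pointwise form of Markov's inequality for the event \<open>norm x > 2 * R\<close>\<close>
  have pt: "b * (1 - (norm x)\<^sup>2 / (4 * R\<^sup>2)) \<le> exp (- \<alpha> * E x)" for x
  proof (cases "norm x \<le> 2 * R")
    case True
    then have "norm x powr p \<le> (2 * R) powr p" using E by (intro powr_mono2) auto
    then have "C * (1 + norm x powr p) \<le> C * (1 + (2 * R) powr p)" using E(2) by simp
    then have "b \<le> exp (- \<alpha> * E x)"
      using E(4)[of x] assms(2) unfolding b_def by simp
    moreover have "b * (1 - (norm x)\<^sup>2 / (4 * R\<^sup>2)) \<le> b * 1"
      using b assms(3) by (intro mult_left_mono) auto
    ultimately show ?thesis by linarith
  next
    case False
    then have "(2 * R)\<^sup>2 \<le> (norm x)\<^sup>2" using assms(3) by (intro power_mono) auto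
    then have "1 \<le> (norm x)\<^sup>2 / (4 * R\<^sup>2)" using assms(3) by (simp add: power_mult_distrib)
    then have "b * (1 - (norm x)\<^sup>2 / (4 * R\<^sup>2)) \<le> 0" using b by (simp add: mult_le_0_iff)
    then show ?thesis by (rule order_trans) simp
  qed
  have "b * (3 / 4) \<le> (\<integral>x. exp (- \<alpha> * E x) \<partial>\<mu>)"
    if \<mu>: "prob_space \<mu>" "sets \<mu> = sets borel" "integrable \<mu> (\<lambda>x. (norm x)\<^sup>2)"
      "(\<integral>x. (norm x)\<^sup>2 \<partial>\<mu>) \<le> R\<^sup>2" for \<mu>
  proof -
    interpret prob_space \<mu> by fact
    have m: "(\<lambda>x. exp (- \<alpha> * E x)) \<in> borel_measurable \<mu>"
      unfolding measurable_cong_sets[OF \<mu>(2) refl] by (rule borel_measurable_continuous_onI[OF cont])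
    have i: "integrable \<mu> (\<lambda>x. exp (- \<alpha> * E x))"
      using E(3) assms(2) by (intro integrable_const_bound[of _ 1] m) auto
    have "b * (3 / 4) \<le> b * (1 - (\<integral>x. (norm x)\<^sup>2 \<partial>\<mu>) / (4 * R\<^sup>2))"
      using b \<mu>(4) assms(3) by (intro mult_left_mono) (auto simp: field_simps)
    also have "\<dots> = (\<integral>x. b * (1 - (norm x)\<^sup>2 / (4 * R\<^sup>2)) \<partial>\<mu>)"
      using \<mu>(3) by (simp add: prob_space)
    also have "\<dots> \<le> (\<integral>x. exp (- \<alpha> * E x) \<partial>\<mu>)"
      using \<mu>(3) i pt by (intro integral_mono) auto
    finally show ?thesis .
  qed
  then show ?thesis using b by (intro exI[of _ "b * (3 / 4)"]) auto
qed

section \<open>Wasserstein distance and stability of the consensus point\<close>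

lemma W2_le_if_coupling:
  assumes "\<pi> \<in> couplings \<mu> \<nu>" "(\<integral>\<^sup>+z. ennreal ((norm (fst z - snd z))\<^sup>2) \<partial>\<pi>) \<le> ennreal (r\<^sup>2)" "0 \<le> r"
  shows "W2 \<mu> \<nu> \<le> r"
proof -
  have "(INF \<pi>\<in>couplings \<mu> \<nu>. \<integral>\<^sup>+z. ennreal ((norm (fst z - snd z))\<^sup>2) \<partial>\<pi>) \<le> ennreal (r\<^sup>2)"
    using assms by (meson INF_lower2)
  from enn2real_mono[OF this] have "enn2real (INF \<pi>\<in>couplings \<mu> \<nu>. \<integral>\<^sup>+z. ennreal ((norm (fst z - snd z))\<^sup>2) \<partial>\<pi>) \<le> r\<^sup>2"
    by simp
  then have "W2 \<mu> \<nu> \<le> sqrt (r\<^sup>2)" unfolding W2_def by (rule real_sqrt_le_mono)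
  then show ?thesis using assms(3) by simp
qed

text \<open>A coupling of finite cost is required because \<open>W2\<close> converts the
  infimum to a real number, and an infinite infimum would become \<open>0\<close>.\<close>

lemma W2_ge_if_all_couplings:
  assumes "\<pi>\<^sub>0 \<in> couplings \<mu> \<nu>" "(\<integral>\<^sup>+z. ennreal ((norm (fst z - snd z))\<^sup>2) \<partial>\<pi>\<^sub>0) < \<infinity>" "0 \<le> r"
    and "\<And>\<pi>. \<pi> \<in> couplings \<mu> \<nu> \<Longrightarrow> ennreal (r\<^sup>2) \<le> (\<integral>\<^sup>+z. ennreal ((norm (fst z - snd z))\<^sup>2) \<partial>\<pi>)"
  shows "r \<le> W2 \<mu> \<nu>"
proof -
  let ?I = "INF \<pi>\<in>couplings \<mu> \<nu>. \<integral>\<^sup>+z. ennreal ((norm (fst z - snd z))\<^sup>2) \<partial>\<pi>"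
  have 1: "ennreal (r\<^sup>2) \<le> ?I" using assms(4) by (intro INF_greatest)
  have "?I < \<infinity>" using assms(1,2) by (meson INF_lower le_less_trans)
  then have "enn2real (ennreal (r\<^sup>2)) \<le> enn2real ?I" using 1 by (intro enn2real_mono) auto
  then have "sqrt (r\<^sup>2) \<le> W2 \<mu> \<nu>" unfolding W2_def by (intro real_sqrt_le_mono) simp
  then show ?thesis using assms(3) by simp
qed

lemma P2_D:
  assumes "\<mu> \<in> P2 V"
  shows "prob_space \<mu>" "sets \<mu> = sets borel" "integrable \<mu> (\<lambda>x. (norm x)\<^sup>2)" "AE x in \<mu>. x \<in> V"
  using assms by (auto simp: P2_def)

lemma couplings_integral:
  fixes f :: "'h::{real_inner, banach, second_countable_topology} \<Rightarrow> 'b::{banach, second_countable_topology}"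
  assumes "\<pi> \<in> couplings \<mu> \<nu>" "f \<in> borel_measurable borel"
  shows "integral\<^sup>L \<mu> f = (\<integral>z. f (fst z) \<partial>\<pi>)" "integral\<^sup>L \<nu> f = (\<integral>z. f (snd z) \<partial>\<pi>)"
    "integrable \<mu> f \<longleftrightarrow> integrable \<pi> (\<lambda>z. f (fst z))" "integrable \<nu> f \<longleftrightarrow> integrable \<pi> (\<lambda>z. f (snd z))"
proof -
  have s: "sets \<pi> = sets (borel \<Otimes>\<^sub>M borel)" and d: "\<mu> = distr \<pi> borel fst" "\<nu> = distr \<pi> borel snd"
    using assms(1) unfolding couplings_def by auto
  have m: "fst \<in> measurable \<pi> borel" "snd \<in> measurable \<pi> borel"
    unfolding measurable_cong_sets[OF s refl] by measurable
  show "integral\<^sup>L \<mu> f = (\<integral>z. f (fst z) \<partial>\<pi>)" "integral\<^sup>L \<nu> f = (\<integral>z. f (snd z) \<partial>\<pi>)"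
    unfolding d using m assms(2) by (simp_all add: integral_distr)
  show "integrable \<mu> f \<longleftrightarrow> integrable \<pi> (\<lambda>z. f (fst z))" "integrable \<nu> f \<longleftrightarrow> integrable \<pi> (\<lambda>z. f (snd z))"
    unfolding d using m assms(2) by (simp_all add: integrable_distr_eq)
qed

lemma norm_diff_power2_le: "(norm (a - b))\<^sup>2 \<le> 2 * (norm a)\<^sup>2 + 2 * (norm (b::'a::real_normed_vector))\<^sup>2"
proof -
  have "(norm (a - b))\<^sup>2 \<le> (norm a + norm b)\<^sup>2"
    by (intro power_mono norm_triangle_ineq4) auto
  also have "\<dots> \<le> 2 * (norm a)\<^sup>2 + 2 * (norm b)\<^sup>2"
    using sum_squares_bound[of "norm a" "norm b"] by (simp add: power2_sum)
  finally show ?thesis .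
qed

lemma couplings_cost:
  assumes "\<mu> \<in> P2 V" "\<nu> \<in> P2 V" "\<pi> \<in> couplings \<mu> \<nu>"
  shows "integrable \<pi> (\<lambda>z. (norm (fst z - snd z))\<^sup>2)"
    "(\<integral>\<^sup>+z. ennreal ((norm (fst z - snd z))\<^sup>2) \<partial>\<pi>) = ennreal (\<integral>z. (norm (fst z - snd z))\<^sup>2 \<partial>\<pi>)"
    "(\<integral>z. (norm (fst z - snd z))\<^sup>2 \<partial>\<pi>) \<le> 2 * (\<integral>x. (norm x)\<^sup>2 \<partial>\<mu>) + 2 * (\<integral>x. (norm x)\<^sup>2 \<partial>\<nu>)"
proof -
  have m: "(\<lambda>x::'a. (norm x)\<^sup>2) \<in> borel_measurable borel" by measurable
  note c = couplings_integral[OF assms(3) m]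
  have s: "sets \<pi> = sets (borel \<Otimes>\<^sub>M borel)" using assms(3) unfolding couplings_def by auto
  have i: "integrable \<pi> (\<lambda>z. 2 * (norm (fst z))\<^sup>2 + 2 * (norm (snd z))\<^sup>2)"
    using c(3,4) P2_D(3)[OF assms(1)] P2_D(3)[OF assms(2)] by simp
  show j: "integrable \<pi> (\<lambda>z. (norm (fst z - snd z))\<^sup>2)"
  proof (rule Bochner_Integration.integrable_bound[OF i])
    show "(\<lambda>z. (norm (fst z - snd z))\<^sup>2) \<in> borel_measurable \<pi>"
      unfolding measurable_cong_sets[OF s refl] by measurable
  qed (use norm_diff_power2_le in auto)
  show "(\<integral>\<^sup>+z. ennreal ((norm (fst z - snd z))\<^sup>2) \<partial>\<pi>) = ennreal (\<integral>z. (norm (fst z - snd z))\<^sup>2 \<partial>\<pi>)"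
    by (intro nn_integral_eq_integral j) auto
  have "(\<integral>z. (norm (fst z - snd z))\<^sup>2 \<partial>\<pi>) \<le> (\<integral>z. 2 * (norm (fst z))\<^sup>2 + 2 * (norm (snd z))\<^sup>2 \<partial>\<pi>)"
    by (intro integral_mono i j norm_diff_power2_le)
  also have "\<dots> = 2 * (\<integral>x. (norm x)\<^sup>2 \<partial>\<mu>) + 2 * (\<integral>x. (norm x)\<^sup>2 \<partial>\<nu>)"
    using c P2_D(3)[OF assms(1)] P2_D(3)[OF assms(2)] by simp
  finally show "(\<integral>z. (norm (fst z - snd z))\<^sup>2 \<partial>\<pi>) \<le> 2 * (\<integral>x. (norm x)\<^sup>2 \<partial>\<mu>) + 2 * (\<integral>x. (norm x)\<^sup>2 \<partial>\<nu>)" .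
qed

text \<open>The independent coupling, which witnesses that the infimum in \<open>W2\<close> is
  finite on \<open>P2\<close>.\<close>

lemma pair_measure_coupling:
  assumes "\<mu> \<in> P2 V" "\<nu> \<in> P2 V"
  shows "\<mu> \<Otimes>\<^sub>M \<nu> \<in> couplings \<mu> \<nu>"
proof -
  interpret \<mu>: prob_space \<mu> using P2_D(1)[OF assms(1)] .
  interpret \<nu>: prob_space \<nu> using P2_D(1)[OF assms(2)] .
  interpret pair_prob_space \<mu> \<nu> ..
  have s: "sets \<mu> = sets borel" "sets \<nu> = sets borel" using P2_D(2) assms by auto
  have "distr (\<mu> \<Otimes>\<^sub>M \<nu>) borel fst = distr (\<mu> \<Otimes>\<^sub>M \<nu>) \<mu> fst"
    using s by (intro distr_cong) auto
  moreover have "distr (\<mu> \<Otimes>\<^sub>M \<nu>) \<mu> fst = \<mu>" by (rule \<nu>.distr_pair_fst)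
  moreover have "distr (\<mu> \<Otimes>\<^sub>M \<nu>) borel snd = distr (\<mu> \<Otimes>\<^sub>M \<nu>) \<nu> snd"
    using s by (intro distr_cong) auto
  moreover have "distr (\<mu> \<Otimes>\<^sub>M \<nu>) \<nu> snd = \<nu>"
  proof (rule measure_eqI)
    fix A assume "A \<in> sets (distr (\<mu> \<Otimes>\<^sub>M \<nu>) \<nu> snd)"
    then have A: "A \<in> sets \<nu>" by simp
    then have "snd -` A \<inter> space (\<mu> \<Otimes>\<^sub>M \<nu>) = space \<mu> \<times> A"
      using sets.sets_into_space by (auto simp: space_pair_measure)
    then show "emeasure (distr (\<mu> \<Otimes>\<^sub>M \<nu>) \<nu> snd) A = emeasure \<nu> A"
      using A by (simp add: emeasure_distr \<nu>.emeasure_pair_measure_Times \<mu>.emeasure_space_1)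
  qed simp
  ultimately show ?thesis
    unfolding couplings_def using s by (auto intro: prob_space_axioms sets_pair_measure_cong)
qed

lemma W2_le_second_moments:
  assumes "\<mu> \<in> P2 V" "\<nu> \<in> P2 V" "(\<integral>x. (norm x)\<^sup>2 \<partial>\<mu>) \<le> R\<^sup>2" "(\<integral>x. (norm x)\<^sup>2 \<partial>\<nu>) \<le> R\<^sup>2" "0 \<le> R"
  shows "W2 \<mu> \<nu> \<le> 2 * R"
proof -
  note c = couplings_cost[OF assms(1,2) pair_measure_coupling[OF assms(1,2)]]
  show "W2 \<mu> \<nu> \<le> 2 * R"
    using c(3) assms(3-5)
    by (intro W2_le_if_coupling[OF pair_measure_coupling[OF assms(1,2)]])
      (auto simp: c(2) power_mult_distrib intro!: ennreal_leI)
qed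

lemma W2_distr_le:
  fixes X Y :: "'w \<Rightarrow> 'h::{real_inner, banach, second_countable_topology}"
  assumes "prob_space M" "X \<in> borel_measurable M" "Y \<in> borel_measurable M"
    and "(\<integral>\<^sup>+\<omega>. ennreal ((norm (X \<omega> - Y \<omega>))\<^sup>2) \<partial>M) \<le> ennreal (r\<^sup>2)" "0 \<le> r"
  shows "W2 (distr M borel X) (distr M borel Y) \<le> r"
proof (rule W2_le_if_coupling[OF _ _ assms(5)])
  let ?\<pi> = "distr M (borel \<Otimes>\<^sub>M borel) (\<lambda>\<omega>. (X \<omega>, Y \<omega>))"
  note [measurable] = assms(2,3)
  show "?\<pi> \<in> couplings (distr M borel X) (distr M borel Y)"
    unfolding couplings_def using assms(1)
    by (auto intro!: prob_space.prob_space_distr simp: distr_distr comp_def)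
  show "(\<integral>\<^sup>+z. ennreal ((norm (fst z - snd z))\<^sup>2) \<partial>?\<pi>) \<le> ennreal (r\<^sup>2)"
    using assms(4) by (subst nn_integral_distr) (auto simp: split_beta)
qed

text \<open>The easy half of Kantorovich--Rubinstein duality, followed by Jensen's inequality
  to pass from the first to the second moment of the distance.\<close>

lemma lipschitz_expectation_coupling:
  fixes f :: "'h::{real_inner, banach, second_countable_topology} \<Rightarrow> 'b::{banach, second_countable_topology}"
  assumes "\<mu> \<in> P2 V" "\<nu> \<in> P2 V" "\<pi> \<in> couplings \<mu> \<nu>" "K > 0"
    and lip: "\<And>x y. norm (f x - f y) \<le> K * norm (x - y)" and bnd: "\<And>x. norm (f x) \<le> C"
  shows "norm (integral\<^sup>L \<mu> f - integral\<^sup>L \<nu> f) \<le> K * sqrt (\<integral>z. (norm (fst z - snd z))\<^sup>2 \<partial>\<pi>)"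
proof -
  interpret \<pi>: prob_space \<pi> using assms(3) unfolding couplings_def by auto
  have s: "sets \<pi> = sets (borel \<Otimes>\<^sub>M borel)" using assms(3) unfolding couplings_def by auto
  have "continuous_on UNIV f"
    using lip assms(4) by (intro lipschitz_on_continuous_on[of K] lipschitz_onI) (auto simp: dist_norm)
  then have f: "f \<in> borel_measurable borel" by (rule borel_measurable_continuous_onI)
  note c = couplings_integral[OF assms(3) f] and j = couplings_cost(1)[OF assms(1-3)]
  have mf: "(\<lambda>z. f (fst z)) \<in> borel_measurable \<pi>" "(\<lambda>z. f (snd z)) \<in> borel_measurable \<pi>"
    "(\<lambda>z. norm (fst z - snd z)) \<in> borel_measurable \<pi>"
    unfolding measurable_cong_sets[OF s refl] using f by measurable
  have i: "integrable \<pi> (\<lambda>z. f (fst z))" "integrable \<pi> (\<lambda>z. f (snd z))"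
    using bnd mf by (auto intro!: \<pi>.integrable_const_bound[of _ C])
  have j1: "integrable \<pi> (\<lambda>z. norm (fst z - snd z))"
    by (rule \<pi>.square_integrable_imp_integrable[OF mf(3) j])
  have "norm (integral\<^sup>L \<mu> f - integral\<^sup>L \<nu> f) = norm (\<integral>z. f (fst z) - f (snd z) \<partial>\<pi>)"
    using i by (simp add: c(1,2))
  also have "\<dots> \<le> (\<integral>z. norm (f (fst z) - f (snd z)) \<partial>\<pi>)" by (rule integral_norm_bound)
  also have "\<dots> \<le> (\<integral>z. K * norm (fst z - snd z) \<partial>\<pi>)"
    using i j1 lip by (intro integral_mono) auto
  also have "\<dots> = K * (\<integral>z. norm (fst z - snd z) \<partial>\<pi>)" by simp
  also have "(\<integral>z. norm (fst z - snd z) \<partial>\<pi>) \<le> sqrt (\<integral>z. (norm (fst z - snd z))\<^sup>2 \<partial>\<pi>)"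
    using \<pi>.variance_positive[of "\<lambda>z. norm (fst z - snd z)"] \<pi>.variance_eq[OF j1 j]
    by (intro real_le_rsqrt) simp
  finally show ?thesis using assms(4) by simp
qed

text \<open>With numerators \<open>N1\<close>, \<open>N2\<close> and denominators
  \<open>D1\<close>, \<open>D2\<close> of the two consensus points, their difference is
  \<open>(N1 - N2) / D1 + (D2 - D1) / (D1 * D2) * N2\<close>; each bracket is controlled by
  the cost of any coupling, and the infimum over all couplings is taken at the end. The
  subspace \<open>V\<close> is quantified inside, so that the constant does not depend on
  it.\<close>

lemma consensus_point_lipschitz:
  fixes E :: "'h::{real_inner, banach, second_countable_topology} \<Rightarrow> real"
  assumes "admissible_objective E" "\<alpha> > 0" "R > 0"
  shows "\<exists>C>0. \<forall>V \<mu> \<nu>. \<mu> \<in> P2 V \<longrightarrow> \<nu> \<in> P2 V \<longrightarrow>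
           (\<integral>x. (norm x)\<^sup>2 \<partial>\<mu>) \<le> R\<^sup>2 \<longrightarrow> (\<integral>x. (norm x)\<^sup>2 \<partial>\<nu>) \<le> R\<^sup>2 \<longrightarrow>
           norm (consensus_point \<alpha> E \<mu> - consensus_point \<alpha> E \<nu>) \<le> C * W2 \<mu> \<nu>"
proof -
  obtain a where a: "a > 0" "\<And>\<mu>. prob_space \<mu> \<Longrightarrow> sets \<mu> = sets borel \<Longrightarrow> integrable \<mu> (\<lambda>x. (norm x)\<^sup>2) \<Longrightarrow>
           (\<integral>x. (norm x)\<^sup>2 \<partial>\<mu>) \<le> R\<^sup>2 \<Longrightarrow> a \<le> (\<integral>x. exp (- \<alpha> * E x) \<partial>\<mu>)"
    using gibbs_normalisation_lower_bound[OF assms] by metis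
  obtain K where K: "K > 0" "\<And>x. norm (exp (- \<alpha> * E x) *\<^sub>R x) \<le> K"
      "\<And>x y. norm (exp (- \<alpha> * E x) - exp (- \<alpha> * E y)) \<le> K * norm (x - y)"
      "\<And>x y. norm (exp (- \<alpha> * E x) *\<^sub>R x - exp (- \<alpha> * E y) *\<^sub>R y) \<le> K * norm (x - y)"
    using gibbs_weight_lipschitz[OF assms(1,2)] by (metis real_norm_def)
  have b1: "norm (exp (- \<alpha> * E x)) \<le> 1" for x
    using assms(1,2) unfolding admissible_objective_def by auto
  define C where "C = K / a + K * K / a\<^sup>2"
  have C: "C > 0" unfolding C_def using a K by (intro add_pos_pos divide_pos_pos mult_pos_pos) auto
  have "norm (consensus_point \<alpha> E \<mu> - consensus_point \<alpha> E \<nu>) \<le> C * W2 \<mu> \<nu>"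
    if P: "\<mu> \<in> P2 V" "\<nu> \<in> P2 V" and b: "(\<integral>x. (norm x)\<^sup>2 \<partial>\<mu>) \<le> R\<^sup>2" "(\<integral>x. (norm x)\<^sup>2 \<partial>\<nu>) \<le> R\<^sup>2" for \<mu> \<nu> V
  proof -
    interpret \<nu>: prob_space \<nu> using P2_D(1)[OF P(2)] .
    define D1 D2 where "D1 = (\<integral>x. exp (- \<alpha> * E x) \<partial>\<mu>)" and "D2 = (\<integral>x. exp (- \<alpha> * E x) \<partial>\<nu>)"
    define N1 N2 where "N1 = (\<integral>x. exp (- \<alpha> * E x) *\<^sub>R x \<partial>\<mu>)" and "N2 = (\<integral>x. exp (- \<alpha> * E x) *\<^sub>R x \<partial>\<nu>)"
    have D: "a \<le> D1" "a \<le> D2" unfolding D1_def D2_def using a(2) P2_D P b by blast+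
    have N2: "norm N2 \<le> K"
    proof -
      have "norm N2 \<le> (\<integral>x. norm (exp (- \<alpha> * E x) *\<^sub>R x) \<partial>\<nu>)" unfolding N2_def by (rule integral_norm_bound)
      also have "\<dots> \<le> (\<integral>x. K \<partial>\<nu>)" using K(1,2) by (intro integral_mono') auto
      finally show ?thesis by (simp add: \<nu>.prob_space)
    qed
    have main: "norm (consensus_point \<alpha> E \<mu> - consensus_point \<alpha> E \<nu>)
        \<le> C * sqrt (\<integral>z. (norm (fst z - snd z))\<^sup>2 \<partial>\<pi>)" if \<pi>: "\<pi> \<in> couplings \<mu> \<nu>" for \<pi>
    proof -
      define r where "r = sqrt (\<integral>z. (norm (fst z - snd z))\<^sup>2 \<partial>\<pi>)"
      have r: "0 \<le> r" unfolding r_def by simp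
      have dN: "norm (N1 - N2) \<le> K * r"
        unfolding N1_def N2_def r_def
        by (rule lipschitz_expectation_coupling[OF P \<pi> K(1,4,2)])
      have dD: "norm (D1 - D2) \<le> K * r"
        unfolding D1_def D2_def r_def
        by (rule lipschitz_expectation_coupling[OF P \<pi> K(1,3) b1])
      have q: "(D2 - D1) / (D1 * D2) = inverse D1 - inverse D2"
        using D a(1) by (simp add: field_simps)
      have "consensus_point \<alpha> E \<mu> - consensus_point \<alpha> E \<nu> = (N1 - N2) /\<^sub>R D1 + ((D2 - D1) / (D1 * D2)) *\<^sub>R N2"
        unfolding consensus_point_def N1_def[symmetric] N2_def[symmetric] D1_def[symmetric] D2_def[symmetric]
        unfolding q by (simp add: scaleR_diff_right scaleR_diff_left)
      then have "norm (consensus_point \<alpha> E \<mu> - consensus_point \<alpha> E \<nu>)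
          \<le> norm (N1 - N2) / D1 + norm (D1 - D2) / (D1 * D2) * norm N2"
        using norm_triangle_ineq[of "(N1 - N2) /\<^sub>R D1" "((D2 - D1) / (D1 * D2)) *\<^sub>R N2"] D a(1)
        by (simp add: abs_mult abs_minus_commute divide_inverse mult.commute)
      also have "\<dots> \<le> (K * r) / a + (K * r) / (a * a) * K"
        using D a(1) dN dD N2 r K(1)
        by (intro add_mono frac_le mult_mono divide_nonneg_nonneg) auto
      also have "\<dots> = C * r" unfolding C_def by (simp add: algebra_simps power2_eq_square)
      finally show ?thesis unfolding r_def .
    qed
    have "norm (consensus_point \<alpha> E \<mu> - consensus_point \<alpha> E \<nu>) / C \<le> W2 \<mu> \<nu>"
    proof (rule W2_ge_if_all_couplings[OF pair_measure_coupling[OF P]])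
      show "(\<integral>\<^sup>+z. ennreal ((norm (fst z - snd z))\<^sup>2) \<partial>(\<mu> \<Otimes>\<^sub>M \<nu>)) < \<infinity>"
        unfolding couplings_cost(2)[OF P pair_measure_coupling[OF P]] by simp
      show "0 \<le> norm (consensus_point \<alpha> E \<mu> - consensus_point \<alpha> E \<nu>) / C" using C by simp
      fix \<pi> assume \<pi>: "\<pi> \<in> couplings \<mu> \<nu>"
      have "norm (consensus_point \<alpha> E \<mu> - consensus_point \<alpha> E \<nu>) / C \<le> sqrt (\<integral>z. (norm (fst z - snd z))\<^sup>2 \<partial>\<pi>)"
        using main[OF \<pi>] C by (simp add: divide_le_eq mult.commute)
      then have "(norm (consensus_point \<alpha> E \<mu> - consensus_point \<alpha> E \<nu>) / C)\<^sup>2 \<le> (sqrt (\<integral>z. (norm (fst z - snd z))\<^sup>2 \<partial>\<pi>))\<^sup>2"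
        using C by (intro power_mono) auto
      also have "\<dots> = (\<integral>z. (norm (fst z - snd z))\<^sup>2 \<partial>\<pi>)"
        by (intro real_sqrt_pow2 integral_nonneg_AE) auto
      finally show "ennreal ((norm (consensus_point \<alpha> E \<mu> - consensus_point \<alpha> E \<nu>) / C)\<^sup>2)
          \<le> (\<integral>\<^sup>+z. ennreal ((norm (fst z - snd z))\<^sup>2) \<partial>\<pi>)"
        unfolding couplings_cost(2)[OF P \<pi>] by (rule ennreal_leI)
    qed
    then show ?thesis using C by (simp add: divide_le_eq mult.commute)
  qed
  then show ?thesis using C by blast
qed

section \<open>Second moments of Wiener increments and the Ito isometry\<close>

text \<open>The Dirac case \<open>v = 0\<close> is separate because
  \<open>centered_gaussian\<close> has no density there.\<close>

lemma centered_gaussian_moments: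
  assumes "0 \<le> v"
  shows "has_bochner_integral (centered_gaussian v) (\<lambda>x. x) 0"
    "has_bochner_integral (centered_gaussian v) (\<lambda>x. x\<^sup>2) v"
proof -
  have "has_bochner_integral (centered_gaussian v) (\<lambda>x. x) 0 \<and>
      has_bochner_integral (centered_gaussian v) (\<lambda>x. x\<^sup>2) v"
  proof (cases "v = 0")
    case True
    interpret r: prob_space "return borel (0::real)" by (rule prob_space_return) simp
    have "integrable (return borel 0) f" if [measurable]: "f \<in> borel_measurable borel" for f :: "real \<Rightarrow> real"
    proof (rule r.integrable_const_bound)
      show "AE x in return borel 0. norm (f x) \<le> norm (f 0)" by (subst AE_return) measurable
    qed simp
    note int = this
    have i: "has_bochner_integral (return borel 0) f (f 0)" if "f \<in> borel_measurable borel" for f :: "real \<Rightarrow> real"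
      unfolding has_bochner_integral_iff by (intro conjI int integral_return that) simp
    have c: "centered_gaussian 0 = return borel 0" by (simp add: centered_gaussian_def)
    have "has_bochner_integral (return borel 0) (\<lambda>x::real. x) 0" by (rule i) measurable
    moreover have "has_bochner_integral (return borel 0) (\<lambda>x::real. x\<^sup>2) (0\<^sup>2)" by (rule i) measurable
    ultimately show ?thesis
      unfolding True c power_zero_numeral by (rule conjI)
  next
    case False
    then have v: "0 < v" using assms by simp
    have 1: "has_bochner_integral lborel (\<lambda>x. normal_density 0 (sqrt v) x *\<^sub>R x) 0"
      using normal_moment_odd[of "sqrt v" 0 0] v by simp
    have 2: "has_bochner_integral lborel (\<lambda>x. normal_density 0 (sqrt v) x *\<^sub>R x\<^sup>2) v"
      using normal_moment_even[of "sqrt v" 0 1] v by (simp add: field_simps power2_eq_square)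
    show ?thesis
      using v 1 2 unfolding centered_gaussian_def
      by (auto intro!: has_bochner_integral_density)
  qed
  then show "has_bochner_integral (centered_gaussian v) (\<lambda>x. x) 0"
    "has_bochner_integral (centered_gaussian v) (\<lambda>x. x\<^sup>2) v" by auto
qed

lemma nn_integral_has_bochner_integral:
  fixes f :: "'a \<Rightarrow> real"
  assumes "has_bochner_integral M f c" "\<And>x. x \<in> space M \<Longrightarrow> 0 \<le> f x"
  shows "(\<integral>\<^sup>+x. ennreal (f x) \<partial>M) = ennreal c"
  using assms by (subst nn_integral_eq_integral) (auto simp: has_bochner_integral_iff)

locale wiener_process =
  fixes M :: "'w measure" and F :: "real \<Rightarrow> 'w measure"
    and Q :: "'h::{real_inner, banach, second_countable_topology} \<Rightarrow>\<^sub>L 'h"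
    and W :: "real \<Rightarrow> 'w \<Rightarrow> 'h"
  assumes usual: "usual_conditions M F"
    and covariance: "covariance_operator Q"
    and wiener: "Q_wiener_process M F Q W"
begin

sublocale prob_space M using usual by (simp add: usual_conditions_def)

lemma space_F [simp]: "space (F t) = space M"
  using usual by (simp add: usual_conditions_def filtration_def)

lemma sets_F_mono: "s \<le> t \<Longrightarrow> sets (F s) \<subseteq> sets (F t)"
  using usual by (simp add: usual_conditions_def filtration_def)

lemma sets_F: "0 \<le> t \<Longrightarrow> sets (F t) \<subseteq> sets M"
  using usual unfolding usual_conditions_def by blast

lemma measurable_F_mono: "f \<in> measurable (F s) N \<Longrightarrow> s \<le> t \<Longrightarrow> f \<in> measurable (F t) N"
  using sets_F_mono by (intro measurable_from_subalg[of "F t" "F s"]) (auto simp: subalgebra_def)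

lemma measurable_F: "f \<in> measurable (F s) N \<Longrightarrow> 0 \<le> s \<Longrightarrow> f \<in> measurable M N"
  using sets_F by (intro measurable_from_subalg[of M "F s"]) (auto simp: subalgebra_def)

lemma measurable_W_F: "0 \<le> s \<Longrightarrow> s \<le> t \<Longrightarrow> W s \<in> borel_measurable (F t)"
  using wiener measurable_F_mono unfolding Q_wiener_process_def by blast

lemma measurable_W: "0 \<le> s \<Longrightarrow> W s \<in> borel_measurable M"
  using measurable_W_F[of s s] measurable_F by blast

definition qform :: "'h \<Rightarrow> real" where "qform x = x \<bullet> blinfun_apply Q x"

lemma Q_sym: "a \<bullet> blinfun_apply Q b = b \<bullet> blinfun_apply Q a"
  using covariance by (metis covariance_operator_def inner_commute)

lemma qform_nonneg [simp]: "0 \<le> qform x"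
  using covariance by (simp add: covariance_operator_def qform_def)

lemma qform_scaleR: "qform (c *\<^sub>R x) = c\<^sup>2 * qform x"
  by (simp add: qform_def blinfun.scaleR_right power2_eq_square)

lemma qform_polarization: "qform (x + y) - qform (x - y) = 4 * (x \<bullet> blinfun_apply Q y)"
  using Q_sym[of x y]
  by (simp add: qform_def inner_add inner_diff blinfun.add_right blinfun.diff_right algebra_simps)

lemma qform_add3: "qform (x + y + z) \<le> 3 * (qform x + qform y + qform z)"
proof -
  have "3 * (qform x + qform y + qform z) - qform (x + y + z) = qform (x - y) + qform (y - z) + qform (x - z)"
    using Q_sym[of x y] Q_sym[of x z] Q_sym[of y z]
    by (simp add: qform_def inner_add inner_diff blinfun.add_right blinfun.diff_right algebra_simps)
  then show ?thesis using qform_nonneg[of "x - y"] qform_nonneg[of "y - z"] qform_nonneg[of "x - z"] by linarith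
qed

lemma measurable_qform [measurable]: "qform \<in> borel_measurable borel"
  unfolding qform_def
  by (intro borel_measurable_continuous_onI continuous_intros)

lemma increment_moments:
  assumes "0 \<le> s" "s \<le> t"
  shows "has_bochner_integral M (\<lambda>\<omega>. h \<bullet> (W t \<omega> - W s \<omega>)) 0"
    "has_bochner_integral M (\<lambda>\<omega>. (h \<bullet> (W t \<omega> - W s \<omega>))\<^sup>2) ((t - s) * qform h)"
proof -
  have "has_bochner_integral M (\<lambda>\<omega>. h \<bullet> (W t \<omega> - W s \<omega>)) 0 \<and>
    has_bochner_integral M (\<lambda>\<omega>. (h \<bullet> (W t \<omega> - W s \<omega>))\<^sup>2) ((t - s) * qform h)"
  proof (cases "s = t")
    case True
    then show ?thesis by (simp add: has_bochner_integral_zero)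
  next
    case False
    then have st: "s < t" using assms by simp
    have [measurable]: "W s \<in> borel_measurable M" "W t \<in> borel_measurable M"
      using measurable_W assms by auto
    let ?D = "\<lambda>\<omega>. h \<bullet> (W t \<omega> - W s \<omega>)"
    have d: "distr M borel ?D = centered_gaussian ((t - s) * qform h)"
      using wiener st assms unfolding Q_wiener_process_def qform_def by blast
    have "0 \<le> (t - s) * qform h" using st by simp
    from centered_gaussian_moments[OF this, folded d] show ?thesis
      by (simp add: has_bochner_integral_iff integrable_distr_eq integral_distr)
  qed
  then show "has_bochner_integral M (\<lambda>\<omega>. h \<bullet> (W t \<omega> - W s \<omega>)) 0"
    "has_bochner_integral M (\<lambda>\<omega>. (h \<bullet> (W t \<omega> - W s \<omega>))\<^sup>2) ((t - s) * qform h)" by auto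
qed

lemma increment_covariance:
  assumes "0 \<le> s" "s \<le> t"
  shows "has_bochner_integral M (\<lambda>\<omega>. (a \<bullet> (W t \<omega> - W s \<omega>)) * (b \<bullet> (W t \<omega> - W s \<omega>)))
    ((t - s) * (a \<bullet> blinfun_apply Q b))"
proof -
  have "has_bochner_integral M
    (\<lambda>\<omega>. (((a + b) \<bullet> (W t \<omega> - W s \<omega>))\<^sup>2 - ((a - b) \<bullet> (W t \<omega> - W s \<omega>))\<^sup>2) / 4)
    (((t - s) * qform (a + b) - (t - s) * qform (a - b)) / 4)"
    by (intro has_bochner_integral_divide has_bochner_integral_diff increment_moments assms)
  moreover have "((t - s) * qform (a + b) - (t - s) * qform (a - b)) / 4 = (t - s) * (a \<bullet> blinfun_apply Q b)"
    by (simp add: qform_polarization flip: right_diff_distrib)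
  moreover have "(((a + b) \<bullet> x)\<^sup>2 - ((a - b) \<bullet> x)\<^sup>2) / 4 = (a \<bullet> x) * (b \<bullet> x)" for x
    by (simp add: inner_add_left inner_diff_left power2_eq_square algebra_simps)
  ultimately show ?thesis by simp
qed

text \<open>An increment of the Wiener process is independent of the past, so expectations
  factorise. The degenerate case \<open>s = t\<close> is included: then the second factor is
  constant.\<close>

lemma indep_increment_product:
  fixes f :: "'w \<Rightarrow> real" and \<phi> :: "'h \<Rightarrow> real"
  assumes "0 \<le> s" "s \<le> t" and f: "f \<in> borel_measurable (F s)" "has_bochner_integral M f c"
    and \<phi>: "\<phi> \<in> borel_measurable borel" "has_bochner_integral M (\<lambda>\<omega>. \<phi> (W t \<omega> - W s \<omega>)) d"
  shows "has_bochner_integral M (\<lambda>\<omega>. f \<omega> * \<phi> (W t \<omega> - W s \<omega>)) (c * d)"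
proof (cases "s = t")
  case True
  then have "d = \<phi> 0"
    using \<phi>(2) by (simp add: has_bochner_integral_iff prob_space)
  then show ?thesis using True f(2) by (auto intro: has_bochner_integral_mult_left)
next
  case False
  then have st: "s < t" using assms by simp
  have [measurable]: "W s \<in> borel_measurable M" "W t \<in> borel_measurable M" "f \<in> borel_measurable M"
    "\<phi> \<in> borel_measurable borel"
    using measurable_W measurable_F f \<phi> assms by auto
  let ?D = "\<lambda>\<omega>. W t \<omega> - W s \<omega>"
  have ind: "indep_set (sets (F s)) {?D -` A \<inter> space M | A. A \<in> sets borel}"
    using wiener st assms(1) unfolding Q_wiener_process_def by blast
  have D: "sigma_sets (space M) {?D -` A \<inter> space M | A. A \<in> sets borel} = {?D -` A \<inter> space M | A. A \<in> sets borel}"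
    by (simp only: sets_vimage_algebra[symmetric]) (rule sets_vimage_algebra2, simp)
  have "indep_set (sigma_sets (space M) {f -` A \<inter> space M |A. A \<in> sets borel})
      (sigma_sets (space M) {(\<lambda>\<omega>. \<phi> (?D \<omega>)) -` A \<inter> space M |A. A \<in> sets borel})"
    using ind unfolding indep_set_def
  proof (rule indep_sets_mono_sets)
    have "sigma_sets (space M) {f -` A \<inter> space M |A. A \<in> sets borel} \<subseteq> sets (F s)"
    proof -
      have "{f -` A \<inter> space M |A. A \<in> sets borel} \<subseteq> sets (F s)"
        using measurable_sets[OF f(1)] by auto
      then show ?thesis using sets.sigma_sets_subset[of _ "F s"] by simp
    qed
    moreover have "{(\<lambda>\<omega>. \<phi> (?D \<omega>)) -` A \<inter> space M |A. A \<in> sets borel} \<subseteq> {?D -` A \<inter> space M | A. A \<in> sets borel}"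
    proof safe
      fix A :: "real set" assume "A \<in> sets borel"
      then have "\<phi> -` A \<in> sets borel" using measurable_sets[OF \<phi>(1)] by simp
      then show "\<exists>B. (\<lambda>\<omega>. \<phi> (?D \<omega>)) -` A \<inter> space M = ?D -` B \<inter> space M \<and> B \<in> sets borel"
        by (intro exI[of _ "\<phi> -` A"]) auto
    qed
    then have "sigma_sets (space M) {(\<lambda>\<omega>. \<phi> (?D \<omega>)) -` A \<inter> space M |A. A \<in> sets borel}
        \<subseteq> {?D -` A \<inter> space M | A. A \<in> sets borel}"
      using sigma_sets_mono'[of _ "{?D -` A \<inter> space M | A. A \<in> sets borel}" "space M"] unfolding D by blast
    ultimately show "(case i of True \<Rightarrow> sigma_sets (space M) {f -` A \<inter> space M |A. A \<in> sets borel}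
         | False \<Rightarrow> sigma_sets (space M) {(\<lambda>\<omega>. \<phi> (?D \<omega>)) -` A \<inter> space M |A. A \<in> sets borel})
        \<subseteq> (case i of True \<Rightarrow> sets (F s) | False \<Rightarrow> {?D -` A \<inter> space M | A. A \<in> sets borel})" for i
      by (cases i) auto
  qed
  then have iv: "indep_var borel f borel (\<lambda>\<omega>. \<phi> (?D \<omega>))"
    unfolding indep_var_eq by auto
  show ?thesis
    using f(2) \<phi>(2) indep_var_lebesgue_integral[OF iv] indep_var_integrable[OF iv]
    by (auto simp: has_bochner_integral_iff)
qed

text \<open>The integral of the elementary integrand \<open>1\<^sub>A * 1\<^bsub>(s,t]\<^esub>
  * a\<close>. Every quantity in the construction of the Ito integral becomes, after testing
  with a fixed vector, a finite sum of these.\<close>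

definition atom :: "real \<Rightarrow> real \<Rightarrow> 'w set \<Rightarrow> 'h \<Rightarrow> 'w \<Rightarrow> real" where
  "atom s t A a \<omega> = indicator A \<omega> * (a \<bullet> (W t \<omega> - W s \<omega>))"

lemma atom_split: "atom s t A a \<omega> = atom s r A a \<omega> + atom r t A a \<omega>"
  by (simp add: atom_def inner_diff_right algebra_simps)

lemma atom_measurable:
  assumes "0 \<le> s" "s \<le> t" "t \<le> u" "A \<in> sets (F s)"
  shows "atom s t A a \<in> borel_measurable (F u)"
proof -
  have [measurable]: "A \<in> sets (F u)" "W s \<in> borel_measurable (F u)" "W t \<in> borel_measurable (F u)"
    using measurable_W_F[of s u] measurable_W_F[of t u] sets_F_mono[of s u] assms by auto
  show ?thesis unfolding atom_def by measurable
qed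

lemma atom_integrable:
  assumes "0 \<le> s" "s \<le> t" "A \<in> sets (F s)"
  shows "integrable M (atom s t A a)"
proof -
  have "A \<in> sets M" using assms sets_F by auto
  then have "integrable M (\<lambda>\<omega>. (a \<bullet> (W t \<omega> - W s \<omega>)) * indicator A \<omega>)"
    using increment_moments(1)[OF assms(1,2), of a]
    by (intro integrable_real_mult_indicator) (auto simp: has_bochner_integral_iff)
  then show ?thesis unfolding atom_def by (simp add: mult.commute)
qed

text \<open>The first atom and the event \<open>A'\<close> are known at time
  \<open>s'\<close>, and the later increment has mean zero.\<close>

lemma atom_orthogonal:
  assumes "0 \<le> s" "s \<le> t" "t \<le> s'" "s' \<le> t'" "A \<in> sets (F s)" "A' \<in> sets (F s')"
  shows "has_bochner_integral M (\<lambda>\<omega>. atom s t A a \<omega> * atom s' t' A' a' \<omega>) 0"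
proof -
  define f where "f \<omega> = atom s t A a \<omega> * indicator A' \<omega>" for \<omega>
  have [measurable]: "A' \<in> sets (F s')" "atom s t A a \<in> borel_measurable (F s')"
    using atom_measurable assms by auto
  have "A' \<in> sets M" using assms sets_F[of s'] by auto
  then have "integrable M f"
    unfolding f_def using atom_integrable assms by (intro integrable_real_mult_indicator) auto
  then have i: "has_bochner_integral M f (integral\<^sup>L M f)" by (rule has_bochner_integral_integrable)
  have "f \<in> borel_measurable (F s')" unfolding f_def by measurable
  from indep_increment_product[OF _ _ this i, of t' "\<lambda>x. a' \<bullet> x" 0] show ?thesis
    using assms increment_moments(1)[of s' t' a'] by (simp add: f_def atom_def mult_ac)
qed

lemma atom_same_interval:
  assumes "0 \<le> s" "s \<le> t" "A \<in> sets (F s)" "A' \<in> sets (F s)"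
  shows "has_bochner_integral M (\<lambda>\<omega>. atom s t A a \<omega> * atom s t A' a' \<omega>)
    ((t - s) * prob (A \<inter> A') * (a \<bullet> blinfun_apply Q a'))"
proof -
  have A: "A \<inter> A' \<in> sets (F s)" "A \<inter> A' \<in> sets M" using assms sets_F by auto
  have i: "has_bochner_integral M (indicator (A \<inter> A')) (prob (A \<inter> A'))"
    using A(2) by (intro has_bochner_integral_real_indicator) (auto simp: less_top[symmetric])
  have m: "indicator (A \<inter> A') \<in> borel_measurable (F s)" using A(1) by measurable
  have "has_bochner_integral M
     (\<lambda>\<omega>. indicator (A \<inter> A') \<omega> * ((a \<bullet> (W t \<omega> - W s \<omega>)) * (a' \<bullet> (W t \<omega> - W s \<omega>))))
     (prob (A \<inter> A') * ((t - s) * (a \<bullet> blinfun_apply Q a')))"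
    by (rule indep_increment_product[OF assms(1,2) m i, where \<phi>="\<lambda>x. (a \<bullet> x) * (a' \<bullet> x)"])
       (measurable, rule increment_covariance[OF assms(1,2)])
  then show ?thesis by (simp add: atom_def indicator_inter_arith mult_ac)
qed

text \<open>If the intervals overlap, both are cut at \<open>s'\<close> and at \<open>min t
  t'\<close>. Of the resulting products only the one over the common interval survives: the
  others involve disjoint intervals, except for the product of the two last pieces, one of
  which is empty.\<close>

lemma atom_covariance_ordered:
  assumes "0 \<le> s" "s \<le> t" "A \<in> sets (F s)" "s' \<le> t'" "A' \<in> sets (F s')" "s \<le> s'"
  shows "has_bochner_integral M (\<lambda>\<omega>. atom s t A a \<omega> * atom s' t' A' a' \<omega>)
    (max 0 (min t t' - max s s') * prob (A \<inter> A') * (a \<bullet> blinfun_apply Q a'))"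
proof (cases "t \<le> s'")
  case True
  then have "max 0 (min t t' - max s s') = 0" by auto
  then show ?thesis using True atom_orthogonal[of s t s' t' A A' a a'] assms by simp
next
  case False
  define r where "r = min t t'"
  have r: "s' \<le> r" "r \<le> t" "r \<le> t'" "0 \<le> s'" "0 \<le> r" using False assms by (auto simp: r_def)
  have A: "A \<in> sets (F s')" "A \<in> sets (F r)" "A' \<in> sets (F r)"
    using assms r sets_F_mono[of s s'] sets_F_mono[of s r] sets_F_mono[of s' r] by auto
  have last: "atom r t A a \<omega> * atom r t' A' a' \<omega> = 0" for \<omega>
    by (auto simp: r_def min_def atom_def)
  have "has_bochner_integral M (\<lambda>\<omega>. (atom s s' A a \<omega> * atom s' r A' a' \<omega> + atom s s' A a \<omega> * atom r t' A' a' \<omega>)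
      + (atom s' r A a \<omega> * atom s' r A' a' \<omega> + atom s' r A a \<omega> * atom r t' A' a' \<omega>)
      + (atom s' r A' a' \<omega> * atom r t A a \<omega> + 0))
      ((0 + 0) + ((r - s') * prob (A \<inter> A') * (a \<bullet> blinfun_apply Q a') + 0) + (0 + 0))"
    using assms r A
    by (intro has_bochner_integral_add has_bochner_integral_zero atom_orthogonal atom_same_interval) auto
  moreover have "(atom s s' A a \<omega> * atom s' r A' a' \<omega> + atom s s' A a \<omega> * atom r t' A' a' \<omega>)
      + (atom s' r A a \<omega> * atom s' r A' a' \<omega> + atom s' r A a \<omega> * atom r t' A' a' \<omega>)
      + (atom s' r A' a' \<omega> * atom r t A a \<omega> + 0) = atom s t A a \<omega> * atom s' t' A' a' \<omega>" for \<omega>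
    using last[of \<omega>] unfolding atom_split[of s t A a \<omega> s'] atom_split[of s' t A a \<omega> r] atom_split[of s' t' A' a' \<omega> r]
    by (simp add: algebra_simps)
  ultimately have "has_bochner_integral M (\<lambda>\<omega>. atom s t A a \<omega> * atom s' t' A' a' \<omega>)
      ((0 + 0) + ((r - s') * prob (A \<inter> A') * (a \<bullet> blinfun_apply Q a') + 0) + (0 + 0))" by simp
  moreover have "max 0 (min t t' - max s s') = r - s'" using r assms by (auto simp: r_def)
  ultimately show ?thesis by simp
qed

lemma atom_covariance:
  assumes "0 \<le> s" "s \<le> t" "A \<in> sets (F s)" "0 \<le> s'" "s' \<le> t'" "A' \<in> sets (F s')"
  shows "has_bochner_integral M (\<lambda>\<omega>. atom s t A a \<omega> * atom s' t' A' a' \<omega>)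
    (max 0 (min t t' - max s s') * prob (A \<inter> A') * (a \<bullet> blinfun_apply Q a'))"
proof (cases "s \<le> s'")
  case True
  then show ?thesis using assms atom_covariance_ordered by auto
next
  case False
  then have "s' \<le> s" by simp
  from atom_covariance_ordered[OF assms(4,5,6,2,3) this, of a' a] show ?thesis
    by (simp add: mult.commute min.commute max.commute Int_commute Q_sym[of a a'])
qed

text \<open>A pair \<open>S\<close>, \<open>h\<close> of a random variable and its integrand,
  generated by adding one atom at a time. In this form differences of integrals over unrelated
  partitions are again of the same form, so no common refinement is needed, and bilinear
  statements follow by induction.\<close>

inductive elem_int :: "('w \<Rightarrow> real) \<Rightarrow> ('w \<Rightarrow> real \<Rightarrow> 'h) \<Rightarrow> bool" where
  zero: "elem_int (\<lambda>\<omega>. 0) (\<lambda>\<omega> u. 0)"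
| add: "elem_int S h \<Longrightarrow> 0 \<le> s \<Longrightarrow> s \<le> t \<Longrightarrow> A \<in> sets (F s) \<Longrightarrow>
    elem_int (\<lambda>\<omega>. S \<omega> + atom s t A a \<omega>)
      (\<lambda>\<omega> u. h \<omega> u + (indicator A \<omega> * indicator {s<..t} u) *\<^sub>R a)"

lemma elem_int_minus: "elem_int S h \<Longrightarrow> elem_int (\<lambda>\<omega>. - S \<omega>) (\<lambda>\<omega> u. - h \<omega> u)"
proof (induction rule: elem_int.induct)
  case zero
  show ?case using elem_int.zero by simp
next
  case (add S h s t A a)
  from elem_int.add[OF add.IH add.hyps(2,3,4), of "- a"] show ?case
    by (simp add: atom_def)
qed

lemma elem_int_plus: 
  assumes "elem_int S h"
  shows "elem_int S' h' \<Longrightarrow> elem_int (\<lambda>\<omega>. S \<omega> + S' \<omega>) (\<lambda>\<omega> u. h \<omega> u + h' \<omega> u)"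
proof (induction rule: elem_int.induct)
  case zero
  show ?case using assms by simp
next
  case (add S' h' s t A a)
  from elem_int.add[OF add.IH add.hyps(2,3,4), of a] show ?case
    by (simp add: add.assoc)
qed

lemma elem_int_diff:
  "elem_int S h \<Longrightarrow> elem_int S' h' \<Longrightarrow> elem_int (\<lambda>\<omega>. S \<omega> - S' \<omega>) (\<lambda>\<omega> u. h \<omega> u - h' \<omega> u)"
  using elem_int_plus[OF _ elem_int_minus] by fastforce

lemma elem_int_sum:
  assumes "finite I" "\<And>i. i \<in> I \<Longrightarrow> elem_int (S i) (h i)"
  shows "elem_int (\<lambda>\<omega>. \<Sum>i\<in>I. S i \<omega>) (\<lambda>\<omega> u. \<Sum>i\<in>I. h i \<omega> u)"
  using assms
proof (induction I)
  case empty
  show ?case using elem_int.zero by simp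
next
  case (insert i I)
  then show ?case using elem_int_plus[of "S i" "h i"] by simp
qed

lemma elem_int_measurable:
  "elem_int S h \<Longrightarrow> S \<in> borel_measurable M \<and> (\<lambda>(\<omega>, u). h \<omega> u) \<in> borel_measurable (M \<Otimes>\<^sub>M lborel)"
proof (induction rule: elem_int.induct)
  case zero
  show ?case by simp
next
  case (add S h s t A a)
  then have [measurable]: "S \<in> borel_measurable M" "(\<lambda>(\<omega>, u). h \<omega> u) \<in> borel_measurable (M \<Otimes>\<^sub>M lborel)"
    "atom s t A a \<in> borel_measurable M" "A \<in> sets M"
    using atom_measurable[of s t t A a] measurable_F[of _ t] sets_F[of s] by auto
  show ?case by measurable
qed

text \<open>Both sides are bilinear in the two pairs, so by induction on each of them only two
  atoms remain; these are settled by \<open>atom_covariance\<close>, whose factor is the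
  length of the common interval. Carrying the values \<open>g\<close> and \<open>c\<close>
  along avoids separate integrability arguments for the sums.\<close>

lemma elem_int_bilinear_isometry:
  assumes "elem_int S h" "elem_int S' h'"
  shows "\<exists>g c. (\<forall>\<omega>\<in>space M. has_bochner_integral lborel (\<lambda>u. h \<omega> u \<bullet> blinfun_apply Q (h' \<omega> u)) (g \<omega>)) \<and>
     has_bochner_integral M g c \<and> has_bochner_integral M (\<lambda>\<omega>. S \<omega> * S' \<omega>) c"
    (is "?P S h S' h'")
proof -
  have add_left: "?P (\<lambda>\<omega>. S \<omega> + T \<omega>) (\<lambda>\<omega> u. h \<omega> u + k \<omega> u) S' h'"
    if "?P S h S' h'" "?P T k S' h'" for S h T k S' h'
  proof -
    from that obtain g c g' c' where "\<forall>\<omega>\<in>space M. has_bochner_integral lborel (\<lambda>u. h \<omega> u \<bullet> blinfun_apply Q (h' \<omega> u)) (g \<omega>)"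
      "has_bochner_integral M g c" "has_bochner_integral M (\<lambda>\<omega>. S \<omega> * S' \<omega>) c"
      "\<forall>\<omega>\<in>space M. has_bochner_integral lborel (\<lambda>u. k \<omega> u \<bullet> blinfun_apply Q (h' \<omega> u)) (g' \<omega>)"
      "has_bochner_integral M g' c'" "has_bochner_integral M (\<lambda>\<omega>. T \<omega> * S' \<omega>) c'" by auto
    then show ?thesis
      by (intro exI[of _ "\<lambda>\<omega>. g \<omega> + g' \<omega>"] exI[of _ "c + c'"] conjI)
         (auto simp: inner_add_left distrib_right intro!: has_bochner_integral_add)
  qed
  have sym: "?P S h S' h'" if "?P S' h' S h" for S h S' h'
    using that by (simp add: mult.commute Q_sym)
  have zero_left: "?P (\<lambda>\<omega>. 0) (\<lambda>\<omega> u. 0) S' h'" for S' h'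
    by (intro exI[of _ "\<lambda>\<omega>. 0"] exI[of _ 0]) auto
  have atoms: "?P (atom s t A a) (\<lambda>\<omega> u. (indicator A \<omega> * indicator {s<..t} u) *\<^sub>R a)
       (atom s' t' A' a') (\<lambda>\<omega> u. (indicator A' \<omega> * indicator {s'<..t'} u) *\<^sub>R a')"
    if "0 \<le> s" "s \<le> t" "A \<in> sets (F s)" "0 \<le> s'" "s' \<le> t'" "A' \<in> sets (F s')" for s t A a s' t' A' a'
  proof -
    let ?o = "max 0 (min t t' - max s s')"
    have A: "A \<inter> A' \<in> sets M" using that sets_F[of s] sets_F[of s'] by auto
    have m: "measure lborel {max s s'<..min t t'} = ?o"
    proof (cases "max s s' \<le> min t t'")
      case False
      then have "{max s s'<..min t t'} = {}" "?o = 0" by auto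
      then show ?thesis by (simp only: measure_empty)
    qed (simp add: measure_lborel_Ioc)
    have "bounded {max s s'<..min t t'}" by (rule bounded_subset[of "{max s s'..min t t'}"]) auto
    then have fin: "emeasure lborel {max s s'<..min t t'} < \<infinity>" by (rule emeasure_bounded_finite)
    have "has_bochner_integral lborel (indicator {max s s'<..min t t'}) ?o"
      unfolding m[symmetric]
      by (rule has_bochner_integral_real_indicator[OF _ fin]) simp
    then have "has_bochner_integral lborel (\<lambda>u. (indicator (A \<inter> A') \<omega> * (a \<bullet> blinfun_apply Q a')) * indicator {max s s'<..min t t'} u)
        ((indicator (A \<inter> A') \<omega> * (a \<bullet> blinfun_apply Q a')) * ?o)" for \<omega>
      by (rule has_bochner_integral_mult_right)
    moreover have "((indicator A \<omega> * indicator {s<..t} u) *\<^sub>R a) \<bullet> blinfun_apply Q ((indicator A' \<omega> * indicator {s'<..t'} u) *\<^sub>R a')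
        = (indicator (A \<inter> A') \<omega> * (a \<bullet> blinfun_apply Q a')) * indicator {max s s'<..min t t'} u" for \<omega> u
      by (auto simp: blinfun.scaleR_right indicator_def)
    ultimately have 1: "\<forall>\<omega>\<in>space M. has_bochner_integral lborel
         (\<lambda>u. ((indicator A \<omega> * indicator {s<..t} u) *\<^sub>R a) \<bullet> blinfun_apply Q ((indicator A' \<omega> * indicator {s'<..t'} u) *\<^sub>R a'))
        ((indicator (A \<inter> A') \<omega> * (a \<bullet> blinfun_apply Q a')) * ?o)"
      by (simp only:) blast
    have "has_bochner_integral M (\<lambda>\<omega>. (indicator (A \<inter> A') \<omega> * (a \<bullet> blinfun_apply Q a')) * ?o)
        (prob (A \<inter> A') * (a \<bullet> blinfun_apply Q a') * ?o)"
      using A by (intro has_bochner_integral_mult_left has_bochner_integral_real_indicator)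
         (auto simp: less_top[symmetric])
    then show ?thesis
      using 1 atom_covariance[OF that, of a a']
      by (intro exI[of _ "\<lambda>\<omega>. (indicator (A \<inter> A') \<omega> * (a \<bullet> blinfun_apply Q a')) * ?o"]
         exI[of _ "prob (A \<inter> A') * (a \<bullet> blinfun_apply Q a') * ?o"] conjI) (auto simp: mult_ac)
  qed
  have left: "?P S h (atom s' t' A' a') (\<lambda>\<omega> u. (indicator A' \<omega> * indicator {s'<..t'} u) *\<^sub>R a')"
    if "elem_int S h" "0 \<le> s'" "s' \<le> t'" "A' \<in> sets (F s')" for S h s' t' A' a'
    using that(1)
  proof (induction rule: elem_int.induct)
    case zero
    show ?case by (rule zero_left)
  next
    case (add S h s t A a)
    show ?case by (rule add_left[OF add.IH atoms]) (use add.hyps that in auto)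
  qed
  show ?thesis
    using assms(2)
  proof (induction rule: elem_int.induct)
    case zero
    show ?case by (rule sym[OF zero_left])
  next
    case (add S' h' s t A a)
    show ?case by (rule sym[OF add_left[OF sym[OF add.IH] sym[OF left]]]) (use add.hyps assms in auto)
  qed
qed

lemma elem_int_isometry:
  assumes "elem_int S h"
  shows "(\<integral>\<^sup>+\<omega>. ennreal ((S \<omega>)\<^sup>2) \<partial>M) = (\<integral>\<^sup>+\<omega>. \<integral>\<^sup>+u. ennreal (qform (h \<omega> u)) \<partial>lborel \<partial>M)"
proof -
  from elem_int_bilinear_isometry[OF assms assms] obtain g c where
    g: "\<And>\<omega>. \<omega> \<in> space M \<Longrightarrow> has_bochner_integral lborel (\<lambda>u. qform (h \<omega> u)) (g \<omega>)"
    and c: "has_bochner_integral M g c" "has_bochner_integral M (\<lambda>\<omega>. (S \<omega>)\<^sup>2) c"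
    unfolding qform_def power2_eq_square by blast
  have g0: "0 \<le> g \<omega>" if "\<omega> \<in> space M" for \<omega>
    unfolding has_bochner_integral_integral_eq[OF g[OF that], symmetric] by simp
  have "(\<integral>\<^sup>+\<omega>. \<integral>\<^sup>+u. ennreal (qform (h \<omega> u)) \<partial>lborel \<partial>M) = (\<integral>\<^sup>+\<omega>. ennreal (g \<omega>) \<partial>M)"
    using g by (intro nn_integral_cong nn_integral_has_bochner_integral) auto
  also have "\<dots> = ennreal c" using c(1) g0 by (rule nn_integral_has_bochner_integral)
  also have "\<dots> = (\<integral>\<^sup>+\<omega>. ennreal ((S \<omega>)\<^sup>2) \<partial>M)"
    using c(2) by (intro nn_integral_has_bochner_integral[symmetric]) auto
  finally show ?thesis ..
qed

text \<open>The time-one increment \<open>G\<close> has covariance \<open>Q\<close>. Hence the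
  diagonal entry of \<open>A Q A\<^sup>*\<close> at a basis vector \<open>e\<close> is the
  second moment of \<open>e \<bullet> A G\<close>, and Parseval's identity sums these to the
  second moment of \<open>A G\<close>. Finiteness, which comes from the trace-class property
  of \<open>Q\<close>, is essential: an infinite sum that diverges has value
  \<open>0\<close>.\<close>

lemma L20_norm_sq_eq:
  fixes A :: "'h \<Rightarrow>\<^sub>L 'h"
  shows "ennreal (L20_norm_sq Q A) = (\<integral>\<^sup>+\<omega>. ennreal ((norm (blinfun_apply A (W 1 \<omega> - W 0 \<omega>)))\<^sup>2) \<partial>M)"
proof -
  define B where "B = (SOME B::'h set. orthonormal_basis B)"
  have B: "orthonormal_basis B" unfolding B_def using orthonormal_basis_exists by (rule someI_ex)
  have cB: "countable B" using orthonormal_countable orthonormal_basis_orthonormal B by blast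
  define G where "G \<omega> = W 1 \<omega> - W 0 \<omega>" for \<omega>
  have [measurable]: "G \<in> borel_measurable M" unfolding G_def using measurable_W[of 0] measurable_W[of 1] by auto
  have [measurable]: "blinfun_apply A \<in> borel_measurable borel"
    by (intro borel_measurable_continuous_onI continuous_intros)
  have mom: "(\<integral>\<^sup>+\<omega>. ennreal ((x \<bullet> G \<omega>)\<^sup>2) \<partial>M) = ennreal (qform x)" for x
    using increment_moments(2)[of 0 1 x] unfolding G_def
    by (intro nn_integral_has_bochner_integral) auto
  have expand: "(\<integral>\<^sup>+\<omega>. ennreal ((norm (H \<omega>))\<^sup>2) \<partial>M) = (\<integral>\<^sup>+e. \<integral>\<^sup>+\<omega>. ennreal ((e \<bullet> H \<omega>)\<^sup>2) \<partial>M \<partial>count_space B)"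
    if "H \<in> borel_measurable M" for H :: "'w \<Rightarrow> 'h"
    unfolding parseval_nn[OF B] using that by (intro nn_integral_count_space_nn_integral cB) measurable
  have tr: "qform summable_on B" using covariance B unfolding covariance_operator_def qform_def[abs_def] by blast
  have "(\<integral>\<^sup>+\<omega>. ennreal ((norm (G \<omega>))\<^sup>2) \<partial>M) = (\<integral>\<^sup>+e. ennreal (qform e) \<partial>count_space B)"
    by (subst expand) (simp_all add: mom)
  also have "\<dots> < \<infinity>" by (simp add: nn_integral_count_space_infsum tr)
  finally have fin: "(\<integral>\<^sup>+\<omega>. ennreal ((norm (G \<omega>))\<^sup>2) \<partial>M) < \<infinity>" .
  have calc: "(\<integral>\<^sup>+\<omega>. ennreal ((norm (blinfun_apply A (G \<omega>)))\<^sup>2) \<partial>M) = (\<integral>\<^sup>+e. ennreal (qform (adjoint (blinfun_apply A) e)) \<partial>count_space B)"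
    by (subst expand) (simp_all add: inner_blinfun_adjoint mom)
  have "(\<integral>\<^sup>+\<omega>. ennreal ((norm (blinfun_apply A (G \<omega>)))\<^sup>2) \<partial>M) < \<infinity>"
  proof -
    have "(\<integral>\<^sup>+\<omega>. ennreal ((norm (blinfun_apply A (G \<omega>)))\<^sup>2) \<partial>M) \<le> (\<integral>\<^sup>+\<omega>. ennreal ((norm A)\<^sup>2) * ennreal ((norm (G \<omega>))\<^sup>2) \<partial>M)"
      using power_mono[OF norm_blinfun[of A] norm_ge_zero, of _ 2]
      by (intro nn_integral_mono) (auto simp: power_mult_distrib simp flip: ennreal_mult)
    also have "\<dots> < \<infinity>" using fin by (simp add: nn_integral_cmult ennreal_mult_less_top)
    finally show ?thesis .
  qed
  then have "(\<lambda>e. qform (adjoint (blinfun_apply A) e)) summable_on B"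
    unfolding calc
    by (intro summable_on_if_nn_integral_finite) auto
  with calc have "(\<integral>\<^sup>+\<omega>. ennreal ((norm (blinfun_apply A (G \<omega>)))\<^sup>2) \<partial>M) = ennreal (\<Sum>\<^sub>\<infinity>e\<in>B. qform (adjoint (blinfun_apply A) e))"
    by (simp add: nn_integral_count_space_infsum)
  moreover have "L20_norm_sq Q A = (\<Sum>\<^sub>\<infinity>e\<in>B. qform (adjoint (blinfun_apply A) e))"
    unfolding L20_norm_sq_def trace_op_def B_def[symmetric] inner_blinfun_adjoint qform_def ..
  ultimately show ?thesis unfolding G_def by simp
qed

text \<open>In terms of the time-one increment \<open>G\<close>, the left-hand side is the
  second moment of \<open>v \<bullet> A G\<close> and the right-hand side is \<open>(norm
  v)\<^sup>2\<close> times the second moment of \<open>A G\<close>. So convergence in the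
  Hilbert--Schmidt norm implies convergence of the integrands tested with
  \<open>v\<close>.\<close>

lemma qform_adjoint_le:
  "ennreal (qform (adjoint (blinfun_apply A) v)) \<le> ennreal ((norm v)\<^sup>2) * ennreal (L20_norm_sq Q A)"
proof -
  define G where "G \<omega> = W 1 \<omega> - W 0 \<omega>" for \<omega>
  have [measurable]: "G \<in> borel_measurable M" unfolding G_def using measurable_W[of 0] measurable_W[of 1] by auto
  have [measurable]: "blinfun_apply A \<in> borel_measurable borel"
    by (intro borel_measurable_continuous_onI continuous_intros)
  have "ennreal (qform (adjoint (blinfun_apply A) v)) = (\<integral>\<^sup>+\<omega>. ennreal ((v \<bullet> blinfun_apply A (G \<omega>))\<^sup>2) \<partial>M)"
    unfolding inner_blinfun_adjoint using increment_moments(2)[of 0 1 "adjoint (blinfun_apply A) v"] unfolding G_def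
    by (intro nn_integral_has_bochner_integral[symmetric]) auto
  also have "\<dots> \<le> (\<integral>\<^sup>+\<omega>. ennreal ((norm v)\<^sup>2) * ennreal ((norm (blinfun_apply A (G \<omega>)))\<^sup>2) \<partial>M)"
    using Cauchy_Schwarz_ineq[of v]
    by (intro nn_integral_mono) (auto simp: power2_norm_eq_inner simp flip: ennreal_mult)
  also have "\<dots> = ennreal ((norm v)\<^sup>2) * ennreal (L20_norm_sq Q A)"
    unfolding L20_norm_sq_eq G_def[symmetric] by (simp add: nn_integral_cmult)
  finally show ?thesis .
qed

end

section \<open>Comparison of two Ito integrals\<close>

lemma adjoint_sum_scaleR:
  fixes A :: "'i \<Rightarrow> 'h::{real_inner, banach} \<Rightarrow>\<^sub>L 'g::real_inner"
  shows "adjoint (blinfun_apply (\<Sum>i\<in>I. c i *\<^sub>R A i)) v = (\<Sum>i\<in>I. c i *\<^sub>R adjoint (blinfun_apply (A i)) v)"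
  by (rule adjoint_blinfun_eqI)
     (simp add: blinfun.sum_left blinfun.scaleR_left inner_sum_left inner_sum_right adjoint_blinfun_works)

lemma adjoint_diff:
  fixes A B :: "'h::{real_inner, banach} \<Rightarrow>\<^sub>L 'g::real_inner"
  shows "adjoint (blinfun_apply (A - B)) v = adjoint (blinfun_apply A) v - adjoint (blinfun_apply B) v"
  by (rule adjoint_blinfun_eqI)
     (simp add: blinfun.diff_left inner_diff_left inner_diff_right adjoint_blinfun_works)

lemma sum_level_sets:
  fixes f :: "'b \<Rightarrow> 'c::real_vector"
  assumes "finite (\<Psi> ` \<Omega>)" "\<omega> \<in> \<Omega>"
  shows "(\<Sum>P\<in>\<Psi> ` \<Omega>. indicator (\<Psi> -` {P} \<inter> \<Omega>) \<omega> *\<^sub>R f P) = f (\<Psi> \<omega>)"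
proof -
  have "(\<Sum>P\<in>\<Psi> ` \<Omega>. indicator (\<Psi> -` {P} \<inter> \<Omega>) \<omega> *\<^sub>R f P) = (\<Sum>P\<in>\<Psi> ` \<Omega>. if P = \<Psi> \<omega> then f P else 0)"
    using assms(2) by (intro sum.cong) (auto simp: indicator_def)
  then show ?thesis using assms by simp
qed

lemma sum3_power2_le: "(a + b + c)\<^sup>2 \<le> 3 * (a\<^sup>2 + b\<^sup>2 + (c::real)\<^sup>2)"
proof -
  have "3 * (a\<^sup>2 + b\<^sup>2 + c\<^sup>2) - (a + b + c)\<^sup>2 = (a - b)\<^sup>2 + (b - c)\<^sup>2 + (a - c)\<^sup>2"
    by (simp add: power2_eq_square algebra_simps)
  then show ?thesis using zero_le_power2[of "a - b"] zero_le_power2[of "b - c"] zero_le_power2[of "a - c"] by linarith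
qed

lemma nn_integral_sum3_le:
  fixes f a b c :: "'a \<Rightarrow> ennreal"
  assumes [measurable]: "a \<in> borel_measurable M" "b \<in> borel_measurable M" "c \<in> borel_measurable M"
    and "\<And>x. x \<in> space M \<Longrightarrow> f x \<le> 3 * (a x + b x + c x)"
  shows "(\<integral>\<^sup>+x. f x \<partial>M) \<le> 3 * ((\<integral>\<^sup>+x. a x \<partial>M) + (\<integral>\<^sup>+x. b x \<partial>M) + (\<integral>\<^sup>+x. c x \<partial>M))"
proof -
  have "(\<integral>\<^sup>+x. f x \<partial>M) \<le> (\<integral>\<^sup>+x. 3 * (a x + b x + c x) \<partial>M)"
    using assms(4) by (rule nn_integral_mono)
  also have "\<dots> = 3 * ((\<integral>\<^sup>+x. a x \<partial>M) + (\<integral>\<^sup>+x. b x \<partial>M) + (\<integral>\<^sup>+x. c x \<partial>M))"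
    by (simp add: nn_integral_cmult nn_integral_add)
  finally show ?thesis .
qed

lemma ennreal_sum3_le:
  assumes "f \<le> 3 * (a + b + c)" "0 \<le> a" "0 \<le> b" "0 \<le> c"
  shows "ennreal f \<le> 3 * (ennreal a + ennreal b + ennreal c)"
proof -
  have "ennreal f \<le> ennreal (3 * (a + b + c))" using assms(1) by (rule ennreal_leI)
  also have "\<dots> = 3 * (ennreal a + ennreal b + ennreal c)"
    using assms by (simp add: ennreal_mult ennreal_plus distrib_left flip: ennreal_numeral)
  finally show ?thesis .
qed

context wiener_process
begin

text \<open>One step of an elementary process, stopped at time \<open>t\<close> and tested
  with \<open>v\<close>: it splits into one atom for each value of \<open>\<Psi>\<close>. If
  \<open>t\<close> precedes the step, both sides vanish, and the trivial pair is used because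
  the level sets of \<open>\<Psi>\<close> need not be measurable at time
  \<open>t\<close>.\<close>

lemma elementary_piece_elem_int:
  assumes "simple_function (F s) \<Psi>" "0 \<le> s" "s \<le> e" "0 \<le> t"
  shows "\<exists>S h. elem_int S h \<and>
    (\<forall>\<omega>\<in>space M. S \<omega> = v \<bullet> blinfun_apply (\<Psi> \<omega>) (W (min e t) \<omega> - W (min s t) \<omega>)) \<and>
    (\<forall>\<omega>\<in>space M. \<forall>u. h \<omega> u = (indicator {0..t} u * indicator {s<..e} u) *\<^sub>R adjoint (blinfun_apply (\<Psi> \<omega>)) v)"
proof (cases "s \<le> t")
  case False
  then have "indicator {0..t} u * indicator {s<..e} u = (0::real)" for u
    by (auto simp: indicator_def)
  then show ?thesis
    using False assms by (intro exI[of _ "\<lambda>\<omega>. 0"] exI[of _ "\<lambda>\<omega> u. 0"]) (auto intro: elem_int.zero)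
next
  case True
  define r where "r = min e t"
  define R where "R = \<Psi> ` space M"
  define L where "L P = \<Psi> -` {P} \<inter> space M" for P
  have fin: "finite R" and L: "\<And>P. P \<in> R \<Longrightarrow> L P \<in> sets (F s)"
    using assms(1) unfolding simple_function_def R_def L_def by auto
  define S where "S \<omega> = (\<Sum>P\<in>R. 0 + atom s r (L P) (adjoint (blinfun_apply P) v) \<omega>)" for \<omega>
  define h where "h \<omega> u = (\<Sum>P\<in>R. 0 + (indicator (L P) \<omega> * indicator {s<..r} u) *\<^sub>R adjoint (blinfun_apply P) v)" for \<omega> u
  have "elem_int S h"
    unfolding S_def h_def using fin L True assms
    by (intro elem_int_sum elem_int.add[OF elem_int.zero]) (auto simp: r_def)
  moreover have "S \<omega> = v \<bullet> blinfun_apply (\<Psi> \<omega>) (W (min e t) \<omega> - W (min s t) \<omega>)" if "\<omega> \<in> space M" for \<omega>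
  proof -
    have "S \<omega> = (\<Sum>P\<in>\<Psi> ` space M. indicator (\<Psi> -` {P} \<inter> space M) \<omega> *\<^sub>R (adjoint (blinfun_apply P) v \<bullet> (W r \<omega> - W s \<omega>)))"
      unfolding S_def atom_def R_def L_def by simp
    also have "\<dots> = adjoint (blinfun_apply (\<Psi> \<omega>)) v \<bullet> (W r \<omega> - W s \<omega>)"
      using fin that unfolding R_def by (rule sum_level_sets)
    also have "\<dots> = v \<bullet> blinfun_apply (\<Psi> \<omega>) (W r \<omega> - W s \<omega>)"
      by (rule inner_blinfun_adjoint[symmetric])
    finally show ?thesis using True by (simp add: r_def)
  qed
  moreover have "h \<omega> u = (indicator {0..t} u * indicator {s<..e} u) *\<^sub>R adjoint (blinfun_apply (\<Psi> \<omega>)) v"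
    if "\<omega> \<in> space M" for \<omega> u
  proof -
    have "h \<omega> u = (\<Sum>P\<in>\<Psi> ` space M. indicator (\<Psi> -` {P} \<inter> space M) \<omega> *\<^sub>R (indicator {s<..r} u *\<^sub>R adjoint (blinfun_apply P) v))"
      unfolding h_def R_def L_def by simp
    also have "\<dots> = indicator {s<..r} u *\<^sub>R adjoint (blinfun_apply (\<Psi> \<omega>)) v"
      using fin that unfolding R_def by (rule sum_level_sets)
    also have "indicator {s<..r} u = (indicator {0..t} u * indicator {s<..e} u :: real)"
      using assms(2) by (auto simp: indicator_def r_def)
    finally show ?thesis .
  qed
  ultimately show ?thesis by blast
qed

lemma elementary_elem_int:
  assumes "elementary F T n \<tau> \<Psi>" "0 \<le> t"
  shows "\<exists>S h. elem_int S h \<and>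
    (\<forall>\<omega>\<in>space M. S \<omega> = v \<bullet> elementary_integral W n \<tau> \<Psi> t \<omega>) \<and>
    (\<forall>\<omega>\<in>space M. \<forall>u. h \<omega> u = indicator {0..t} u *\<^sub>R adjoint (blinfun_apply (elementary_process n \<tau> \<Psi> u \<omega>)) v)"
proof -
  have "\<forall>i\<in>{..<n}. \<exists>S h. elem_int S h \<and>
    (\<forall>\<omega>\<in>space M. S \<omega> = v \<bullet> blinfun_apply (\<Psi> i \<omega>) (W (min (\<tau> (Suc i)) t) \<omega> - W (min (\<tau> i) t) \<omega>)) \<and>
    (\<forall>\<omega>\<in>space M. \<forall>u. h \<omega> u = (indicator {0..t} u * indicator {\<tau> i<..\<tau> (Suc i)} u) *\<^sub>R adjoint (blinfun_apply (\<Psi> i \<omega>)) v)"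
    using assms unfolding elementary_def
    by (intro ballI elementary_piece_elem_int) (auto simp: monotone_on_def image_subset_iff)
  then obtain S h where Sh: "\<And>i. i < n \<Longrightarrow> elem_int (S i) (h i)"
    "\<And>i \<omega>. i < n \<Longrightarrow> \<omega> \<in> space M \<Longrightarrow> S i \<omega> = v \<bullet> blinfun_apply (\<Psi> i \<omega>) (W (min (\<tau> (Suc i)) t) \<omega> - W (min (\<tau> i) t) \<omega>)"
    "\<And>i \<omega> u. i < n \<Longrightarrow> \<omega> \<in> space M \<Longrightarrow> h i \<omega> u = (indicator {0..t} u * indicator {\<tau> i<..\<tau> (Suc i)} u) *\<^sub>R adjoint (blinfun_apply (\<Psi> i \<omega>)) v"
    unfolding bchoice_iff by (metis lessThan_iff)
  have "elem_int (\<lambda>\<omega>. \<Sum>i\<in>{..<n}. S i \<omega>) (\<lambda>\<omega> u. \<Sum>i\<in>{..<n}. h i \<omega> u)"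
    using Sh(1) by (intro elem_int_sum) auto
  moreover have "(\<Sum>i\<in>{..<n}. S i \<omega>) = v \<bullet> elementary_integral W n \<tau> \<Psi> t \<omega>" if "\<omega> \<in> space M" for \<omega>
    unfolding elementary_integral_def inner_sum_right using Sh(2) that by (intro sum.cong) auto
  moreover have "(\<Sum>i\<in>{..<n}. h i \<omega> u)
      = indicator {0..t} u *\<^sub>R adjoint (blinfun_apply (elementary_process n \<tau> \<Psi> u \<omega>)) v"
    if "\<omega> \<in> space M" for \<omega> u
    unfolding elementary_process_def adjoint_sum_scaleR scaleR_sum_right
    using Sh(3) that by (intro sum.cong) auto
  ultimately show ?thesis by blast
qed

text \<open>The integrand seen by the scalar process \<open>v \<bullet> I t\<close>: the
  operators act on \<open>v\<close> through their adjoints, and times after \<open>t\<close>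
  are cut off.\<close>

definition adj_process :: "real \<Rightarrow> 'h \<Rightarrow> (real \<Rightarrow> 'w \<Rightarrow> 'h \<Rightarrow>\<^sub>L 'h) \<Rightarrow> 'w \<Rightarrow> real \<Rightarrow> 'h" where
  "adj_process t v A \<omega> u = indicator {0..t} u *\<^sub>R adjoint (blinfun_apply (A u \<omega>)) v"

text \<open>The defining sequence of elementary processes, tested with a unit vector. The
  normalisation allows both limits to follow from monotonicity of the integral alone, without
  any measurability of the approximation errors.\<close>

lemma ito_integral_approx:
  assumes "has_ito_integral M F Q W T A I" "t \<in> {0..T}" "norm v = 1"
  shows "\<exists>S h. (\<forall>k. elem_int (S k) (h k)) \<and>
    (\<lambda>k::nat. \<integral>\<^sup>+\<omega>. ennreal ((S k \<omega> - v \<bullet> I t \<omega>)\<^sup>2) \<partial>M) \<longlonglongrightarrow> 0 \<and>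
    (\<lambda>k. \<integral>\<^sup>+\<omega>. \<integral>\<^sup>+u. ennreal (qform (h k \<omega> u - adj_process t v A \<omega> u)) \<partial>lborel \<partial>M) \<longlonglongrightarrow> 0"
proof -
  from assms(1)[unfolded has_ito_integral_def] assms(2) obtain n \<tau> \<Psi> where el: "\<And>k. elementary F T (n k) (\<tau> k) (\<Psi> k)"
    and lim1: "(\<lambda>k. \<integral>\<^sup>+\<omega>. (\<integral>\<^sup>+u\<in>{0..T}.
           ennreal (L20_norm_sq Q (elementary_process (n k) (\<tau> k) (\<Psi> k) u \<omega> - A u \<omega>)) \<partial>lborel) \<partial>M) \<longlonglongrightarrow> 0"
    and lim2: "(\<lambda>k. \<integral>\<^sup>+\<omega>. ennreal ((norm (elementary_integral W (n k) (\<tau> k) (\<Psi> k) t \<omega> - I t \<omega>))\<^sup>2) \<partial>M) \<longlonglongrightarrow> 0"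
    by blast
  have "0 \<le> t" using assms(2) by simp
  then have "\<forall>k. \<exists>S h. elem_int S h \<and>
    (\<forall>\<omega>\<in>space M. S \<omega> = v \<bullet> elementary_integral W (n k) (\<tau> k) (\<Psi> k) t \<omega>) \<and>
    (\<forall>\<omega>\<in>space M. \<forall>u. h \<omega> u = indicator {0..t} u *\<^sub>R adjoint (blinfun_apply (elementary_process (n k) (\<tau> k) (\<Psi> k) u \<omega>)) v)"
    using elementary_elem_int[OF el] by blast
  then obtain S h where Sh: "\<And>k. elem_int (S k) (h k)"
    "\<And>k \<omega>. \<omega> \<in> space M \<Longrightarrow> S k \<omega> = v \<bullet> elementary_integral W (n k) (\<tau> k) (\<Psi> k) t \<omega>"
    "\<And>k \<omega> u. \<omega> \<in> space M \<Longrightarrow> h k \<omega> u = indicator {0..t} u *\<^sub>R adjoint (blinfun_apply (elementary_process (n k) (\<tau> k) (\<Psi> k) u \<omega>)) v"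
    by metis
  have null: "g \<longlonglongrightarrow> 0" if "f \<longlonglongrightarrow> 0" "\<And>k. g k \<le> f k" for f g :: "nat \<Rightarrow> ennreal"
    by (rule tendsto_sandwich[of "\<lambda>_. 0" g _ f]) (use that in auto)
  have lim3: "(\<lambda>k. \<integral>\<^sup>+\<omega>. ennreal ((S k \<omega> - v \<bullet> I t \<omega>)\<^sup>2) \<partial>M) \<longlonglongrightarrow> 0"
  proof (rule null[OF lim2], rule nn_integral_mono)
    fix k \<omega> assume "\<omega> \<in> space M"
    then have "S k \<omega> - v \<bullet> I t \<omega> = v \<bullet> (elementary_integral W (n k) (\<tau> k) (\<Psi> k) t \<omega> - I t \<omega>)"
      by (simp add: Sh(2) inner_diff_right)
    then have "(S k \<omega> - v \<bullet> I t \<omega>)\<^sup>2 \<le> (norm (elementary_integral W (n k) (\<tau> k) (\<Psi> k) t \<omega> - I t \<omega>))\<^sup>2"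
      using Cauchy_Schwarz_ineq[of v] assms(3) by (simp add: power2_norm_eq_inner norm_eq_1)
    then show "ennreal ((S k \<omega> - v \<bullet> I t \<omega>)\<^sup>2) \<le> ennreal ((norm (elementary_integral W (n k) (\<tau> k) (\<Psi> k) t \<omega> - I t \<omega>))\<^sup>2)"
      by (rule ennreal_leI)
  qed
  have lim4: "(\<lambda>k. \<integral>\<^sup>+\<omega>. \<integral>\<^sup>+u. ennreal (qform (h k \<omega> u - adj_process t v A \<omega> u)) \<partial>lborel \<partial>M) \<longlonglongrightarrow> 0"
  proof (rule null[OF lim1], intro nn_integral_mono)
    fix k \<omega> u assume w: "\<omega> \<in> space M"
    let ?D = "elementary_process (n k) (\<tau> k) (\<Psi> k) u \<omega> - A u \<omega>"
    have "h k \<omega> u - adj_process t v A \<omega> u = indicator {0..t} u *\<^sub>R adjoint (blinfun_apply ?D) v"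
      by (simp add: Sh(3)[OF w] adj_process_def adjoint_diff scaleR_diff_right)
    moreover have "ennreal (qform (adjoint (blinfun_apply ?D) v)) \<le> ennreal (L20_norm_sq Q ?D)"
      using qform_adjoint_le[of ?D v] assms(3) by simp
    moreover have "qform 0 = 0" by (simp add: qform_def)
    ultimately show "ennreal (qform (h k \<omega> u - adj_process t v A \<omega> u)) \<le> ennreal (L20_norm_sq Q ?D) * indicator {0..T} u"
      using assms(2) by (auto simp: indicator_def)
  qed
  show ?thesis using Sh(1) lim3 lim4 by blast
qed

text \<open>Up to a constant this is the Ito isometry for the difference of two integrals. Two
  three-term splittings, one for the integrals and one for the integrands, contribute a factor
  \<open>3\<close> each; the four outer terms tend to \<open>0\<close>.\<close>

lemma ito_integral_difference_bound:
  assumes I: "has_ito_integral M F Q W T A I" and J: "has_ito_integral M F Q W T B J"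
    and t: "t \<in> {0..T}" and v: "norm v = 1"
    and [measurable]: "(\<lambda>(\<omega>, u). adj_process t v A \<omega> u) \<in> borel_measurable (M \<Otimes>\<^sub>M lborel)"
      "(\<lambda>(\<omega>, u). adj_process t v B \<omega> u) \<in> borel_measurable (M \<Otimes>\<^sub>M lborel)"
  shows "(\<integral>\<^sup>+\<omega>. ennreal ((v \<bullet> (I t \<omega> - J t \<omega>))\<^sup>2) \<partial>M)
    \<le> 9 * (\<integral>\<^sup>+\<omega>. \<integral>\<^sup>+u. ennreal (qform (adj_process t v A \<omega> u - adj_process t v B \<omega> u)) \<partial>lborel \<partial>M)"
proof -
  obtain S h where Sh: "\<And>k::nat. elem_int (S k) (h k)"
    "(\<lambda>k. \<integral>\<^sup>+\<omega>. ennreal ((S k \<omega> - v \<bullet> I t \<omega>)\<^sup>2) \<partial>M) \<longlonglongrightarrow> 0"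
    "(\<lambda>k. \<integral>\<^sup>+\<omega>. \<integral>\<^sup>+u. ennreal (qform (h k \<omega> u - adj_process t v A \<omega> u)) \<partial>lborel \<partial>M) \<longlonglongrightarrow> 0"
    using ito_integral_approx[OF I t v] by auto
  obtain S' h' where Sh': "\<And>k::nat. elem_int (S' k) (h' k)"
    "(\<lambda>k. \<integral>\<^sup>+\<omega>. ennreal ((S' k \<omega> - v \<bullet> J t \<omega>)\<^sup>2) \<partial>M) \<longlonglongrightarrow> 0"
    "(\<lambda>k. \<integral>\<^sup>+\<omega>. \<integral>\<^sup>+u. ennreal (qform (h' k \<omega> u - adj_process t v B \<omega> u)) \<partial>lborel \<partial>M) \<longlonglongrightarrow> 0"
    using ito_integral_approx[OF J t v] by auto
  have [measurable]: "I t \<in> borel_measurable M" "J t \<in> borel_measurable M"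
    using I J t measurable_F unfolding has_ito_integral_def by (meson atLeastAtMost_iff)+
  have [measurable]: "S k \<in> borel_measurable M" "S' k \<in> borel_measurable M"
    "(\<lambda>(\<omega>, u). h k \<omega> u) \<in> borel_measurable (M \<Otimes>\<^sub>M lborel)"
    "(\<lambda>(\<omega>, u). h' k \<omega> u) \<in> borel_measurable (M \<Otimes>\<^sub>M lborel)" for k
    using elem_int_measurable[OF Sh(1)] elem_int_measurable[OF Sh'(1)] by auto
  define a a' e e' where "a k = (\<integral>\<^sup>+\<omega>. ennreal ((S k \<omega> - v \<bullet> I t \<omega>)\<^sup>2) \<partial>M)"
    and "a' k = (\<integral>\<^sup>+\<omega>. ennreal ((S' k \<omega> - v \<bullet> J t \<omega>)\<^sup>2) \<partial>M)"
    and "e k = (\<integral>\<^sup>+\<omega>. \<integral>\<^sup>+u. ennreal (qform (h k \<omega> u - adj_process t v A \<omega> u)) \<partial>lborel \<partial>M)"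
    and "e' k = (\<integral>\<^sup>+\<omega>. \<integral>\<^sup>+u. ennreal (qform (h' k \<omega> u - adj_process t v B \<omega> u)) \<partial>lborel \<partial>M)" for k
  define X where "X = (\<integral>\<^sup>+\<omega>. ennreal ((v \<bullet> (I t \<omega> - J t \<omega>))\<^sup>2) \<partial>M)"
  define Y where "Y = (\<integral>\<^sup>+\<omega>. \<integral>\<^sup>+u. ennreal (qform (adj_process t v A \<omega> u - adj_process t v B \<omega> u)) \<partial>lborel \<partial>M)"
  have 1: "X \<le> 3 * (a k + (\<integral>\<^sup>+\<omega>. ennreal ((S k \<omega> - S' k \<omega>)\<^sup>2) \<partial>M) + a' k)" for k
    unfolding X_def a_def a'_def
  proof (rule nn_integral_sum3_le)
    fix \<omega>
    have "v \<bullet> (I t \<omega> - J t \<omega>) = (- (S k \<omega> - v \<bullet> I t \<omega>)) + (S k \<omega> - S' k \<omega>) + (S' k \<omega> - v \<bullet> J t \<omega>)"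
      by (simp add: inner_diff_right)
    then show "ennreal ((v \<bullet> (I t \<omega> - J t \<omega>))\<^sup>2)
        \<le> 3 * (ennreal ((S k \<omega> - v \<bullet> I t \<omega>)\<^sup>2) + ennreal ((S k \<omega> - S' k \<omega>)\<^sup>2) + ennreal ((S' k \<omega> - v \<bullet> J t \<omega>)\<^sup>2))"
      using sum3_power2_le[of "- (S k \<omega> - v \<bullet> I t \<omega>)" "S k \<omega> - S' k \<omega>" "S' k \<omega> - v \<bullet> J t \<omega>"]
      by (intro ennreal_sum3_le) (simp_all add: power2_commute)
  qed measurable
  have 2: "(\<integral>\<^sup>+\<omega>. ennreal ((S k \<omega> - S' k \<omega>)\<^sup>2) \<partial>M) \<le> 3 * (e k + Y + e' k)" for k
    unfolding elem_int_isometry[OF elem_int_diff[OF Sh(1) Sh'(1)]] e_def e'_def Y_def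
  proof (rule nn_integral_sum3_le, measurable, rule nn_integral_sum3_le)
    fix \<omega> u
    let ?x = "h k \<omega> u - adj_process t v A \<omega> u" and ?y = "adj_process t v A \<omega> u - adj_process t v B \<omega> u"
      and ?z = "h' k \<omega> u - adj_process t v B \<omega> u"
    have "h k \<omega> u - h' k \<omega> u = ?x + ?y + (-1) *\<^sub>R ?z" by simp
    then have "qform (h k \<omega> u - h' k \<omega> u) \<le> 3 * (qform ?x + qform ?y + qform ?z)"
      using qform_add3[of ?x ?y "(-1) *\<^sub>R ?z"] unfolding qform_scaleR by simp
    then show "ennreal (qform (h k \<omega> u - h' k \<omega> u)) \<le> 3 * (ennreal (qform ?x) + ennreal (qform ?y) + ennreal (qform ?z))"
      by (intro ennreal_sum3_le) auto
  qed measurable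
  have "X \<le> 3 * (a k + 3 * (e k + Y + e' k) + a' k)" for k
    using 1[of k] 2[of k] by (meson add_left_mono add_right_mono mult_left_mono order_trans zero_le)
  moreover have "(\<lambda>k. 3 * (a k + 3 * (e k + Y + e' k) + a' k)) \<longlonglongrightarrow> 3 * (0 + 3 * (0 + Y + 0) + 0)"
    using Sh(2,3) Sh'(2,3) unfolding a_def[symmetric] a'_def[symmetric] e_def[symmetric] e'_def[symmetric]
    by (intro ennreal_tendsto_cmult tendsto_add tendsto_const) auto
  ultimately have "X \<le> 3 * (0 + 3 * (0 + Y + 0) + 0)"
    by (intro LIMSEQ_le_const) auto
  then show ?thesis unfolding X_def[symmetric] Y_def[symmetric] by (simp flip: mult.assoc)
qed

end

section \<open>Distance between two solutions\<close>

text \<open>A continuous process is the pointwise limit of its values at the grid points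
  \<open>\<lfloor>n u\<rfloor> / n\<close>, and each of these discretisations involves only
  countably many measurable functions. The grid time is clamped to \<open>{0..T}\<close>,
  since nothing is known about \<open>X\<close> at other times.\<close>

lemma jointly_measurable_if_continuous:
  fixes X :: "real \<Rightarrow> 'w \<Rightarrow> 'b::{banach, second_countable_topology}"
  assumes T: "0 \<le> T" and meas: "\<And>t. t \<in> {0..T} \<Longrightarrow> X t \<in> borel_measurable M"
    and cont: "\<And>\<omega>. \<omega> \<in> space M \<Longrightarrow> continuous_on {0..T} (\<lambda>t. X t \<omega>)"
  shows "(\<lambda>(\<omega>, u). indicator {0..T} u *\<^sub>R X u \<omega>) \<in> borel_measurable (M \<Otimes>\<^sub>M lborel)"
proof -
  define c where "c x = max 0 (min T x)" for x :: real
  define r where "r n i = real_of_int i / real (Suc n)" for n i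
  define Y where "Y n = (\<lambda>(\<omega>, u). indicator {0..T} u *\<^sub>R X (c (r n \<lfloor>real (Suc n) * u\<rfloor>)) \<omega>)" for n
  have c: "c x \<in> {0..T}" for x using T by (auto simp: c_def)
  show ?thesis
  proof (rule borel_measurable_LIMSEQ_metric)
    fix n
    have [measurable]: "X (c (r n i)) \<in> borel_measurable M" for i by (intro meas c)
    have "(\<lambda>x. X (c (r n \<lfloor>real (Suc n) * snd x\<rfloor>)) (fst x)) \<in> borel_measurable (M \<Otimes>\<^sub>M lborel)"
      by (rule measurable_compose_countable[where g="\<lambda>x. \<lfloor>real (Suc n) * snd x\<rfloor>"]) measurable
    then show "Y n \<in> borel_measurable (M \<Otimes>\<^sub>M lborel)"
      unfolding Y_def split_beta by measurable
  next
    fix x :: "'w \<times> real" assume "x \<in> space (M \<Otimes>\<^sub>M lborel)"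
    then obtain \<omega> u where x: "x = (\<omega>, u)" "\<omega> \<in> space M" by (auto simp: space_pair_measure)
    show "(\<lambda>n. Y n x) \<longlonglongrightarrow> (case x of (\<omega>, u) \<Rightarrow> indicator {0..T} u *\<^sub>R X u \<omega>)"
    proof (cases "u \<in> {0..T}")
      case False
      then show ?thesis by (simp add: x Y_def)
    next
      case True
      have lim: "(\<lambda>n. r n \<lfloor>real (Suc n) * u\<rfloor>) \<longlonglongrightarrow> u"
      proof (rule tendsto_sandwich)
        have "real_of_int \<lfloor>real (Suc n) * u\<rfloor> \<ge> real (Suc n) * u - 1" for n by linarith
        then have "u - 1 / real (Suc n) \<le> r n \<lfloor>real (Suc n) * u\<rfloor>" for n
          unfolding r_def using divide_right_mono[of "real (Suc n) * u - 1" _ "real (Suc n)"]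
          by (simp add: diff_divide_distrib del: of_nat_Suc)
        then show "\<forall>\<^sub>F n in sequentially. u - 1 / real (Suc n) \<le> r n \<lfloor>real (Suc n) * u\<rfloor>" by simp
        have "real_of_int \<lfloor>real (Suc n) * u\<rfloor> \<le> real (Suc n) * u" for n by linarith
        then have "r n \<lfloor>real (Suc n) * u\<rfloor> \<le> u" for n
          unfolding r_def by (simp add: divide_le_eq mult.commute del: of_nat_Suc)
        then show "\<forall>\<^sub>F n in sequentially. r n \<lfloor>real (Suc n) * u\<rfloor> \<le> u" by simp
        have "(\<lambda>n. u - 1 / real (Suc n)) \<longlonglongrightarrow> u - 0"
          by (intro tendsto_intros LIMSEQ_Suc[OF lim_1_over_n])
        then show "(\<lambda>n. u - 1 / real (Suc n)) \<longlonglongrightarrow> u" by simp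
      qed simp
      have "(\<lambda>n. c (r n \<lfloor>real (Suc n) * u\<rfloor>)) \<longlonglongrightarrow> c u"
        unfolding c_def by (intro tendsto_intros lim)
      moreover have "c u = u" using True by (simp add: c_def)
      ultimately have "(\<lambda>n. c (r n \<lfloor>real (Suc n) * u\<rfloor>)) \<longlonglongrightarrow> u" by simp
      from continuous_on_tendsto_compose[OF cont[OF x(2)] this True] c
      have "(\<lambda>n. X (c (r n \<lfloor>real (Suc n) * u\<rfloor>)) \<omega>) \<longlonglongrightarrow> X u \<omega>" by simp
      then show ?thesis using True by (simp add: x Y_def)
    qed
  qed
qed

text \<open>The Cauchy--Schwarz inequality against the constant function
  \<open>1\<close>.\<close>

lemma set_integral_norm_square_le:
  fixes f :: "real \<Rightarrow> 'b::{banach, second_countable_topology}"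
  assumes "continuous_on {0..t} f" "0 \<le> t"
  shows "ennreal ((norm (LINT s:{0..t}|lborel. f s))\<^sup>2)
    \<le> ennreal t * (\<integral>\<^sup>+s\<in>{0..t}. ennreal ((norm (f s))\<^sup>2) \<partial>lborel)"
proof -
  let ?f = "\<lambda>s. indicator {0..t} s *\<^sub>R f s"
  have i: "integrable lborel ?f"
    using borel_integrable_atLeastAtMost'[OF assms(1)] unfolding set_integrable_def .
  then have [measurable]: "?f \<in> borel_measurable lborel" by simp
  have "norm (LINT s:{0..t}|lborel. f s) \<le> (\<integral>\<^sup>+s. ennreal (norm (?f s)) \<partial>lborel)"
    unfolding set_lebesgue_integral_def by (rule integral_norm_bound_ennreal[OF i])
  also have "\<dots> = (\<integral>\<^sup>+s. ennreal (norm (?f s)) * indicator {0..t} s \<partial>lborel)"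
    by (intro nn_integral_cong) (auto simp: indicator_def)
  finally have "(ennreal (norm (LINT s:{0..t}|lborel. f s)))\<^sup>2
      \<le> (\<integral>\<^sup>+s. ennreal (norm (?f s)) * indicator {0..t} s \<partial>lborel)\<^sup>2"
    by (intro power_mono) auto
  also have "\<dots> \<le> (\<integral>\<^sup>+s. (ennreal (norm (?f s)))\<^sup>2 \<partial>lborel) * (\<integral>\<^sup>+s. (indicator {0..t} s)\<^sup>2 \<partial>lborel)"
    by (intro Cauchy_Schwarz_nn_integral) measurable
  also have "(\<integral>\<^sup>+s. (ennreal (norm (?f s)))\<^sup>2 \<partial>lborel) = (\<integral>\<^sup>+s\<in>{0..t}. ennreal ((norm (f s))\<^sup>2) \<partial>lborel)"
    by (intro nn_integral_cong) (auto simp: indicator_def ennreal_power)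
  also have "(\<integral>\<^sup>+s. (indicator {0..t} s)\<^sup>2 \<partial>lborel) = (\<integral>\<^sup>+s. indicator {0..t} s \<partial>lborel)"
    by (intro nn_integral_cong) (auto simp: indicator_def)
  also have "\<dots> = ennreal t" using assms(2) by simp
  finally show ?thesis by (simp add: ennreal_power mult.commute)
qed

lemma sum2_power2_le: "(a + b)\<^sup>2 \<le> 2 * a\<^sup>2 + 2 * (b::real)\<^sup>2"
  using sum_squares_bound[of a b] by (simp add: power2_sum)

context wiener_process
begin

lemma qform_sum_nonneg [simp]: "0 \<le> (\<Sum>e\<in>B. qform e)"
  by (simp add: sum_nonneg)

text \<open>The diffusion is a scalar multiple of the self-adjoint projection onto
  \<open>V\<close>, which fixes \<open>v\<close>.\<close>

lemma adj_process_diffusion: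
  assumes "subspace V" "\<forall>x. \<exists>v\<in>V. \<exists>w\<in>V\<^sup>\<bottom>. x = v + w" "v \<in> V"
  shows "adj_process t v (\<lambda>u \<omega>. \<sigma> *\<^sub>R diffusion V (P u \<omega>)) \<omega> u = (indicator {0..t} u * (\<sigma> * norm (P u \<omega>))) *\<^sub>R v"
proof -
  have "adjoint (blinfun_apply (\<sigma> *\<^sub>R diffusion V (P u \<omega>))) v = (\<sigma> * norm (P u \<omega>)) *\<^sub>R v"
    by (rule adjoint_blinfun_eqI)
      (simp add: diffusion_def blinfun.scaleR_left bounded_linear_Blinfun_apply[OF bounded_linear_orth_proj[OF assms(1,2)]]
        orth_proj_inner[OF assms])
  then show ?thesis by (simp add: adj_process_def)
qed

text \<open>Since \<open>X t - Y t\<close> lies in \<open>V\<close>, its squared norm is the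
  sum of squares of its coordinates in the basis \<open>B\<close> of \<open>V\<close>. The
  initial values cancel. The drift part is estimated by the Cauchy--Schwarz inequality in
  time, the stochastic part by \<open>ito_integral_difference_bound\<close> together with the
  fact that the diffusion coefficient involves its argument only through the norm, which is
  \<open>1\<close>-Lipschitz. Tonelli's theorem then exchanges time integral and
  expectation.\<close>

lemma strong_solution_gap:
  fixes V :: "'h set" and E :: "'h \<Rightarrow> real"
  assumes V: "subspace V" "\<forall>x. \<exists>v\<in>V. \<exists>w\<in>V\<^sup>\<bottom>. x = v + w"
    and B: "finite B" "orthonormal B" "span B = V"
    and T: "0 \<le> T"
    and X: "strong_solution M F Q W V E \<alpha> lam \<sigma> \<xi> T \<mu> X"
    and Y: "strong_solution M F Q W V E \<alpha> lam \<sigma> \<xi> T \<nu> Y"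
    and m: "continuous_on {0..T} (\<lambda>s. consensus_point \<alpha> E (\<mu> s))"
      "continuous_on {0..T} (\<lambda>s. consensus_point \<alpha> E (\<nu> s))"
    and t: "t \<in> {0..T}" and inV: "AE \<omega> in M. X t \<omega> \<in> V" "AE \<omega> in M. Y t \<omega> \<in> V"
  shows "(\<integral>\<^sup>+\<omega>. ennreal ((norm (X t \<omega> - Y t \<omega>))\<^sup>2) \<partial>M)
    \<le> ennreal (2 * lam\<^sup>2 * T + 18 * \<sigma>\<^sup>2 * (\<Sum>v\<in>B. qform v)) *
      (\<integral>\<^sup>+s\<in>{0..T}. (\<integral>\<^sup>+\<omega>. ennreal ((norm ((X s \<omega> - consensus_point \<alpha> E (\<mu> s)) -
         (Y s \<omega> - consensus_point \<alpha> E (\<nu> s))))\<^sup>2) \<partial>M) \<partial>lborel)"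
proof -
  define P P' where "P s \<omega> = X s \<omega> - consensus_point \<alpha> E (\<mu> s)"
    and "P' s \<omega> = Y s \<omega> - consensus_point \<alpha> E (\<nu> s)" for s \<omega>
  define Z where "Z s \<omega> = P s \<omega> - P' s \<omega>" for s \<omega>
  have t0: "0 \<le> t" "t \<le> T" using t by auto
  from X[unfolded strong_solution_def, folded P_def] obtain I where
      Xm: "\<And>s. s \<in> {0..T} \<Longrightarrow> X s \<in> borel_measurable (F s)"
    and Xc: "\<And>\<omega>. \<omega> \<in> space M \<Longrightarrow> continuous_on {0..T} (\<lambda>s. X s \<omega>)"
    and I: "has_ito_integral M F Q W T (\<lambda>t \<omega>. \<sigma> *\<^sub>R diffusion V (P t \<omega>)) I"
    and Xeq: "AE \<omega> in M. \<forall>t\<in>{0..T}. X t \<omega> = \<xi> \<omega> + (LINT s:{0..t}|lborel. - lam *\<^sub>R P s \<omega>) + I t \<omega>"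
    by blast
  from Y[unfolded strong_solution_def, folded P'_def] obtain J where
      Ym: "\<And>s. s \<in> {0..T} \<Longrightarrow> Y s \<in> borel_measurable (F s)"
    and Yc: "\<And>\<omega>. \<omega> \<in> space M \<Longrightarrow> continuous_on {0..T} (\<lambda>s. Y s \<omega>)"
    and J: "has_ito_integral M F Q W T (\<lambda>t \<omega>. \<sigma> *\<^sub>R diffusion V (P' t \<omega>)) J"
    and Yeq: "AE \<omega> in M. \<forall>t\<in>{0..T}. Y t \<omega> = \<xi> \<omega> + (LINT s:{0..t}|lborel. - lam *\<^sub>R P' s \<omega>) + J t \<omega>"
    by blast
  have Pm: "P s \<in> borel_measurable M" "P' s \<in> borel_measurable M" if "s \<in> {0..T}" for s
    using measurable_F[OF Xm] measurable_F[OF Ym] that unfolding P_def[abs_def] P'_def[abs_def] by auto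
  have Pc: "continuous_on {0..T} (\<lambda>s. P s \<omega>)" "continuous_on {0..T} (\<lambda>s. P' s \<omega>)" if "\<omega> \<in> space M" for \<omega>
    using Xc[OF that] Yc[OF that] m unfolding P_def P'_def by (auto intro!: continuous_intros)
  have [measurable]: "(\<lambda>(\<omega>, u). indicator {0..T} u *\<^sub>R P u \<omega>) \<in> borel_measurable (M \<Otimes>\<^sub>M lborel)"
    "(\<lambda>(\<omega>, u). indicator {0..T} u *\<^sub>R P' u \<omega>) \<in> borel_measurable (M \<Otimes>\<^sub>M lborel)"
    using jointly_measurable_if_continuous[OF T Pm(1) Pc(1)] jointly_measurable_if_continuous[OF T Pm(2) Pc(2)] by auto
  have [measurable]: "I t \<in> borel_measurable M" "J t \<in> borel_measurable M"
    using I J t measurable_F unfolding has_ito_integral_def by (meson atLeastAtMost_iff)+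
  define H where "H = (\<integral>\<^sup>+\<omega>. (\<integral>\<^sup>+s\<in>{0..T}. ennreal ((norm (Z s \<omega>))\<^sup>2) \<partial>lborel) \<partial>M)"
  have Zeq: "ennreal ((norm (Z s \<omega>))\<^sup>2) * indicator {0..T} s
      = ennreal ((norm (indicator {0..T} s *\<^sub>R P s \<omega> - indicator {0..T} s *\<^sub>R P' s \<omega>))\<^sup>2)" for s \<omega>
    by (auto simp: Z_def indicator_def)
  have jm [measurable]: "(\<lambda>(\<omega>, s). ennreal ((norm (Z s \<omega>))\<^sup>2) * indicator {0..T} s) \<in> borel_measurable (M \<Otimes>\<^sub>M lborel)"
    unfolding Zeq by measurable
  have sec: "(\<lambda>s. ennreal ((norm (Z s \<omega>))\<^sup>2) * indicator {0..T} s) \<in> borel_measurable lborel" if "\<omega> \<in> space M" for \<omega>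
    using measurable_Pair2[OF jm that] by simp
  have ito: "(\<integral>\<^sup>+\<omega>. ennreal ((v \<bullet> (I t \<omega> - J t \<omega>))\<^sup>2) \<partial>M) \<le> ennreal (9 * \<sigma>\<^sup>2 * qform v) * H" if v: "v \<in> B" for v
  proof -
    have vV: "v \<in> V" using v B(3) span_base by blast
    have nv: "norm v = 1" using v B(2) by (simp add: orthonormal_def)
    let ?a = "adj_process t v (\<lambda>t \<omega>. \<sigma> *\<^sub>R diffusion V (P t \<omega>))"
    let ?b = "adj_process t v (\<lambda>t \<omega>. \<sigma> *\<^sub>R diffusion V (P' t \<omega>))"
    have a: "?a \<omega> u = (indicator {0..t} u * (\<sigma> * norm (P u \<omega>))) *\<^sub>R v"
      and b: "?b \<omega> u = (indicator {0..t} u * (\<sigma> * norm (P' u \<omega>))) *\<^sub>R v" for \<omega> u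
      using adj_process_diffusion[OF V vV, of t \<sigma> P \<omega> u] adj_process_diffusion[OF V vV, of t \<sigma> P' \<omega> u] by auto
    \<comment> \<open>\<open>P\<close> and \<open>P'\<close> are known to be jointly measurable only after cutting off at \<open>T\<close>\<close>
    have a': "?a \<omega> u = (indicator {0..t} u * (\<sigma> * norm (indicator {0..T} u *\<^sub>R P u \<omega>))) *\<^sub>R v"
      and b': "?b \<omega> u = (indicator {0..t} u * (\<sigma> * norm (indicator {0..T} u *\<^sub>R P' u \<omega>))) *\<^sub>R v" for \<omega> u
      unfolding a b using t0 by (auto simp: indicator_def)
    have meas: "(\<lambda>(\<omega>, u). ?a \<omega> u) \<in> borel_measurable (M \<Otimes>\<^sub>M lborel)"
      "(\<lambda>(\<omega>, u). ?b \<omega> u) \<in> borel_measurable (M \<Otimes>\<^sub>M lborel)"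
      unfolding a' b' by measurable
    have "(\<integral>\<^sup>+\<omega>. ennreal ((v \<bullet> (I t \<omega> - J t \<omega>))\<^sup>2) \<partial>M)
      \<le> 9 * (\<integral>\<^sup>+\<omega>. \<integral>\<^sup>+u. ennreal (qform (?a \<omega> u - ?b \<omega> u)) \<partial>lborel \<partial>M)"
      by (rule ito_integral_difference_bound[OF I J t nv meas])
    also have "\<dots> \<le> 9 * (\<integral>\<^sup>+\<omega>. \<integral>\<^sup>+u. ennreal (\<sigma>\<^sup>2 * qform v) * (ennreal ((norm (Z u \<omega>))\<^sup>2) * indicator {0..T} u) \<partial>lborel \<partial>M)"
    proof (intro mult_left_mono nn_integral_mono)
      fix \<omega> u
      show "ennreal (qform (?a \<omega> u - ?b \<omega> u)) \<le> ennreal (\<sigma>\<^sup>2 * qform v) * (ennreal ((norm (Z u \<omega>))\<^sup>2) * indicator {0..T} u)"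
      proof (cases "u \<in> {0..t}")
        case False
        then show ?thesis by (simp add: a b qform_def)
      next
        case True
        have "\<bar>norm (P u \<omega>) - norm (P' u \<omega>)\<bar> \<le> norm (Z u \<omega>)"
          unfolding Z_def by (rule norm_triangle_ineq3)
        then have "(norm (P u \<omega>) - norm (P' u \<omega>))\<^sup>2 \<le> (norm (Z u \<omega>))\<^sup>2"
          by (metis abs_le_square_iff abs_norm_cancel)
        then have "\<sigma>\<^sup>2 * qform v * (norm (P u \<omega>) - norm (P' u \<omega>))\<^sup>2 \<le> \<sigma>\<^sup>2 * qform v * (norm (Z u \<omega>))\<^sup>2"
          by (intro mult_left_mono) auto
        moreover have "?a \<omega> u - ?b \<omega> u = (\<sigma> * (norm (P u \<omega>) - norm (P' u \<omega>))) *\<^sub>R v"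
          using True unfolding a b by (simp add: scaleR_diff_left right_diff_distrib)
        then have "qform (?a \<omega> u - ?b \<omega> u) = \<sigma>\<^sup>2 * qform v * (norm (P u \<omega>) - norm (P' u \<omega>))\<^sup>2"
          by (simp add: qform_scaleR power_mult_distrib mult_ac)
        ultimately have "ennreal (qform (?a \<omega> u - ?b \<omega> u)) \<le> ennreal (\<sigma>\<^sup>2 * qform v * (norm (Z u \<omega>))\<^sup>2)"
          by (intro ennreal_leI) simp
        then show ?thesis using True t0 by (simp add: ennreal_mult)
      qed
    qed simp
    also have "\<dots> = 9 * (ennreal (\<sigma>\<^sup>2 * qform v) * H)"
    proof -
      have "(\<integral>\<^sup>+\<omega>. \<integral>\<^sup>+u. ennreal (\<sigma>\<^sup>2 * qform v) * (ennreal ((norm (Z u \<omega>))\<^sup>2) * indicator {0..T} u) \<partial>lborel \<partial>M)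
          = (\<integral>\<^sup>+\<omega>. ennreal (\<sigma>\<^sup>2 * qform v) * (\<integral>\<^sup>+u\<in>{0..T}. ennreal ((norm (Z u \<omega>))\<^sup>2) \<partial>lborel) \<partial>M)"
        by (intro nn_integral_cong nn_integral_cmult sec)
      also have "\<dots> = ennreal (\<sigma>\<^sup>2 * qform v) * H"
        unfolding H_def by (rule nn_integral_cmult) measurable
      finally show ?thesis by simp
    qed
    also have "\<dots> = ennreal (9 * \<sigma>\<^sup>2 * qform v) * H"
      by (simp add: ennreal_mult mult_ac)
    finally show ?thesis .
  qed

  have pw: "AE \<omega> in M. ennreal ((norm (X t \<omega> - Y t \<omega>))\<^sup>2)
      \<le> ennreal (2 * lam\<^sup>2 * T) * (\<integral>\<^sup>+s\<in>{0..T}. ennreal ((norm (Z s \<omega>))\<^sup>2) \<partial>lborel)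
        + 2 * (\<Sum>v\<in>B. ennreal ((v \<bullet> (I t \<omega> - J t \<omega>))\<^sup>2))"
    using Xeq Yeq inV AE_space
  proof eventually_elim
    case (elim \<omega>)
    define D where "D = (LINT s:{0..t}|lborel. Z s \<omega>)"
    have c: "continuous_on {0..t} (\<lambda>s. P s \<omega>)" "continuous_on {0..t} (\<lambda>s. P' s \<omega>)"
      using continuous_on_subset[OF Pc(1)[OF elim(5)]] continuous_on_subset[OF Pc(2)[OF elim(5)]] t0 by auto
    have D: "D = (LINT s:{0..t}|lborel. P s \<omega>) - (LINT s:{0..t}|lborel. P' s \<omega>)"
      unfolding D_def Z_def using c by (intro set_integral_diff borel_integrable_atLeastAtMost')
    have eq: "X t \<omega> - Y t \<omega> = (- lam) *\<^sub>R D + (I t \<omega> - J t \<omega>)"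
      using elim(1,2) t unfolding D set_integral_scaleR_right by (simp add: scaleR_diff_right)
    have "X t \<omega> - Y t \<omega> \<in> span B" using elim(3,4) V(1) B(3) by (simp add: subspace_diff)
    then have "(norm (X t \<omega> - Y t \<omega>))\<^sup>2 = (\<Sum>v\<in>B. (v \<bullet> (X t \<omega> - Y t \<omega>))\<^sup>2)"
      by (rule span_orthonormal_expansion[OF B(2,1)])
    also have "\<dots> \<le> (\<Sum>v\<in>B. 2 * (lam\<^sup>2 * (v \<bullet> D)\<^sup>2) + 2 * (v \<bullet> (I t \<omega> - J t \<omega>))\<^sup>2)"
    proof (rule sum_mono)
      fix v
      have "v \<bullet> (X t \<omega> - Y t \<omega>) = - lam * (v \<bullet> D) + v \<bullet> (I t \<omega> - J t \<omega>)"
        unfolding eq by (simp only: inner_add_right inner_scaleR_right)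
      then show "(v \<bullet> (X t \<omega> - Y t \<omega>))\<^sup>2 \<le> 2 * (lam\<^sup>2 * (v \<bullet> D)\<^sup>2) + 2 * (v \<bullet> (I t \<omega> - J t \<omega>))\<^sup>2"
        using sum2_power2_le[of "- lam * (v \<bullet> D)" "v \<bullet> (I t \<omega> - J t \<omega>)"]
        by (simp only: power_mult_distrib power2_minus)
    qed
    also have "\<dots> = 2 * lam\<^sup>2 * (\<Sum>v\<in>B. (v \<bullet> D)\<^sup>2) + 2 * (\<Sum>v\<in>B. (v \<bullet> (I t \<omega> - J t \<omega>))\<^sup>2)"
      by (simp add: sum.distrib sum_distrib_left mult.assoc)
    also have "\<dots> \<le> 2 * lam\<^sup>2 * (norm D)\<^sup>2 + 2 * (\<Sum>v\<in>B. (v \<bullet> (I t \<omega> - J t \<omega>))\<^sup>2)"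
      by (intro add_right_mono mult_left_mono bessel B) auto
    finally have "ennreal ((norm (X t \<omega> - Y t \<omega>))\<^sup>2)
        \<le> ennreal (2 * lam\<^sup>2 * (norm D)\<^sup>2 + 2 * (\<Sum>v\<in>B. (v \<bullet> (I t \<omega> - J t \<omega>))\<^sup>2))"
      by (rule ennreal_leI)
    also have "\<dots> = ennreal (2 * lam\<^sup>2) * ennreal ((norm D)\<^sup>2) + 2 * (\<Sum>v\<in>B. ennreal ((v \<bullet> (I t \<omega> - J t \<omega>))\<^sup>2))"
      by (simp add: ennreal_plus ennreal_mult sum_nonneg sum_ennreal)
    also have "ennreal ((norm D)\<^sup>2) \<le> ennreal T * (\<integral>\<^sup>+s\<in>{0..T}. ennreal ((norm (Z s \<omega>))\<^sup>2) \<partial>lborel)"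
    proof -
      have "ennreal ((norm D)\<^sup>2) \<le> ennreal t * (\<integral>\<^sup>+s\<in>{0..t}. ennreal ((norm (Z s \<omega>))\<^sup>2) \<partial>lborel)"
        unfolding D_def Z_def using c t0 by (intro set_integral_norm_square_le continuous_intros)
      also have "\<dots> \<le> ennreal T * (\<integral>\<^sup>+s\<in>{0..T}. ennreal ((norm (Z s \<omega>))\<^sup>2) \<partial>lborel)"
        using t0 by (intro mult_mono nn_integral_mono ennreal_leI) (auto simp: indicator_def)
      finally show ?thesis .
    qed
    finally show ?case
      using T by (simp add: ennreal_mult mult.assoc add_right_mono mult_left_mono)
  qed

  have "(\<integral>\<^sup>+\<omega>. ennreal ((norm (X t \<omega> - Y t \<omega>))\<^sup>2) \<partial>M)
      \<le> (\<integral>\<^sup>+\<omega>. ennreal (2 * lam\<^sup>2 * T) * (\<integral>\<^sup>+s\<in>{0..T}. ennreal ((norm (Z s \<omega>))\<^sup>2) \<partial>lborel)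
        + 2 * (\<Sum>v\<in>B. ennreal ((v \<bullet> (I t \<omega> - J t \<omega>))\<^sup>2)) \<partial>M)"
    by (rule nn_integral_mono_AE[OF pw])
  also have "\<dots> = ennreal (2 * lam\<^sup>2 * T) * H + 2 * (\<Sum>v\<in>B. \<integral>\<^sup>+\<omega>. ennreal ((v \<bullet> (I t \<omega> - J t \<omega>))\<^sup>2) \<partial>M)"
    unfolding H_def by (simp add: nn_integral_add nn_integral_cmult nn_integral_sum del: sum_ennreal)
  also have "\<dots> \<le> ennreal (2 * lam\<^sup>2 * T) * H + 2 * (\<Sum>v\<in>B. ennreal (9 * \<sigma>\<^sup>2 * qform v) * H)"
    by (intro add_left_mono mult_left_mono sum_mono ito) auto
  also have "\<dots> = ennreal (2 * lam\<^sup>2 * T + 18 * \<sigma>\<^sup>2 * (\<Sum>v\<in>B. qform v)) * H"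
  proof -
    have "(\<Sum>v\<in>B. ennreal (9 * \<sigma>\<^sup>2 * qform v) * H) = ennreal (9 * \<sigma>\<^sup>2 * (\<Sum>v\<in>B. qform v)) * H"
      unfolding sum_distrib_right[symmetric] sum_distrib_left by (subst sum_ennreal) auto
    moreover have "2 * (ennreal x * H) = ennreal (2 * x) * H" if "0 \<le> x" for x
      using that by (simp add: ennreal_mult mult.assoc)
    from this[of "9 * \<sigma>\<^sup>2 * (\<Sum>v\<in>B. qform v)"]
    have "2 * (ennreal (9 * \<sigma>\<^sup>2 * (\<Sum>v\<in>B. qform v)) * H) = ennreal (18 * \<sigma>\<^sup>2 * (\<Sum>v\<in>B. qform v)) * H"
      by (simp add: mult.assoc)
    ultimately show ?thesis using T by (simp add: ennreal_plus distrib_right)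
  qed
  also have "H = (\<integral>\<^sup>+s\<in>{0..T}. (\<integral>\<^sup>+\<omega>. ennreal ((norm (Z s \<omega>))\<^sup>2) \<partial>M) \<partial>lborel)"
  proof -
    interpret pair_sigma_finite M lborel ..
    have "H = (\<integral>\<^sup>+s. \<integral>\<^sup>+\<omega>. ennreal ((norm (Z s \<omega>))\<^sup>2) * indicator {0..T} s \<partial>M \<partial>lborel)"
      unfolding H_def by (rule Fubini'[symmetric]) measurable
    also have "\<dots> = (\<integral>\<^sup>+s\<in>{0..T}. (\<integral>\<^sup>+\<omega>. ennreal ((norm (Z s \<omega>))\<^sup>2) \<partial>M) \<partial>lborel)"
      by (intro nn_integral_cong) (auto simp: indicator_def)
    finally show ?thesis .
  qed
  finally show ?thesis unfolding Z_def P_def P'_def .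
qed

end

section \<open>Flows of measures and the contraction\<close>

lemma flow_ball_D:
  assumes "\<mu> \<in> flow_ball V T R" "t \<in> {0..T}"
  shows "\<mu> t \<in> P2 V" "(\<integral>x. (norm x)\<^sup>2 \<partial>\<mu> t) \<le> R\<^sup>2"
    "((\<lambda>s. W2 (\<mu> s) (\<mu> t)) \<longlongrightarrow> 0) (at t within {0..T})"
  using assms unfolding flow_ball_def flows_def by auto

text \<open>The supremum is over a bounded set, because the independent coupling bounds the
  distance of any two measures in the ball by \<open>2 * R\<close>; an unbounded supremum of
  reals would be unspecified.\<close>

lemma flow_dist_upper:
  assumes "\<mu> \<in> flow_ball V T R" "\<nu> \<in> flow_ball V T R" "t \<in> {0..T}" "0 \<le> R"
  shows "W2 (\<mu> t) (\<nu> t) \<le> flow_dist T \<mu> \<nu>"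
  unfolding flow_dist_def
proof (rule cSUP_upper[OF assms(3)])
  show "bdd_above ((\<lambda>t. W2 (\<mu> t) (\<nu> t)) ` {0..T})"
    using W2_le_second_moments[OF flow_ball_D(1)[OF assms(1)] flow_ball_D(1)[OF assms(2)]
        flow_ball_D(2)[OF assms(1)] flow_ball_D(2)[OF assms(2)] assms(4)]
    by (intro bdd_aboveI[of _ "2 * R"]) auto
qed

lemma consensus_flow_continuous:
  assumes lip: "\<And>V \<mu> \<nu>. \<mu> \<in> P2 V \<Longrightarrow> \<nu> \<in> P2 V \<Longrightarrow>
           (\<integral>x. (norm x)\<^sup>2 \<partial>\<mu>) \<le> R\<^sup>2 \<Longrightarrow> (\<integral>x. (norm x)\<^sup>2 \<partial>\<nu>) \<le> R\<^sup>2 \<Longrightarrow>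
           norm (consensus_point \<alpha> E \<mu> - consensus_point \<alpha> E \<nu>) \<le> C * W2 \<mu> \<nu>"
    and \<mu>: "\<mu> \<in> flow_ball V T R"
  shows "continuous_on {0..T} (\<lambda>s. consensus_point \<alpha> E (\<mu> s))"
  unfolding continuous_on_def
proof
  fix t assume t: "t \<in> {0..T}"
  have "((\<lambda>s. C * W2 (\<mu> s) (\<mu> t)) \<longlongrightarrow> C * 0) (at t within {0..T})"
    by (intro tendsto_intros flow_ball_D(3)[OF \<mu> t])
  then have lim: "((\<lambda>s. C * W2 (\<mu> s) (\<mu> t)) \<longlongrightarrow> 0) (at t within {0..T})" by simp
  have "\<forall>\<^sub>F s in at t within {0..T}. s \<in> {0..T}" by (simp add: eventually_at_filter)
  then have "\<forall>\<^sub>F s in at t within {0..T}.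
      norm (consensus_point \<alpha> E (\<mu> s) - consensus_point \<alpha> E (\<mu> t)) \<le> C * W2 (\<mu> s) (\<mu> t)"
    by (rule eventually_mono) (rule lip[OF flow_ball_D(1)[OF \<mu>] flow_ball_D(1)[OF \<mu> t] flow_ball_D(2)[OF \<mu>] flow_ball_D(2)[OF \<mu> t]])
  then have "((\<lambda>s. consensus_point \<alpha> E (\<mu> s) - consensus_point \<alpha> E (\<mu> t)) \<longlongrightarrow> 0) (at t within {0..T})"
    by (rule Lim_null_comparison) (rule lim)
  then show "((\<lambda>s. consensus_point \<alpha> E (\<mu> s)) \<longlongrightarrow> consensus_point \<alpha> E (\<mu> t)) (at t within {0..T})"
    by (rule LIM_zero_cancel)
qed

text \<open>Where the equation has no strong solution, \<open>Phi\<close> takes the null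
  measure as value, which is not a probability measure. So a value in the ball of flows
  certifies that a solution exists.\<close>

lemma Phi_solution:
  assumes "Phi M F Q W V E \<alpha> lam \<sigma> \<xi> T \<mu> \<in> flow_ball V T R" "0 \<le> T"
  shows "\<exists>X. strong_solution M F Q W V E \<alpha> lam \<sigma> \<xi> T \<mu> X \<and>
    (\<forall>t\<in>{0..T}. Phi M F Q W V E \<alpha> lam \<sigma> \<xi> T \<mu> t = distr M borel (X t))"
proof -
  let ?S = "strong_solution M F Q W V E \<alpha> lam \<sigma> \<xi> T \<mu>"
  have ex: "\<exists>X. ?S X"
  proof (rule ccontr)
    assume "\<not> ?thesis"
    then have "Phi M F Q W V E \<alpha> lam \<sigma> \<xi> T \<mu> 0 = null_measure borel"
      using assms(2) by (simp add: Phi_def)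
    moreover have "prob_space (Phi M F Q W V E \<alpha> lam \<sigma> \<xi> T \<mu> 0)"
      using flow_ball_D(1)[OF assms(1)] assms(2) by (intro P2_D(1)) auto
    ultimately show False by (metis prob_space.emeasure_space_1 emeasure_null_measure zero_neq_one)
  qed
  then have "?S (SOME X. ?S X)" by (rule someI_ex)
  then show ?thesis using ex by (intro exI[of _ "SOME X. ?S X"]) (simp add: Phi_def)
qed

theorem lemma2p13:
  fixes M :: "'w measure" and F :: "real \<Rightarrow> 'w measure"
    and Q :: "'h::{real_inner, banach, second_countable_topology} \<Rightarrow>\<^sub>L 'h"
    and W :: "real \<Rightarrow> 'w \<Rightarrow> 'h" and \<xi> :: "'w \<Rightarrow> 'h"
    and V :: "'h set" and E :: "'h \<Rightarrow> real"
    and T T1 \<alpha> lam \<sigma> R :: real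
  assumes "infinite_dimensional TYPE('h)"
    and "covariance_operator Q"
    and "usual_conditions M F"
    and "Q_wiener_process M F Q W"
    and "\<xi> \<in> borel_measurable (F 0)"
    and "T > 0" and "\<alpha> > 0" and "lam > 0" and "\<sigma> > 0"
    and "admissible_objective E"
    and "active_subspace M V Q E \<xi>"
    and "integrable M (\<lambda>\<omega>. (norm (\<xi> \<omega>))\<^sup>2)"
    and "R > 0" and "R\<^sup>2 > (\<integral>\<omega>. (norm (\<xi> \<omega>))\<^sup>2 \<partial>M)"
    and "lam > 2 * \<sigma>\<^sup>2 * (L_D V Q)\<^sup>2"
    and "T1 \<in> {0<..T}"
    and "\<And>T0. T0 \<in> {0<..T1} \<Longrightarrow>
           Phi M F Q W V E \<alpha> lam \<sigma> \<xi> T0 ` flow_ball V T0 R \<subseteq> flow_ball V T0 R"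
  shows "\<exists>T0\<in>{0<..T1}.
           strict_contraction_on (flow_dist T0) (flow_ball V T0 R) (Phi M F Q W V E \<alpha> lam \<sigma> \<xi> T0)"
proof -
  interpret wiener_process M F Q W using assms(2-4) by unfold_locales
  have V: "subspace V" "\<forall>x. \<exists>v\<in>V. \<exists>w\<in>V\<^sup>\<bottom>. x = v + w"
    and "\<exists>B. finite B \<and> V = span B"
    using assms(11) unfolding active_subspace_def by auto
  then obtain B where B: "finite B" "orthonormal B" "span B = V"
    using finite_orthonormal_span by metis
  obtain C where C: "C > 0" and lip: "\<And>V \<mu> \<nu>. \<mu> \<in> P2 V \<Longrightarrow> \<nu> \<in> P2 V \<Longrightarrow>
           (\<integral>x. (norm x)\<^sup>2 \<partial>\<mu>) \<le> R\<^sup>2 \<Longrightarrow> (\<integral>x. (norm x)\<^sup>2 \<partial>\<nu>) \<le> R\<^sup>2 \<Longrightarrow>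
           norm (consensus_point \<alpha> E \<mu> - consensus_point \<alpha> E \<nu>) \<le> C * W2 \<mu> \<nu>"
    using consensus_point_lipschitz[OF assms(10,7,13)] by blast
  define K where "K = 2 * lam\<^sup>2 * T + 18 * \<sigma>\<^sup>2 * (\<Sum>v\<in>B. qform v)"
  have K: "K > 0" unfolding K_def using assms(6,8) by (intro add_pos_nonneg) auto
  \<comment> \<open>the choice makes the coefficients of \<open>r\<close> and \<open>d\<^sup>2\<close> below equal to \<open>1/8\<close> at most\<close>
  define T0 where "T0 = min T1 (1 / (16 * K * (1 + C\<^sup>2)))"
  have d0: "0 < 16 * K * (1 + C\<^sup>2)" using K by (intro mult_pos_pos add_pos_nonneg) auto
  have T0: "0 < T0" "T0 \<le> T1" "T0 \<le> T" using assms(16) d0 unfolding T0_def by auto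
  have small: "K * T0 * (1 + C\<^sup>2) \<le> 1 / 16"
  proof -
    have "T0 * (16 * K * (1 + C\<^sup>2)) \<le> 1"
      using d0 unfolding T0_def by (simp add: min_le_iff_disj flip: pos_le_divide_eq)
    then show ?thesis by (simp add: mult_ac)
  qed
  let ?\<Phi> = "Phi M F Q W V E \<alpha> lam \<sigma> \<xi> T0"
  have "flow_dist T0 (?\<Phi> \<mu>) (?\<Phi> \<nu>) \<le> 1 / 2 * flow_dist T0 \<mu> \<nu>"
    if \<mu>: "\<mu> \<in> flow_ball V T0 R" and \<nu>: "\<nu> \<in> flow_ball V T0 R" for \<mu> \<nu>
  proof -
    have \<Phi>: "?\<Phi> \<mu> \<in> flow_ball V T0 R" "?\<Phi> \<nu> \<in> flow_ball V T0 R"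
      using assms(17)[of T0] T0 \<mu> \<nu> by auto
    obtain X where X: "strong_solution M F Q W V E \<alpha> lam \<sigma> \<xi> T0 \<mu> X"
      "\<And>t. t \<in> {0..T0} \<Longrightarrow> ?\<Phi> \<mu> t = distr M borel (X t)"
      using Phi_solution[OF \<Phi>(1)] T0 by auto
    obtain Y where Y: "strong_solution M F Q W V E \<alpha> lam \<sigma> \<xi> T0 \<nu> Y"
      "\<And>t. t \<in> {0..T0} \<Longrightarrow> ?\<Phi> \<nu> t = distr M borel (Y t)"
      using Phi_solution[OF \<Phi>(2)] T0 by auto
    have Xm: "X t \<in> borel_measurable M" and Ym: "Y t \<in> borel_measurable M" if "t \<in> {0..T0}" for t
      using X(1)[unfolded strong_solution_def] Y(1)[unfolded strong_solution_def] that measurable_F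
      by (meson atLeastAtMost_iff)+
    have law: "AE \<omega> in M. U \<omega> \<in> V" "(\<integral>\<^sup>+\<omega>. ennreal ((norm (U \<omega>))\<^sup>2) \<partial>M) \<le> ennreal (R\<^sup>2)"
      if U: "distr M borel U \<in> P2 V" "(\<integral>x. (norm x)\<^sup>2 \<partial>distr M borel U) \<le> R\<^sup>2" "U \<in> borel_measurable M" for U
    proof -
      note P = P2_D[OF U(1)] and [measurable] = U(3)
      show "AE \<omega> in M. U \<omega> \<in> V" using P(4) by (rule AE_distrD[OF U(3)])
      have "integrable M (\<lambda>\<omega>. (norm (U \<omega>))\<^sup>2)" using P(3) by (simp add: integrable_distr_eq)
      then have "(\<integral>\<^sup>+\<omega>. ennreal ((norm (U \<omega>))\<^sup>2) \<partial>M) = ennreal (\<integral>\<omega>. (norm (U \<omega>))\<^sup>2 \<partial>M)"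
        by (intro nn_integral_eq_integral) auto
      then show "(\<integral>\<^sup>+\<omega>. ennreal ((norm (U \<omega>))\<^sup>2) \<partial>M) \<le> ennreal (R\<^sup>2)"
        using U(2) by (simp add: integral_distr ennreal_leI)
    qed
    have lawX: "AE \<omega> in M. X t \<omega> \<in> V" "(\<integral>\<^sup>+\<omega>. ennreal ((norm (X t \<omega>))\<^sup>2) \<partial>M) \<le> ennreal (R\<^sup>2)"
      if t: "t \<in> {0..T0}" for t
      by (rule law[OF flow_ball_D(1,2)[OF \<Phi>(1) t, unfolded X(2)[OF t]] Xm[OF t]])+
    have lawY: "AE \<omega> in M. Y t \<omega> \<in> V" "(\<integral>\<^sup>+\<omega>. ennreal ((norm (Y t \<omega>))\<^sup>2) \<partial>M) \<le> ennreal (R\<^sup>2)"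
      if t: "t \<in> {0..T0}" for t
      by (rule law[OF flow_ball_D(1,2)[OF \<Phi>(2) t, unfolded Y(2)[OF t]] Ym[OF t]])+

    define g where "g t = (\<integral>\<^sup>+\<omega>. ennreal ((norm (X t \<omega> - Y t \<omega>))\<^sup>2) \<partial>M)" for t
    define d where "d = flow_dist T0 \<mu> \<nu>"
    have W2d: "W2 (\<mu> t) (\<nu> t) \<le> d" if "t \<in> {0..T0}" for t
      unfolding d_def using flow_dist_upper[OF \<mu> \<nu> that] assms(13) by simp
    have "0 \<le> W2 (\<mu> 0) (\<nu> 0)" by (simp add: W2_def)
    then have d: "0 \<le> d" using W2d[of 0] T0 by simp
    \<comment> \<open>finiteness of the supremum, without which it could not be absorbed\<close>
    have g_fin: "g t \<le> ennreal (4 * R\<^sup>2)" if t: "t \<in> {0..T0}" for t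
    proof -
      note [measurable] = Xm[OF t] Ym[OF t]
      have "g t \<le> (\<integral>\<^sup>+\<omega>. 2 * ennreal ((norm (X t \<omega>))\<^sup>2) + 2 * ennreal ((norm (Y t \<omega>))\<^sup>2) \<partial>M)"
        unfolding g_def
      proof (rule nn_integral_mono)
        fix \<omega>
        show "ennreal ((norm (X t \<omega> - Y t \<omega>))\<^sup>2) \<le> 2 * ennreal ((norm (X t \<omega>))\<^sup>2) + 2 * ennreal ((norm (Y t \<omega>))\<^sup>2)"
          using ennreal_leI[OF norm_diff_power2_le[of "X t \<omega>" "Y t \<omega>"]] by (simp add: ennreal_plus ennreal_mult)
      qed
      also have "\<dots> = 2 * (\<integral>\<^sup>+\<omega>. ennreal ((norm (X t \<omega>))\<^sup>2) \<partial>M) + 2 * (\<integral>\<^sup>+\<omega>. ennreal ((norm (Y t \<omega>))\<^sup>2) \<partial>M)"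
        by (simp add: nn_integral_add nn_integral_cmult)
      also have "\<dots> \<le> 2 * ennreal (R\<^sup>2) + 2 * ennreal (R\<^sup>2)"
        by (intro add_mono mult_left_mono lawX lawY t) auto
      also have "\<dots> = ennreal (2 * R\<^sup>2 + 2 * R\<^sup>2)" by (subst ennreal_plus) (auto simp: ennreal_mult)
      finally show ?thesis by simp
    qed
    define G where "G = (SUP t\<in>{0..T0}. g t)"
    have "G \<le> ennreal (4 * R\<^sup>2)" unfolding G_def by (intro SUP_least g_fin)
    then obtain r where r: "G = ennreal r" "0 \<le> r" by (cases G) (auto simp: top_unique)
    have gr: "g t \<le> ennreal r" if "t \<in> {0..T0}" for t
      unfolding r(1)[symmetric] G_def using that by (intro SUP_upper)

    have inner: "(\<integral>\<^sup>+\<omega>. ennreal ((norm ((X s \<omega> - consensus_point \<alpha> E (\<mu> s)) -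
         (Y s \<omega> - consensus_point \<alpha> E (\<nu> s))))\<^sup>2) \<partial>M) \<le> ennreal (2 * r + 2 * (C * d)\<^sup>2)" if s: "s \<in> {0..T0}" for s
    proof -
      note [measurable] = Xm[OF s] Ym[OF s]
      let ?\<delta> = "consensus_point \<alpha> E (\<mu> s) - consensus_point \<alpha> E (\<nu> s)"
      have "norm ?\<delta> \<le> C * W2 (\<mu> s) (\<nu> s)" using flow_ball_D(1,2)[OF \<mu> s] flow_ball_D(1,2)[OF \<nu> s] by (intro lip) auto
      also have "\<dots> \<le> C * d" using W2d[OF s] C by simp
      finally have \<delta>: "(norm ?\<delta>)\<^sup>2 \<le> (C * d)\<^sup>2" by (intro power_mono) auto
      have "(\<integral>\<^sup>+\<omega>. ennreal ((norm ((X s \<omega> - consensus_point \<alpha> E (\<mu> s)) -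
         (Y s \<omega> - consensus_point \<alpha> E (\<nu> s))))\<^sup>2) \<partial>M)
         \<le> (\<integral>\<^sup>+\<omega>. 2 * ennreal ((norm (X s \<omega> - Y s \<omega>))\<^sup>2) + ennreal (2 * (C * d)\<^sup>2) \<partial>M)"
      proof (rule nn_integral_mono)
        fix \<omega>
        have eq: "(X s \<omega> - consensus_point \<alpha> E (\<mu> s)) - (Y s \<omega> - consensus_point \<alpha> E (\<nu> s)) = (X s \<omega> - Y s \<omega>) - ?\<delta>"
          by simp
        have "(norm ((X s \<omega> - consensus_point \<alpha> E (\<mu> s)) - (Y s \<omega> - consensus_point \<alpha> E (\<nu> s))))\<^sup>2
           \<le> 2 * (norm (X s \<omega> - Y s \<omega>))\<^sup>2 + 2 * (C * d)\<^sup>2"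
          unfolding eq using norm_diff_power2_le[of "X s \<omega> - Y s \<omega>" ?\<delta>] \<delta> by linarith
        from ennreal_leI[OF this] show "ennreal ((norm ((X s \<omega> - consensus_point \<alpha> E (\<mu> s)) - (Y s \<omega> - consensus_point \<alpha> E (\<nu> s))))\<^sup>2)
           \<le> 2 * ennreal ((norm (X s \<omega> - Y s \<omega>))\<^sup>2) + ennreal (2 * (C * d)\<^sup>2)"
          by (simp add: ennreal_plus ennreal_mult)
      qed
      also have "\<dots> = 2 * g s + ennreal (2 * (C * d)\<^sup>2)"
        unfolding g_def by (simp add: nn_integral_add nn_integral_cmult emeasure_space_1)
      also have "\<dots> \<le> 2 * ennreal r + ennreal (2 * (C * d)\<^sup>2)"
        by (intro add_right_mono mult_left_mono gr s) auto
      also have "\<dots> = ennreal (2 * r + 2 * (C * d)\<^sup>2)"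
        using r(2) by (subst ennreal_plus) (auto simp: ennreal_mult)
      finally show ?thesis .
    qed

    have step: "g t \<le> ennreal (K * T0 * (2 * r + 2 * (C * d)\<^sup>2))" if t: "t \<in> {0..T0}" for t
    proof -
      let ?D = "\<lambda>s. (\<integral>\<^sup>+\<omega>. ennreal ((norm ((X s \<omega> - consensus_point \<alpha> E (\<mu> s)) -
         (Y s \<omega> - consensus_point \<alpha> E (\<nu> s))))\<^sup>2) \<partial>M)"
      have "g t \<le> ennreal (2 * lam\<^sup>2 * T0 + 18 * \<sigma>\<^sup>2 * (\<Sum>v\<in>B. qform v)) * (\<integral>\<^sup>+s\<in>{0..T0}. ?D s \<partial>lborel)"
        unfolding g_def
        by (rule strong_solution_gap[OF V B _ X(1) Y(1) consensus_flow_continuous[OF lip \<mu>]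
              consensus_flow_continuous[OF lip \<nu>] t lawX(1)[OF t] lawY(1)[OF t]]) (use T0 in auto)
      also have "\<dots> \<le> ennreal K * (\<integral>\<^sup>+s. ennreal (2 * r + 2 * (C * d)\<^sup>2) * indicator {0..T0} s \<partial>lborel)"
      proof (rule mult_mono[OF _ nn_integral_mono])
        show "ennreal (2 * lam\<^sup>2 * T0 + 18 * \<sigma>\<^sup>2 * (\<Sum>v\<in>B. qform v)) \<le> ennreal K"
          unfolding K_def using T0(3) by (intro ennreal_leI add_right_mono mult_left_mono) auto
        fix s
        show "?D s * indicator {0..T0} s \<le> ennreal (2 * r + 2 * (C * d)\<^sup>2) * indicator {0..T0} s"
        proof (cases "s \<in> {0..T0}")
          case True
          then show ?thesis by (intro mult_right_mono inner) auto
        qed simp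
      qed auto
      also have "\<dots> = ennreal K * (ennreal (2 * r + 2 * (C * d)\<^sup>2) * ennreal T0)"
        using T0 by (subst nn_integral_cmult_indicator) auto
      also have "\<dots> = ennreal (K * T0 * (2 * r + 2 * (C * d)\<^sup>2))"
      proof -
        have aux: "ennreal K * (ennreal b * ennreal T0) = ennreal (K * T0 * b)" if "0 \<le> b" for b
          using that K T0 by (simp add: ennreal_mult mult_ac)
        show ?thesis by (rule aux) (use r(2) in simp)
      qed
      finally show ?thesis .
    qed
    have "G \<le> ennreal (K * T0 * (2 * r + 2 * (C * d)\<^sup>2))" unfolding G_def by (intro SUP_least step)
    then have "r \<le> K * T0 * (2 * r + 2 * (C * d)\<^sup>2)"
      unfolding r(1) using K T0 r(2) by (subst (asm) ennreal_le_iff) auto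
    also have "\<dots> = 2 * (K * T0) * r + 2 * (K * T0 * C\<^sup>2) * d\<^sup>2"
      by (simp add: power_mult_distrib algebra_simps)
    also have "\<dots> \<le> 2 * (1 / 16) * r + 2 * (1 / 16) * d\<^sup>2"
    \<comment> \<open>both products are parts of \<open>K * T0 * (1 + C\<^sup>2)\<close>\<close>
    proof -
      have nn: "0 \<le> K * T0" "0 \<le> K * T0 * C\<^sup>2" using K T0 by auto
      have "K * T0 + K * T0 * C\<^sup>2 \<le> 1 / 16" using small by (simp add: distrib_left)
      then have "K * T0 \<le> 1 / 16" "K * T0 * C\<^sup>2 \<le> 1 / 16" using nn by linarith+
      then show ?thesis using r(2) by (intro add_mono mult_right_mono mult_left_mono) auto
    qed
    finally have rd: "r \<le> (d / 2)\<^sup>2" using r(2) by (simp add: power_divide)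

    show ?thesis
      unfolding flow_dist_def[of T0 "?\<Phi> \<mu>"] d_def[symmetric]
    proof (rule cSUP_least)
      show "{0..T0} \<noteq> {}" using T0 by simp
      fix t assume t: "t \<in> {0..T0}"
      have "g t \<le> ennreal ((d / 2)\<^sup>2)" using gr[OF t] ennreal_leI[OF rd] by (rule order_trans)
      then show "W2 (?\<Phi> \<mu> t) (?\<Phi> \<nu> t) \<le> 1 / 2 * d"
        unfolding X(2)[OF t] Y(2)[OF t] g_def
        using W2_distr_le[OF prob_space_axioms Xm[OF t] Ym[OF t], of "d / 2"] d by simp
    qed
  qed
  then have "strict_contraction_on (flow_dist T0) (flow_ball V T0 R) ?\<Phi>"
    unfolding strict_contraction_on_def by (intro exI[of _ "1 / 2"]) auto
  then show ?thesis using T0 by (intro bexI[of _ T0]) auto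
qed

end
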